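(* Let $b:[0,T]\times\mathbb{R}\times\mathcal{P}_1(\mathbb{R})\to\mathbb{R}$ be a measurable function such that: (1) (linear growth) there exists a constant $C>0$ such that $|b(t,y,\mu)|\le C(1+|y|+\mathcal{K}(\mu,\delta_0))$ for all $t\in[0,T]$, $y\in\mathbb{R}$, $\mu\in\mathcal{P}_1(\mathbb{R})$; (2) (continuity in the third variable) for every $\mu\in\mathcal{P}_1(\mathbb{R})$ and every $\varepsilon>0$ there exists $\delta>0$ such that for all $\nu\in\mathcal{P}_1(\mathbb{R})$ with $\mathcal{K}(\mu,\nu)<\delta$ one has $|b(t,y,\mu)-b(t,y,\nu)|<\varepsilon$ for all $t\in[0,T]$, $y\in\mathbb{R}$. Let $x\in\mathbb{R}$. Then there exists a weak solution of the mean-field SDE $$dX_t^x=b(t,X_t^x,\mathbb{P}_{X_t^x})\,dt+dB_t,\quad X_0^x=x,\quad t\in[0,T].$$ Furthermore, for any weak solution $X^x$ of this equation, the map $t\mapsto\mathbb{P}_{X_t^x}$ belongs to $\mathcal{C}([0,T];\mathcal{P}_1(\mathbb{R}))$.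
   Context: $T>0$ is a fixed time horizon. $\mathcal{P}_1(\mathbb{R})$ is the set of Borel probability measures $\mu$ on $\mathbb{R}$ with $\int|x|\,\mu(dx)<\infty$, endowed with the Kantorovich metric $\mathcal{K}(\lambda,\nu)=\sup\{|\int_{\mathbb{R}}h\,d(\lambda-\nu)| : h:\mathbb{R}\to\mathbb{R}\text{ Lipschitz with constant }1\}$; $\delta_0$ is the Dirac measure at $0$. $\mathcal{C}([0,T];\mathcal{P}_1(\mathbb{R}))$ is the space of continuous maps into this metric space. A weak solution of the mean-field SDE is a six-tuple $(\Omega,\mathcal{F},\mathbb{F},\mathbb{P},B,X^x)$ where $(\Omega,\mathcal{F},\mathbb{P})$ is a complete probability space, $\mathbb{F}=(\mathcal{F}_t)_{t\in[0,T]}$ is a filtration satisfying the usual conditions, $B$ is a one-dimensional $(\mathbb{F},\mathbb{P})$-Brownian motion, $X^x$ is a continuous $\mathbb{F}$-adapted real-valued process, the law $\mathbb{P}_{X_t^x}$ of $X_t^x$ under $\mathbb{P}$ lies in $\mathcal{P}_1(\mathbb{R})$ for all $t\in[0,T]$, and $\mathbb{P}$-a.s. $X_t^x=x+\int_0^t b(s,X_s^x,\mathbb{P}_{X_s^x})\,ds+B_t$ for $t\in[0,T]$. *)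

theory Defs
  imports "HOL-Probability.Probability"
begin

definition P1 :: "real measure set" where
  "P1 = {\<mu>. prob_space \<mu> \<and> sets \<mu> = sets borel \<and> integrable \<mu> (\<lambda>x. \<bar>x\<bar>)}"

text \<open>
  On \<open>P1\<close> the set below is nonempty and bounded above, so \<open>Sup\<close> is the genuine supremum.
  The value outside \<open>P1\<close> is irrelevant; \<open>0\<close> is chosen because \<^locale>\<open>Metric_space\<close> asks for
  nonnegativity and symmetry on the whole type.
\<close>

definition kantorovich :: "real measure \<Rightarrow> real measure \<Rightarrow> real" where
  "kantorovich \<mu> \<nu> = (if \<mu> \<in> P1 \<and> \<nu> \<in> P1
     then Sup {\<bar>(\<integral>y. h y \<partial>\<mu>) - (\<integral>y. h y \<partial>\<nu>)\<bar> | h :: real \<Rightarrow> real. 1-lipschitz_on UNIV h}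
     else 0)"

lemma P1_D:
  assumes "\<mu> \<in> P1"
  shows "prob_space \<mu>" "sets \<mu> = sets borel" "integrable \<mu> (\<lambda>x. \<bar>x\<bar>)" "space \<mu> = UNIV"
  using assms sets_eq_imp_space_eq[of \<mu> borel] by (auto simp: P1_def)

lemma lipschitz_integrable_P1:
  fixes h :: "real \<Rightarrow> real"
  assumes "\<mu> \<in> P1" "1-lipschitz_on UNIV h"
  shows "integrable \<mu> h" "\<bar>(\<integral>y. h y \<partial>\<mu>) - h 0\<bar> \<le> (\<integral>y. \<bar>y\<bar> \<partial>\<mu>)"
proof -
  note P = P1_D[OF assms(1)]
  interpret prob_space \<mu> by (rule P)
  have l: "\<bar>h y - h 0\<bar> \<le> \<bar>y\<bar>" for y
    using lipschitz_onD[OF assms(2), of y 0] by (simp add: dist_real_def)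
  have "h \<in> borel_measurable borel"
    using lipschitz_on_continuous_on[OF assms(2)] by (rule borel_measurable_continuous_onI)
  then have m: "h \<in> borel_measurable \<mu>"
    using measurable_cong_sets[OF P(2) refl] by blast
  have i: "integrable \<mu> (\<lambda>y. h y - h 0)"
    by (rule Bochner_Integration.integrable_bound[OF P(3)]) (use m l in auto)
  have "integrable \<mu> (\<lambda>y. (h y - h 0) + h 0)"
    using i by (intro Bochner_Integration.integrable_add) auto
  then show h: "integrable \<mu> h" by simp
  have "(\<integral>y. h y \<partial>\<mu>) - h 0 = (\<integral>y. h y - h 0 \<partial>\<mu>)"
    using h by (simp add: prob_space)
  also have "\<bar>\<dots>\<bar> \<le> (\<integral>y. \<bar>h y - h 0\<bar> \<partial>\<mu>)"
    by (rule integral_abs_bound)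
  also have "\<dots> \<le> (\<integral>y. \<bar>y\<bar> \<partial>\<mu>)"
    using i P(3) l by (intro integral_mono) auto
  finally show "\<bar>(\<integral>y. h y \<partial>\<mu>) - h 0\<bar> \<le> (\<integral>y. \<bar>y\<bar> \<partial>\<mu>)" .
qed

lemma kantorovich_bdd:
  assumes "\<mu> \<in> P1" "\<nu> \<in> P1"
  shows "bdd_above {\<bar>(\<integral>y. h y \<partial>\<mu>) - (\<integral>y. h y \<partial>\<nu>)\<bar> | h :: real \<Rightarrow> real. 1-lipschitz_on UNIV h}"
proof (rule bdd_aboveI, clarify)
  fix h :: "real \<Rightarrow> real" assume h: "1-lipschitz_on UNIV h"
  show "\<bar>(\<integral>y. h y \<partial>\<mu>) - (\<integral>y. h y \<partial>\<nu>)\<bar> \<le> (\<integral>y. \<bar>y\<bar> \<partial>\<mu>) + (\<integral>y. \<bar>y\<bar> \<partial>\<nu>)"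
    using lipschitz_integrable_P1(2)[OF assms(1) h] lipschitz_integrable_P1(2)[OF assms(2) h] by linarith
qed

lemma kantorovich_upper:
  assumes "\<mu> \<in> P1" "\<nu> \<in> P1" "1-lipschitz_on UNIV (h :: real \<Rightarrow> real)"
  shows "\<bar>(\<integral>y. h y \<partial>\<mu>) - (\<integral>y. h y \<partial>\<nu>)\<bar> \<le> kantorovich \<mu> \<nu>"
proof -
  have "\<bar>(\<integral>y. h y \<partial>\<mu>) - (\<integral>y. h y \<partial>\<nu>)\<bar> \<le>
    Sup {\<bar>(\<integral>y. h y \<partial>\<mu>) - (\<integral>y. h y \<partial>\<nu>)\<bar> | h :: real \<Rightarrow> real. 1-lipschitz_on UNIV h}"
    by (rule cSup_upper[OF _ kantorovich_bdd[OF assms(1,2)]]) (use assms(3) in blast)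
  then show ?thesis using assms by (simp add: kantorovich_def)
qed

lemma lipschitz_const0: "1-lipschitz_on UNIV (\<lambda>x::real. 0::real)"
  by (auto simp: lipschitz_on_def)

lemma kantorovich_least:
  assumes "\<mu> \<in> P1" "\<nu> \<in> P1"
    and "\<And>h :: real \<Rightarrow> real. 1-lipschitz_on UNIV h \<Longrightarrow> \<bar>(\<integral>y. h y \<partial>\<mu>) - (\<integral>y. h y \<partial>\<nu>)\<bar> \<le> c"
  shows "kantorovich \<mu> \<nu> \<le> c"
proof -
  have "Sup {\<bar>(\<integral>y. h y \<partial>\<mu>) - (\<integral>y. h y \<partial>\<nu>)\<bar> | h :: real \<Rightarrow> real. 1-lipschitz_on UNIV h} \<le> c"
    by (rule cSup_least) (use assms(3) lipschitz_const0 in blast)+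
  then show ?thesis using assms(1,2) by (simp add: kantorovich_def)
qed

lemma kantorovich_eq_0_imp_eq:
  assumes "\<mu> \<in> P1" "\<nu> \<in> P1" "kantorovich \<mu> \<nu> = 0"
  shows "\<mu> = \<nu>"
proof -
  note P = P1_D[OF assms(1)] and Q = P1_D[OF assms(2)]
  interpret M: prob_space \<mu> by (rule P)
  interpret N: prob_space \<nu> by (rule Q)
  have cdf: "cdf \<mu> a = cdf \<nu> a" for a
  proof -
    define h where "h n x = max 0 (min 1 (real (Suc n) * (a - x) + 1))" for n x
    have hm: "h n \<in> borel_measurable borel" for n
      unfolding h_def by measurable
    have m: "h n \<in> borel_measurable \<mu>" "h n \<in> borel_measurable \<nu>" for n
      using hm measurable_cong_sets[OF P(2) refl] measurable_cong_sets[OF Q(2) refl] by blast+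
    have lim: "(\<lambda>n. h n x) \<longlonglongrightarrow> indicator {..a} x" for x
    proof (cases "x \<le> a")
      case True
      then have "h n x = 1" for n by (simp add: h_def)
      then show ?thesis using True by simp
    next
      case False
      then obtain k where k: "real k * (x - a) > 1" using ex_less_of_nat_mult[of "x - a" 1] by auto
      have "h n x = 0" if "n \<ge> k" for n
      proof -
        have "real k * (x - a) \<le> real (Suc n) * (x - a)"
          using that False by (intro mult_right_mono) auto
        then have "real (Suc n) * (a - x) + 1 \<le> 0" using k by (simp add: algebra_simps)
        then show ?thesis by (simp add: h_def)
      qed
      then have "eventually (\<lambda>n. h n x = 0) sequentially"
        by (auto simp: eventually_sequentially)
      then show ?thesis using False by (simp add: tendsto_eventually)
    qed
    have eq: "(\<integral>y. h n y \<partial>\<mu>) = (\<integral>y. h n y \<partial>\<nu>)" for n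
    proof -
      have "1-lipschitz_on UNIV (\<lambda>x. h n x / real (Suc n))"
      proof (rule lipschitz_onI)
        fix x y :: real
        have "\<bar>h n x - h n y\<bar> \<le> \<bar>real (Suc n) * (a - x) - real (Suc n) * (a - y)\<bar>"
          unfolding h_def by (simp only: max_def min_def split: if_split) (smt (verit))
        also have "\<dots> = real (Suc n) * \<bar>x - y\<bar>"
          by (subst right_diff_distrib[symmetric]) (simp add: abs_mult)
        finally show "dist (h n x / real (Suc n)) (h n y / real (Suc n)) \<le> 1 * dist x y"
          by (simp add: dist_real_def diff_divide_distrib[symmetric] divide_le_eq mult.commute
              del: of_nat_Suc)
      qed simp
      from kantorovich_upper[OF assms(1,2) this] show ?thesis
        using assms(3) by (simp del: of_nat_Suc)
    qed
    have b: "norm (h n x) \<le> 1" for n x by (simp add: h_def)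
    have "{..a} \<in> sets borel" by simp
    then have s: "{..a} \<in> sets \<mu>" "{..a} \<in> sets \<nu>" using P(2) Q(2) by auto
    have "(\<lambda>n. \<integral>y. h n y \<partial>\<mu>) \<longlonglongrightarrow> (\<integral>y. indicator {..a} y \<partial>\<mu>)"
      by (rule integral_dominated_convergence[where w="\<lambda>_. 1"]) (use m lim b s in auto)
    moreover have "(\<lambda>n. \<integral>y. h n y \<partial>\<nu>) \<longlonglongrightarrow> (\<integral>y. indicator {..a} y \<partial>\<nu>)"
      by (rule integral_dominated_convergence[where w="\<lambda>_. 1"]) (use m lim b s in auto)
    ultimately have "(\<integral>y. indicator {..a} y \<partial>\<mu>) = (\<integral>y. indicator {..a} y \<partial>\<nu> :: real)"
      unfolding eq by (rule LIMSEQ_unique)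
    then show ?thesis using s P(4) Q(4) by (simp add: cdf_def)
  qed
  have "real_distribution \<mu>" "real_distribution \<nu>"
    using P Q by (auto simp: real_distribution_def real_distribution_axioms_def)
  then show ?thesis using cdf by (intro cdf_unique) auto
qed

interpretation P1: Metric_space P1 kantorovich
proof
  show nn: "0 \<le> kantorovich \<mu> \<nu>" for \<mu> \<nu>
    using kantorovich_upper[OF _ _ lipschitz_const0, of \<mu> \<nu>] by (cases "\<mu> \<in> P1 \<and> \<nu> \<in> P1") (auto simp: kantorovich_def)
  show "kantorovich \<mu> \<nu> = kantorovich \<nu> \<mu>" for \<mu> \<nu>
    by (simp add: kantorovich_def abs_minus_commute)
  show "kantorovich \<mu> \<nu> = 0 \<longleftrightarrow> \<mu> = \<nu>" if "\<mu> \<in> P1" "\<nu> \<in> P1" for \<mu> \<nu>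
  proof
    assume "\<mu> = \<nu>"
    then have "kantorovich \<mu> \<nu> \<le> 0" using that by (intro kantorovich_least) auto
    then show "kantorovich \<mu> \<nu> = 0" using nn[of \<mu> \<nu>] by simp
  qed (use that kantorovich_eq_0_imp_eq in blast)
  show "kantorovich \<mu> \<rho> \<le> kantorovich \<mu> \<nu> + kantorovich \<nu> \<rho>"
    if "\<mu> \<in> P1" "\<nu> \<in> P1" "\<rho> \<in> P1" for \<mu> \<nu> \<rho>
  proof (rule kantorovich_least)
    fix h :: "real \<Rightarrow> real" assume h: "1-lipschitz_on UNIV h"
    show "\<bar>(\<integral>y. h y \<partial>\<mu>) - (\<integral>y. h y \<partial>\<rho>)\<bar> \<le> kantorovich \<mu> \<nu> + kantorovich \<nu> \<rho>"
      using kantorovich_upper[OF that(1,2) h] kantorovich_upper[OF that(2,3) h] by linarith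
  qed (use that in auto)
qed

definition borel_P1 :: "real measure measure" where
  "borel_P1 = sigma P1 {U. openin P1.mtopology U}"

text \<open>
  In the following definitions a filtration is a family of measures of which only the
  \<open>\<sigma>\<close>-algebras matter, and only the times in \<open>{0..T}\<close> are constrained.
\<close>

definition usual_filtration :: "real \<Rightarrow> 'w measure \<Rightarrow> (real \<Rightarrow> 'w measure) \<Rightarrow> bool" where
  "usual_filtration T M F \<longleftrightarrow>
     (\<forall>t\<in>{0..T}. subalgebra M (F t)) \<and>
     (\<forall>s\<in>{0..T}. \<forall>t\<in>{0..T}. s \<le> t \<longrightarrow> sets (F s) \<subseteq> sets (F t)) \<and>
     (\<forall>t\<in>{0..<T}. sets (F t) = (\<Inter>u\<in>{t<..T}. sets (F u))) \<and>
     null_sets M \<subseteq> sets (F 0)"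

definition continuous_adapted ::
    "real \<Rightarrow> 'w measure \<Rightarrow> (real \<Rightarrow> 'w measure) \<Rightarrow> (real \<Rightarrow> 'w \<Rightarrow> real) \<Rightarrow> bool" where
  "continuous_adapted T M F X \<longleftrightarrow>
     (\<forall>t\<in>{0..T}. X t \<in> borel_measurable (F t)) \<and>
     (\<forall>\<omega>\<in>space M. continuous_on {0..T} (\<lambda>t. X t \<omega>))"

definition brownian_motion ::
    "real \<Rightarrow> 'w measure \<Rightarrow> (real \<Rightarrow> 'w measure) \<Rightarrow> (real \<Rightarrow> 'w \<Rightarrow> real) \<Rightarrow> bool" where
  "brownian_motion T M F B \<longleftrightarrow>
     continuous_adapted T M F B \<and>
     (AE \<omega> in M. B 0 \<omega> = 0) \<and>
     (\<forall>s t. 0 \<le> s \<and> s < t \<and> t \<le> T \<longrightarrow>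
        distributed M lborel (\<lambda>\<omega>. B t \<omega> - B s \<omega>) (normal_density 0 (sqrt (t - s))) \<and>
        prob_space.indep_set M (sets (F s))
          (sets (vimage_algebra (space M) (\<lambda>\<omega>. B t \<omega> - B s \<omega>) borel)))"

text \<open>
  The integrability clause is part of the meaning of the equation: without it the Bochner
  integral would silently take the value \<open>0\<close> on a non-integrable drift. The initial condition
  is the equation at time \<open>0\<close>.
\<close>

definition weak_solution ::
    "real \<Rightarrow> (real \<Rightarrow> real \<Rightarrow> real measure \<Rightarrow> real) \<Rightarrow> real \<Rightarrow>
     'w measure \<Rightarrow> (real \<Rightarrow> 'w measure) \<Rightarrow> (real \<Rightarrow> 'w \<Rightarrow> real) \<Rightarrow> (real \<Rightarrow> 'w \<Rightarrow> real) \<Rightarrow> bool" where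
  "weak_solution T b x M F B X \<longleftrightarrow>
     prob_space M \<and> complete_measure M \<and>
     usual_filtration T M F \<and>
     brownian_motion T M F B \<and>
     continuous_adapted T M F X \<and>
     (\<forall>t\<in>{0..T}. distr M borel (X t) \<in> P1) \<and>
     (AE \<omega> in M.
        set_integrable lborel {0..T} (\<lambda>s. b s (X s \<omega>) (distr M borel (X s))) \<and>
        (\<forall>t\<in>{0..T}. X t \<omega> = x + (LBINT s:{0..t}. b s (X s \<omega>) (distr M borel (X s))) + B t \<omega>))"

end

theory Submission
  imports Defs
begin

text \<open>
  \<^emph>\<open>Existence.\<close> The equation is solved by changing the measure on one fixed space that carries a
  Brownian motion \<open>W\<close>. The process \<open>X = x + W\<close> is the same throughout and only its law moves; this is
  what makes a drift tractable that is merely measurable in the space variable. For every \<open>N\<close> the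
  drift is replaced by one that is constant on the intervals of a grid of mesh \<open>T / N\<close>: on each
  interval it is the average of \<open>b s (X s) (law of X s)\<close> over the \<^emph>\<open>preceding\<close> interval, the law being
  taken under the measure constructed so far. Thanks to this delay no fixed point is needed, and the
  density is a finite product of exponentials, for which Girsanov's theorem amounts to completing the
  square in a Gaussian integral (\<open>girsanov_one_step\<close>, \<open>girsanov\<close>). Integrated over time the averages
  telescope, so that along each path the accumulated drift differs from
  \<open>\<integral> b s (X s) (law of X s) ds\<close> by at most a multiple of \<open>1 / N\<close> (\<open>drift_close\<close>). The approximation
  therefore costs no regularity of \<open>b\<close> in space or time; only the laws still depend on \<open>N\<close>, and in
  them \<open>b\<close> is continuous.

  The limit rests on compactness of the measures \<open>Q\<^sub>N\<close>. Their densities satisfy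
  \<open>D(\<beta>)\<^sup>2 = D(2\<beta>) exp (\<integral>\<beta>\<^sup>2)\<close> with \<open>D(2\<beta>)\<close> of mean one, and a discrete Gronwall argument bounds the
  second moments of the drift (\<open>stage\<close>); together these give absolute continuity with respect to the
  reference measure, uniformly in \<open>N\<close> (\<open>uniform_continuity_estimate\<close>). On a countably generated space
  such a sequence has a subsequence that converges on \<^emph>\<open>every\<close> measurable set
  (\<open>setwise_compactness\<close>). Setwise convergence, unlike weak convergence, does not see discontinuities
  of the integrands, and with bounded second moments it implies convergence of the laws in the
  Kantorovich distance (\<open>kantorovich_tendsto_of_setwise\<close>). That \<open>X - x\<close> minus its drift is a Brownian
  motion is expressed by \<open>E[1\<^sub>A exp (iu (B\<^sub>t - B\<^sub>s))] = P(A) exp (- u\<^sup>2 (t - s) / 2)\<close> for past events \<open>A\<close>.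
  This identity passes to the limit, and it contains both the normal law of the increments and their
  independence of the past (\<open>normal_indep_of_char\<close>).

  The reference space is a countable product of standard normal laws with Levy's construction of
  Brownian motion on it; the joint law of the dyadic increments comes from linear algebra
  (\<open>levy_increments_isometry\<close>).

  \<^emph>\<open>Continuity of the law.\<close> It suffices to bound \<open>m t = E\<bar>X t\<bar>\<close> on \<open>[0, T]\<close>, since then
  \<open>E\<bar>X t - X s\<bar>\<close> is at most \<open>sqrt (t - s)\<close> plus a multiple of \<open>t - s\<close>. For an arbitrary weak solution
  only the finiteness of each single \<open>m t\<close> is given, and \<open>m\<close> might a priori fail to be integrable, so
  Gronwall's inequality cannot be applied directly. On a short interval where \<open>m\<close> is bounded, though,
  its value at either end controls the value at the other end by constants that do not depend on the
  bound. As \<open>m\<close> is lower semicontinuous by Fatou's lemma, Baire's theorem applied to the closed set of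
  times near which \<open>m\<close> is unbounded shows that this set is empty (\<open>bounded_by_Baire\<close>).
\<close>

section \<open>Measures on the line and their Fourier transforms\<close>

lemma char_zero_eq_measure: "char M 0 = complex_of_real (measure M (space M))"
  by (simp add: char_def scaleR_conv_of_real)

text \<open>
  Both measures have the same mass, namely the value of the transform at \<open>0\<close>; dividing by it reduces
  the claim to Levy's uniqueness theorem for probability measures.
\<close>

lemma finite_measure_eq_of_char:
  fixes M1 M2 :: "real measure"
  assumes f: "finite_measure M1" "finite_measure M2"
    and s: "sets M1 = sets borel" "sets M2 = sets borel"
    and c: "\<And>u. char M1 u = char M2 u"
  shows "M1 = M2"
proof -
  interpret M1: finite_measure M1 by fact
  interpret M2: finite_measure M2 by fact
  have sp: "space M1 = UNIV" "space M2 = UNIV"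
    using s sets_eq_imp_space_eq[of _ borel] by auto
  have eq: "measure M1 UNIV = measure M2 UNIV"
    using c[of 0] unfolding char_zero_eq_measure sp by simp
  define m where "m = measure M1 UNIV"
  have e: "emeasure M1 UNIV = ennreal m" "emeasure M2 UNIV = ennreal m"
    using M1.emeasure_eq_measure M2.emeasure_eq_measure eq by (auto simp: m_def)
  show ?thesis
  proof (cases "m = 0")
    case True
    have "emeasure M1 A = 0" for A
      using emeasure_mono[of A UNIV M1] s e True
      by (cases "A \<in> sets M1") (auto simp: emeasure_notin_sets)
    moreover have "emeasure M2 A = 0" for A
      using emeasure_mono[of A UNIV M2] s e True
      by (cases "A \<in> sets M2") (auto simp: emeasure_notin_sets)
    ultimately show ?thesis using s by (intro measure_eqI) auto
  next
    case False
    then have m: "m > 0" by (simp add: m_def order.strict_iff_order)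
    define N where "N M = density M (\<lambda>_. ennreal (1/m))" for M :: "real measure"
    have rd: "real_distribution (N M)" if "sets M = sets borel" "emeasure M UNIV = ennreal m" for M
    proof -
      have sp: "space M = UNIV" using that sets_eq_imp_space_eq[of M borel] by auto
      have "emeasure (N M) (space (N M)) = 1"
        using that m sp by (simp add: N_def emeasure_density ennreal_mult'[symmetric])
      then show ?thesis
        using that by (auto simp: real_distribution_def real_distribution_axioms_def N_def sp intro: prob_spaceI)
    qed
    have ch: "char (N M) u = char M u / m" if "sets M = sets borel" for M u
    proof -
      have [measurable_cong]: "sets M = sets borel" by fact
      show ?thesis
      using m unfolding char_def N_def
      by (subst integral_density) (auto simp: scaleR_conv_of_real)
    qed
    have "N M1 = N M2"
      using rd[OF s(1) e(1)] rd[OF s(2) e(2)]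
      by (rule Levy_uniqueness) (simp add: fun_eq_iff ch s c)
    moreover have "emeasure M A = ennreal m * emeasure (N M) A" if "sets M = sets borel" "A \<in> sets borel" for M A
    proof -
      have "ennreal m * ennreal (1/m) = 1"
        using m by (simp add: ennreal_mult'[symmetric])
      then show ?thesis using that by (simp add: N_def emeasure_density_const mult.assoc[symmetric])
    qed
    ultimately show ?thesis using s by (intro measure_eqI) auto
  qed
qed

lemma char_normal:
  assumes "\<sigma> > 0"
  shows "char (density lborel (normal_density 0 \<sigma>)) u = complex_of_real (exp (- (u^2 * \<sigma>^2) / 2))"
proof -
  let ?N = "density lborel (normal_density 0 \<sigma>)"
  interpret N: prob_space ?N using assms by (rule prob_space_normal_density)
  have "distributed ?N lborel (\<lambda>x. x) (normal_density 0 \<sigma>)"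
    unfolding distributed_def by (auto intro!: distr_id2)
  then have "distributed ?N lborel (\<lambda>x. (x - 0) / \<sigma>) std_normal_density"
    using N.normal_standard_normal_convert[OF assms, of "\<lambda>x. x" 0] by simp
  then have d: "distr ?N lborel (\<lambda>x. x / \<sigma>) = std_normal_distribution"
    by (simp add: distributed_def)
  have "char ?N u = (CLINT x|?N. iexp ((u * \<sigma>) * (x / \<sigma>)))"
    using assms by (simp add: char_def)
  also have "\<dots> = char (distr ?N lborel (\<lambda>x. x / \<sigma>)) (u * \<sigma>)"
    unfolding char_def by (subst integral_distr) auto
  finally show ?thesis by (simp add: d char_std_normal_distribution power_mult_distrib)
qed

text \<open>
  The positive and the negative part of \<open>R\<close>, used as densities, give two finite measures whose images
  under \<open>V\<close> have the same Fourier transform and hence coincide. In this form Levy's theorem trades an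
  exponential of \<open>V\<close> for an indicator of \<open>V\<close> under an integral that contains other factors as well.
\<close>

lemma fourier_zero_imp_zero_real:
  fixes R V :: "'a \<Rightarrow> real"
  assumes M: "finite_measure M" and R: "integrable M R" and [measurable]: "V \<in> borel_measurable M"
    and z: "\<And>v. (CLINT w|M. R w * iexp (v * V w)) = 0" and C: "C \<in> sets borel"
  shows "(LINT w|M. R w * indicator C (V w)) = 0"
proof -
  interpret finite_measure M by fact
  have [measurable]: "R \<in> borel_measurable M" using R by auto
  define N where "N f = distr (density M (\<lambda>w. ennreal (f w))) borel V" for f
  have fin: "finite_measure (N f)" if "integrable M f" "\<And>w. f w \<ge> 0" for f
  proof
    have [measurable]: "f \<in> borel_measurable M" using that by auto
    have "emeasure (N f) (space (N f)) = (\<integral>\<^sup>+w. ennreal (f w) \<partial>M)"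
      by (simp add: N_def emeasure_distr emeasure_density cong: nn_integral_cong)
    also have "\<dots> < \<infinity>" using that by (simp add: nn_integral_eq_integral)
    finally show "emeasure (N f) (space (N f)) \<noteq> \<infinity>" by simp
  qed
  have ch: "char (N f) v = (CLINT w|M. f w * iexp (v * V w))"
    if "integrable M f" "\<And>w. f w \<ge> 0" for f v
  proof -
    have [measurable]: "f \<in> borel_measurable M" using that by auto
    show ?thesis unfolding char_def N_def
      using that by (subst integral_distr) (auto simp: integral_density scaleR_conv_of_real)
  qed
  have I: "integrable M (\<lambda>w. f w * indicator C (V w))" "measure (N f) C = (LINT w|M. f w * indicator C (V w))"
    if "integrable M f" "\<And>w. f w \<ge> 0" for f
  proof -
    have [measurable]: "f \<in> borel_measurable M" using that by auto
    have "(\<lambda>w. indicator C (V w)::real) \<in> borel_measurable M" using C by measurable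
    then show i: "integrable M (\<lambda>w. f w * indicator C (V w))"
      using that(1) by (intro Bochner_Integration.integrable_bound[OF that(1)]) (auto simp: indicator_def)
    have "emeasure (N f) C = (\<integral>\<^sup>+w. ennreal (f w) * indicator (V -` C \<inter> space M) w \<partial>M)"
      using C by (simp add: N_def emeasure_distr emeasure_density)
    also have "\<dots> = (\<integral>\<^sup>+w. ennreal (f w * indicator C (V w)) \<partial>M)"
      using that by (intro nn_integral_cong) (auto simp: indicator_def)
    also have "\<dots> = ennreal (LINT w|M. f w * indicator C (V w))"
      using that i by (intro nn_integral_eq_integral) auto
    finally show "measure (N f) C = (LINT w|M. f w * indicator C (V w))"
      using that by (simp add: measure_def)
  qed
  define P where "P w = max 0 (R w)" for w
  define Q where "Q w = max 0 (- R w)" for w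
  have PQ: "R w = P w - Q w" "P w \<ge> 0" "Q w \<ge> 0" for w by (auto simp: P_def Q_def)
  have ip: "integrable M P" "integrable M Q" unfolding P_def Q_def
    by (rule Bochner_Integration.integrable_bound[OF R], simp, simp)+
  have ii: "complex_integrable M (\<lambda>w. f w * iexp (v * V w))" if "integrable M f" for v and f :: "'a \<Rightarrow> real"
  proof -
    have [measurable]: "f \<in> borel_measurable M" using that by auto
    show ?thesis
    by (rule Bochner_Integration.integrable_bound[OF that]) (auto simp: norm_mult)
  qed
  have "char (N P) v = char (N Q) v" for v
  proof -
    have "0 = (CLINT w|M. P w * iexp (v * V w) - Q w * iexp (v * V w))"
      using z[of v] by (simp add: PQ(1) left_diff_distrib)
    also have "\<dots> = char (N P) v - char (N Q) v"
      using ii[OF ip(1)] ii[OF ip(2)] by (simp add: ch ip PQ)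
    finally show ?thesis by simp
  qed
  then have "N P = N Q"
    by (intro finite_measure_eq_of_char fin ip PQ) (auto simp: N_def)
  then have "(LINT w|M. P w * indicator C (V w)) = (LINT w|M. Q w * indicator C (V w))"
    using I(2)[OF ip(1)] I(2)[OF ip(2)] PQ by simp
  then show ?thesis
    using I(1)[OF ip(1)] I(1)[OF ip(2)] PQ(2,3) by (simp add: PQ(1) left_diff_distrib)
qed

text \<open>
  Conjugation turns the hypothesis at \<open>- v\<close> into the hypothesis at \<open>v\<close> for \<open>cnj \<circ> H\<close>, so the real and
  the imaginary part of \<open>H\<close> satisfy it separately.
\<close>

lemma fourier_zero_imp_zero:
  fixes H :: "'a \<Rightarrow> complex" and V :: "'a \<Rightarrow> real"
  assumes M: "finite_measure M" and H: "integrable M H" and [measurable]: "V \<in> borel_measurable M"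
    and z: "\<And>v. (CLINT w|M. H w * iexp (v * V w)) = 0" and C: "C \<in> sets borel"
  shows "(CLINT w|M. H w * indicator C (V w)) = 0"
proof -
  have [measurable]: "H \<in> borel_measurable M" using H by auto
  have ii: "complex_integrable M (\<lambda>w. f w * iexp (v * V w))" if "integrable M f" for v and f :: "'a \<Rightarrow> complex"
  proof -
    have [measurable]: "f \<in> borel_measurable M" using that by auto
    show ?thesis
    by (rule Bochner_Integration.integrable_bound[OF that]) (auto simp: norm_mult)
  qed
  have cH: "integrable M (\<lambda>w. cnj (H w))" using H by simp
  have zc: "(CLINT w|M. cnj (H w) * iexp (v * V w)) = 0" for v
  proof -
    have "(CLINT w|M. cnj (H w) * iexp (v * V w)) = (CLINT w|M. cnj (H w * iexp ((-v) * V w)))"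
      by (intro Bochner_Integration.integral_cong) (auto simp: exp_cnj)
    also have "\<dots> = cnj (CLINT w|M. H w * iexp ((-v) * V w))" by (simp only: Bochner_Integration.integral_cnj)
    finally show ?thesis using z[of "-v"] by simp
  qed
  have "(CLINT w|M. complex_of_real (Re (H w)) * iexp (v * V w)) = 0" for v
  proof -
    have "(CLINT w|M. complex_of_real (Re (H w)) * iexp (v * V w))
        = (CLINT w|M. (H w * iexp (v * V w) + cnj (H w) * iexp (v * V w)) / 2)"
      by (intro Bochner_Integration.integral_cong) (auto simp: distrib_right[symmetric] complex_add_cnj)
    also have "\<dots> = 0" using z[of v] zc[of v] ii[OF H] ii[OF cH]
      by (subst integral_divide_zero) (simp add: Bochner_Integration.integral_add)
    finally show ?thesis .
  qed
  then have R: "(LINT w|M. Re (H w) * indicator C (V w)) = 0"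
    using H by (intro fourier_zero_imp_zero_real[OF M] C) auto
  have "(CLINT w|M. complex_of_real (Im (H w)) * iexp (v * V w)) = 0" for v
  proof -
    have "(CLINT w|M. complex_of_real (Im (H w)) * iexp (v * V w))
        = (CLINT w|M. (H w * iexp (v * V w) - cnj (H w) * iexp (v * V w)) / (2 * \<i>))"
      by (intro Bochner_Integration.integral_cong) (auto simp: left_diff_distrib[symmetric] complex_diff_cnj field_simps simp flip: power2_eq_square)
    also have "\<dots> = 0" using z[of v] zc[of v] ii[OF H] ii[OF cH]
      by (subst integral_divide_zero) (simp add: Bochner_Integration.integral_diff)
    finally show ?thesis .
  qed
  then have I: "(LINT w|M. Im (H w) * indicator C (V w)) = 0"
    using H by (intro fourier_zero_imp_zero_real[OF M] C) auto
  have [measurable]: "(\<lambda>w. indicator C (V w)::complex) \<in> borel_measurable M" using C by measurable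
  have "integrable M (\<lambda>w. H w * indicator C (V w))"
    by (rule Bochner_Integration.integrable_bound[OF H]) (auto split: split_indicator)
  then have "Re (CLINT w|M. H w * indicator C (V w)) = (LINT w|M. Re (H w * indicator C (V w)))"
    and "Im (CLINT w|M. H w * indicator C (V w)) = (LINT w|M. Im (H w * indicator C (V w)))"
    by (simp_all only: integral_Re integral_Im)
  moreover have "Re (H w * indicator C (V w)) = Re (H w) * indicator C (V w)"
    and "Im (H w * indicator C (V w)) = Im (H w) * indicator C (V w)" for w
    by (auto simp: indicator_def)
  ultimately show ?thesis using R I by (intro complex_eqI) (simp_all only: zero_complex.sel)
qed

text \<open>
  For fixed \<open>A\<close> the measures \<open>P(A \<inter> {Y \<in> C})\<close> and \<open>P(A) N(0, \<sigma>\<^sup>2)(C)\<close> of \<open>C\<close> have the same Fourier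
  transform. Every statement about Brownian increments is derived from the hypothesis of this lemma,
  which, being an identity between integrals of bounded functions, is stable under limits.
\<close>

lemma (in prob_space) normal_indep_of_char:
  fixes Y :: "'a \<Rightarrow> real"
  assumes F: "subalgebra M F" and [measurable]: "Y \<in> borel_measurable M" and \<sigma>: "\<sigma> > 0"
    and c: "\<And>A u. A \<in> sets F \<Longrightarrow>
      (CLINT w|M. indicator A w * iexp (u * Y w)) = prob A * exp (- (u^2 * \<sigma>^2) / 2)"
  shows "distributed M lborel Y (normal_density 0 \<sigma>)"
    and "indep_set (sets F) (sets (vimage_algebra (space M) Y borel))"
proof -
  let ?N = "density lborel (normal_density 0 \<sigma>)"
  interpret N: prob_space ?N using \<sigma> by (rule prob_space_normal_density)
  have joint: "prob (A \<inter> (Y -` C \<inter> space M)) = prob A * measure ?N C"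
    if A: "A \<in> sets F" and C: "C \<in> sets borel" for A C
  proof -
    have AM[measurable]: "A \<in> events" using A F by (auto simp: subalgebra_def)
    define M1 where "M1 = distr (density M (indicator A)) borel Y"
    define M2 where "M2 = density ?N (\<lambda>_. ennreal (prob A))"
    have f1: "finite_measure M1"
      by (rule finite_measureI) (simp add: M1_def emeasure_distr emeasure_density  cong: nn_integral_cong)
    have f2: "finite_measure M2"
      using N.emeasure_space_1 by (intro finite_measureI) (simp add: M2_def emeasure_density_const ennreal_mult_eq_top_iff)
    have "char M1 u = char M2 u" for u
    proof -
      have "char M1 u = (CLINT w|M. indicator A w * iexp (u * Y w))"
        unfolding char_def M1_def
        by (subst integral_distr, measurable) 
           (auto simp: integral_density[where g="indicator A", unfolded ennreal_indicator] indicator_def intro!: Bochner_Integration.integral_cong)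
      also have "\<dots> = prob A * char ?N u"
        unfolding char_normal[OF \<sigma>] c[OF A] by simp
      also have "\<dots> = char M2 u"
        unfolding char_def M2_def by (subst (2) integral_density) (auto simp: scaleR_conv_of_real)
      finally show ?thesis .
    qed
    then have "M1 = M2"
      by (intro finite_measure_eq_of_char f1 f2) (auto simp: M1_def M2_def)
    moreover have "measure M1 C = prob (A \<inter> (Y -` C \<inter> space M))"
    proof -
      have "emeasure M1 C = (\<integral>\<^sup>+w. indicator (A \<inter> (Y -` C \<inter> space M)) w \<partial>M)"
        using C unfolding M1_def by (subst emeasure_distr) (auto simp: emeasure_density indicator_inter_arith[symmetric] mult.assoc intro!: nn_integral_cong nn_integral_indicator[symmetric] simp del: nn_integral_indicator)
      then show ?thesis using C by (simp add: measure_def)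
    qed
    moreover have "measure M2 C = prob A * measure ?N C"
      using C by (simp add: M2_def measure_def emeasure_density_const enn2real_mult)
    ultimately show ?thesis by simp
  qed
  have law: "prob (Y -` C \<inter> space M) = measure ?N C" if "C \<in> sets borel" for C
  proof -
    have "space M \<in> sets F" using F by (metis sets.top subalgebra_def)
    from joint[OF this that] show ?thesis by (simp add: prob_space Int_absorb1)
  qed
  show "distributed M lborel Y (normal_density 0 \<sigma>)"
    unfolding distributed_def
  proof (intro conjI measure_eqI)
    fix C assume "C \<in> sets (distr M lborel Y)"
    then have C: "C \<in> sets borel" by simp
    then have "emeasure (distr M lborel Y) C = emeasure M (Y -` C \<inter> space M)"
      by (intro emeasure_distr) auto
    also have "\<dots> = emeasure ?N C"
      unfolding emeasure_eq_measure N.emeasure_eq_measure law[OF C] ..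
    finally show "emeasure (distr M lborel Y) C = emeasure ?N C" .
  qed auto
  show "indep_set (sets F) (sets (vimage_algebra (space M) Y borel))"
  proof (rule indep_setI)
    show "sets F \<subseteq> events" using F by (simp add: subalgebra_def)
    show "sets (vimage_algebra (space M) Y borel) \<subseteq> events"
      by (auto simp: sets_vimage_algebra2)
    fix A D assume A: "A \<in> sets F" and "D \<in> sets (vimage_algebra (space M) Y borel)"
    then obtain C where C: "C \<in> sets borel" "D = Y -` C \<inter> space M" by (auto simp: sets_vimage_algebra2)
    show "prob (A \<inter> D) = prob A * prob D"
      using joint[OF A C(1)] law[OF C(1)] C(2) by simp
  qed
qed

section \<open>Setwise limits of uniformly absolutely continuous measures\<close>

lemma LIMSEQ_zero_eventually_less:
  fixes f :: "nat \<Rightarrow> real"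
  assumes "f \<longlonglongrightarrow> 0" "\<delta> > 0"
  shows "\<exists>k0. \<forall>k\<ge>k0. f k < \<delta>"
  using order_tendstoD(2)[OF assms] by (simp add: eventually_sequentially)

definition unif_abs_cont :: "'a measure \<Rightarrow> (nat \<Rightarrow> 'a measure) \<Rightarrow> bool" where
  "unif_abs_cont P Q \<longleftrightarrow> (\<forall>\<epsilon>>0. \<exists>\<delta>>0. \<forall>n. \<forall>A\<in>sets P. measure P A < \<delta> \<longrightarrow> measure (Q n) A < \<epsilon>)"

lemma ex_strict_mono_convergent:
  fixes X :: "nat \<Rightarrow> nat \<Rightarrow> real"
  assumes "\<And>k n. \<bar>X n k\<bar> \<le> 1"
  shows "\<exists>r. strict_mono r \<and> (\<forall>k. convergent (\<lambda>n. X (r n) k))"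
proof -
  let ?P = "\<lambda>k s. convergent (\<lambda>n. X (s n) k)"
  interpret s: subseqs ?P
  proof
    fix k and s :: "nat \<Rightarrow> nat" assume "strict_mono s"
    have "bounded (range (\<lambda>n. X (s n) k))"
      using assms by (auto intro!: boundedI[of _ 1])
    then obtain l r where "strict_mono r" "((\<lambda>n. X (s n) k) \<circ> r) \<longlonglongrightarrow> l"
      using bounded_imp_convergent_subsequence by blast
    then show "\<exists>r. strict_mono r \<and> convergent (\<lambda>n. X ((s \<circ> r) n) k)"
      by (auto simp: o_def convergent_def)
  qed
  have "?P k (s.diagseq \<circ> ((+) (Suc k)))" for k
  proof (rule s.diagseq_holds)
    fix r s :: "nat \<Rightarrow> nat" and n assume "strict_mono r" "convergent (\<lambda>i. X (s i) n)"
    then show "convergent (\<lambda>i. X ((s \<circ> r) i) n)"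
      using convergent_subseq_convergent[of "\<lambda>i. X (s i) n" r] by (simp add: o_def)
  qed
  then have "?P k s.diagseq" for k
    using convergent_ignore_initial_segment[of "\<lambda>n. X (s.diagseq n) k" "Suc k"]
    by (simp add: o_def add.commute[of _ k])
  then show ?thesis using s.subseq_diagseq by blast
qed

text \<open>
  A diagonal subsequence converges on the countable generator. The sets on which it converges form a
  Dynkin system: uniform absolute continuity makes the tails of a disjoint union small uniformly in
  \<open>n\<close>. The same uniformity makes the limit continuous at the empty set, hence a measure.
\<close>

lemma setwise_compactness:
  fixes P :: "'a measure" and Q :: "nat \<Rightarrow> 'a measure"
  assumes P: "prob_space P" and Q: "\<And>n. prob_space (Q n)" "\<And>n. sets (Q n) = sets P"
    and E: "countable E" "Int_stable E" "E \<subseteq> Pow (space P)" "sets P = sigma_sets (space P) E"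
    and uac: "unif_abs_cont P Q"
  obtains r R where "strict_mono r" "prob_space R" "sets R = sets P"
    "\<And>A. A \<in> sets P \<Longrightarrow> (\<lambda>n. measure (Q (r n)) A) \<longlonglongrightarrow> measure R A"
proof -
  interpret P: prob_space P by fact
  interpret Q: prob_space "Q n" for n by fact
  have spQ: "space (Q n) = space P" for n using Q(2) by (rule sets_eq_imp_space_eq)
  define e where "e = from_nat_into (insert {} E)"
  have range_e: "range e = insert {} E" using E(1) by (simp add: e_def range_from_nat_into)
  obtain r where r: "strict_mono r" "\<And>k. convergent (\<lambda>n. measure (Q (r n)) (e k))"
    using ex_strict_mono_convergent[of "\<lambda>n k. measure (Q n) (e k)"] by auto
  have decr_small: "\<exists>k0. \<forall>k\<ge>k0. \<forall>n. measure (Q n) (D k) < \<epsilon>"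
    if D: "range D \<subseteq> sets P" "decseq D" "(\<Inter>i. D i) = {}" and "\<epsilon> > 0" for D \<epsilon>
  proof -
    obtain \<delta> where \<delta>: "\<delta> > 0" "\<And>n A. A \<in> sets P \<Longrightarrow> measure P A < \<delta> \<Longrightarrow> measure (Q n) A < \<epsilon>"
      using uac \<open>\<epsilon> > 0\<close> unfolding unif_abs_cont_def by blast
    have "(\<lambda>k. measure P (D k)) \<longlonglongrightarrow> 0"
      using P.finite_Lim_measure_decseq[OF D(1,2)] D(3) by simp
    then obtain k0 where "\<And>k. k \<ge> k0 \<Longrightarrow> measure P (D k) < \<delta>"
      using \<delta>(1) LIMSEQ_zero_eventually_less by blast
    then show ?thesis using \<delta>(2) D(1) by blast
  qed
  have conv: "convergent (\<lambda>n. measure (Q (r n)) A)" if "A \<in> sets P" for A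
    using E(2,3) that[unfolded E(4)]
  proof (induction rule: sigma_sets_induct_disjoint)
    case (basic A)
    then have "A \<in> range e" using range_e by auto
    then show ?case using r(2) by auto
  next
    case empty
    then show ?case by (simp add: convergent_const)
  next
    case (compl A)
    then have "measure (Q (r n)) (space P - A) = 1 - measure (Q (r n)) A" for n
      using Q.prob_compl[of A "r n"] Q(2) E(4) spQ by auto
    then show ?case using compl by (simp add: convergent_diff convergent_const)
  next
    case (union A)
    have A: "A i \<in> sets P" for i using union(2) E(4) by auto
    define D where "D k = (\<Union>i. A i) - (\<Union>i<k. A i)" for k
    have "decseq D" unfolding D_def decseq_def by (auto intro: order_less_le_trans)
    moreover have "(\<Inter>k. D k) = {}" by (auto simp: D_def)
    moreover have "range D \<subseteq> sets P" using A by (auto simp: D_def)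
    ultimately have small: "\<exists>k0. \<forall>k\<ge>k0. \<forall>n. measure (Q n) (D k) < \<epsilon>" if "\<epsilon> > 0" for \<epsilon>
      using decr_small that by blast
    have split: "measure (Q n) (\<Union>i. A i) = (\<Sum>i<k. measure (Q n) (A i)) + measure (Q n) (D k)" for n k
    proof -
      have "measure (Q n) (\<Union>i. A i) = measure (Q n) ((\<Union>i<k. A i) \<union> D k)"
        by (rule arg_cong[where f="measure (Q n)"]) (auto simp: D_def)
      also have "\<dots> = measure (Q n) (\<Union>i<k. A i) + measure (Q n) (D k)"
        using A by (intro Q.finite_measure_Union) (auto simp: D_def Q(2))
      also have "measure (Q n) (\<Union>i<k. A i) = (\<Sum>i<k. measure (Q n) (A i))"
        using A union(1) by (intro Q.finite_measure_finite_Union) (auto simp: Q(2) disjoint_family_on_def)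
      finally show ?thesis .
    qed
    have "Cauchy (\<lambda>n. measure (Q (r n)) (\<Union>i. A i))"
    proof (rule metric_CauchyI)
      fix \<epsilon> :: real assume "\<epsilon> > 0"
      then obtain k where k: "\<And>n. measure (Q n) (D k) < \<epsilon>/4"
        using small[of "\<epsilon>/4"] by auto
      have "convergent (\<lambda>n. \<Sum>i<k. measure (Q (r n)) (A i))"
        using union(3) by (intro convergent_sum) auto
      then have "Cauchy (\<lambda>n. \<Sum>i<k. measure (Q (r n)) (A i))" by (rule convergent_Cauchy)
      then obtain N where N: "\<And>m n. m \<ge> N \<Longrightarrow> n \<ge> N \<Longrightarrow>
          \<bar>(\<Sum>i<k. measure (Q (r m)) (A i)) - (\<Sum>i<k. measure (Q (r n)) (A i))\<bar> < \<epsilon>/4"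
        using \<open>\<epsilon> > 0\<close> unfolding Cauchy_def dist_real_def by (metis zero_less_divide_iff zero_less_numeral)
      have "\<bar>measure (Q (r m)) (\<Union>i. A i) - measure (Q (r n)) (\<Union>i. A i)\<bar> < \<epsilon>" if "m \<ge> N" "n \<ge> N" for m n
        using N[OF that] k[of "r m"] k[of "r n"] split[of "r m" k] split[of "r n" k]
          measure_nonneg[of "Q (r m)" "D k"] measure_nonneg[of "Q (r n)" "D k"] \<open>\<epsilon> > 0\<close> by linarith
      then show "\<exists>N. \<forall>m\<ge>N. \<forall>n\<ge>N. dist (measure (Q (r m)) (\<Union>i. A i)) (measure (Q (r n)) (\<Union>i. A i)) < \<epsilon>"
        by (auto simp: dist_real_def)
    qed
    then show ?case by (rule Cauchy_convergent)
  qed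
  define q where "q A = lim (\<lambda>n. measure (Q (r n)) A)" for A
  have q: "(\<lambda>n. measure (Q (r n)) A) \<longlonglongrightarrow> q A" if "A \<in> sets P" for A
    using conv[OF that] by (simp add: q_def convergent_LIMSEQ_iff)
  have q_nn: "q A \<ge> 0" if "A \<in> sets P" for A
    using q[OF that] by (rule LIMSEQ_le_const) simp
  have q_space: "q (space P) = 1"
    using LIMSEQ_unique[OF q[OF sets.top]] Q.prob_space spQ by simp
  define R where "R = measure_of (space P) (sets P) (\<lambda>A. ennreal (q A))"
  have q_empty: "q {} = 0" using LIMSEQ_unique[OF q[OF sets.empty_sets], of 0] by simp
  have ca: "countably_additive (sets P) (\<lambda>A. ennreal (q A))"
  proof (rule sets.empty_continuous_imp_countably_additive)
    show "positive (sets P) (\<lambda>A. ennreal (q A))" by (simp add: positive_def q_empty)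
    show "additive (sets P) (\<lambda>A. ennreal (q A))"
    proof (unfold additive_def, intro ballI impI)
      fix A B assume AB: "A \<in> sets P" "B \<in> sets P" "A \<inter> B = {}"
      have "measure (Q (r n)) (A \<union> B) = measure (Q (r n)) A + measure (Q (r n)) B" for n
        using AB Q(2) by (intro Q.finite_measure_Union) auto
      then have "q (A \<union> B) = q A + q B"
        using LIMSEQ_unique[OF q[of "A \<union> B"]] tendsto_add[OF q q] AB by simp
      then show "ennreal (q (A \<union> B)) = ennreal (q A) + ennreal (q B)"
        using q_nn AB by simp
    qed
    show "\<forall>A\<in>sets P. ennreal (q A) \<noteq> \<infinity>" by simp
    fix D assume D: "range D \<subseteq> sets P" "decseq D" "(\<Inter>i. D i) = {}"
    have "(\<lambda>i. q (D i)) \<longlonglongrightarrow> 0"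
    proof (rule LIMSEQ_I)
      fix \<epsilon> :: real assume "\<epsilon> > 0"
      obtain k0 where k0: "\<And>k n. k \<ge> k0 \<Longrightarrow> measure (Q n) (D k) < \<epsilon>/2"
        using decr_small[OF D, of "\<epsilon>/2"] \<open>\<epsilon> > 0\<close> by auto
      have "q (D k) \<le> \<epsilon>/2" if "k \<ge> k0" for k
        by (rule LIMSEQ_le_const2[OF q]) (use D(1) k0[OF that] in \<open>auto intro!: less_imp_le\<close>)
      then have "\<bar>q (D k)\<bar> < \<epsilon>" if "k \<ge> k0" for k
        using q_nn[of "D k"] D(1) that \<open>\<epsilon> > 0\<close> by (fastforce simp: image_subset_iff)
      then show "\<exists>no. \<forall>n\<ge>no. norm (q (D n) - 0) < \<epsilon>" by auto
    qed
    then show "(\<lambda>i. ennreal (q (D i))) \<longlonglongrightarrow> 0"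
      using tendsto_ennrealI by fastforce
  qed
  have setsR: "sets R = sets P"
    by (simp add: R_def sets.space_closed sets.sigma_sets_eq)
  have R: "emeasure R A = ennreal (q A)" if "A \<in> sets P" for A
    unfolding R_def
  proof (rule emeasure_measure_of_sigma)
    show "sigma_algebra (space P) (sets P)" by (rule sets.sigma_algebra_axioms)
    show "positive (sets P) (\<lambda>A. ennreal (q A))"
      by (simp add: positive_def q_empty)
  qed (use ca that in auto)
  have spR: "space R = space P" using setsR by (rule sets_eq_imp_space_eq)
  show thesis
  proof (rule that[OF r(1)])
    show "prob_space R" by (rule prob_spaceI) (simp add: spR R q_space)
    show "sets R = sets P" by fact
    show "(\<lambda>n. measure (Q (r n)) A) \<longlonglongrightarrow> measure R A" if "A \<in> sets P" for A
      using q[OF that] R[OF that] q_nn[OF that] by (simp add: measure_def)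
  qed
qed

text \<open>
  Rounding \<open>f\<close> down to a multiple of \<open>1 / m\<close> changes the integral by at most \<open>1 / m\<close> under every
  probability measure and leaves a finite combination of measures of sets.
\<close>

lemma setwise_tendsto_integral_real:
  fixes f :: "'a \<Rightarrow> real"
  assumes Q: "\<And>n. prob_space (Q n)" "\<And>n. sets (Q n) = sets R" and R: "prob_space R"
    and conv: "\<And>A. A \<in> sets R \<Longrightarrow> (\<lambda>n. measure (Q n) A) \<longlonglongrightarrow> measure R A"
    and f[measurable]: "f \<in> borel_measurable R" and K: "\<And>w. w \<in> space R \<Longrightarrow> \<bar>f w\<bar> \<le> K"
  shows "(\<lambda>n. LINT w|Q n. f w) \<longlonglongrightarrow> (LINT w|R. f w)"
proof (rule LIMSEQ_I)
  fix \<epsilon> :: real assume "\<epsilon> > 0"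
  interpret R: prob_space R by fact
  obtain m :: nat where m: "m > 0" "1 / real m < \<epsilon>/3"
    using reals_Archimedean[of "\<epsilon>/3"] \<open>\<epsilon> > 0\<close> by (metis divide_pos_pos inverse_eq_divide zero_less_Suc zero_less_numeral)
  define g where "g w = real_of_int \<lfloor>real m * f w\<rfloor> / real m" for w
  define J where "J = {\<lfloor>- (real m * K)\<rfloor>..\<lfloor>real m * K\<rfloor>}"
  define S where "S j = {w\<in>space R. \<lfloor>real m * f w\<rfloor> = j}" for j
  have Sm[measurable]: "S j \<in> sets R" for j unfolding S_def by measurable
  have gm: "\<bar>f w - g w\<bar> \<le> 1 / real m" for w
  proof -
    have "\<bar>real m * f w - real_of_int \<lfloor>real m * f w\<rfloor>\<bar> \<le> 1" by linarith
    then have "\<bar>(real m * f w - real_of_int \<lfloor>real m * f w\<rfloor>) / real m\<bar> \<le> 1 / real m"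
      using m by (simp add: divide_right_mono)
    then show ?thesis using m by (simp add: g_def diff_divide_distrib)
  qed
  have gsum: "g w = (\<Sum>j\<in>J. (real_of_int j / real m) * indicator (S j) w)" if "w \<in> space R" for w
  proof -
    have "\<lfloor>real m * f w\<rfloor> \<in> J"
    proof -
      have "- (real m * K) \<le> real m * f w" "real m * f w \<le> real m * K"
        using K[OF that] m by (auto simp: abs_le_iff minus_mult_right[symmetric] simp del: mult_minus_right intro!: mult_left_mono)
           (metis mult_left_mono minus_le_iff mult_minus_right of_nat_0_le_iff)
      then show ?thesis by (auto simp: J_def intro!: floor_mono)
    qed
    then have "(\<Sum>j\<in>J. (real_of_int j / real m) * indicator (S j) w) = (\<Sum>j\<in>J. if j = \<lfloor>real m * f w\<rfloor> then real_of_int j / real m else 0)"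
      using that by (intro sum.cong) (auto simp: S_def indicator_def)
    also have "\<dots> = g w" using \<open>_ \<in> J\<close> by (simp add: J_def g_def)
    finally show ?thesis by simp
  qed
  have int_g: "(LINT w|N. g w) = (\<Sum>j\<in>J. (real_of_int j / real m) * measure N (S j))"
    and close: "\<bar>(LINT w|N. f w) - (LINT w|N. g w)\<bar> \<le> 1 / real m"
    if N: "prob_space N" "sets N = sets R" for N
  proof -
    interpret N: prob_space N by fact
    have sp: "space N = space R" using N(2) by (rule sets_eq_imp_space_eq)
    have [measurable_cong]: "sets N = sets R" by fact
    have "(LINT w|N. g w) = (LINT w|N. (\<Sum>j\<in>J. (real_of_int j / real m) * indicator (S j) w))"
      by (intro Bochner_Integration.integral_cong gsum) (auto simp: sp)
    also have "\<dots> = (\<Sum>j\<in>J. (real_of_int j / real m) * measure N (S j))"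
      using Sm N(2) by (subst Bochner_Integration.integral_sum) (auto simp: N.emeasure_finite less_top[symmetric])
    finally show "(LINT w|N. g w) = (\<Sum>j\<in>J. (real_of_int j / real m) * measure N (S j))" .
    have fi: "integrable N f"
      by (rule N.integrable_const_bound[of _ K]) (use K sp in auto)
    have [measurable]: "g \<in> borel_measurable N" unfolding g_def by measurable
    have gi: "integrable N g"
      by (rule N.integrable_const_bound[of _ "K + 1 / real m"]) (use K sp gm in \<open>auto intro!: AE_I2, smt (verit)\<close>)
    have "\<bar>(LINT w|N. f w) - (LINT w|N. g w)\<bar> = \<bar>LINT w|N. f w - g w\<bar>"
      using fi gi by simp
    also have "\<dots> \<le> (LINT w|N. \<bar>f w - g w\<bar>)" by (rule integral_abs_bound)
    also have "\<dots> \<le> (LINT w|N. 1 / real m)"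
      using fi gi gm by (intro integral_mono) auto
    finally show "\<bar>(LINT w|N. f w) - (LINT w|N. g w)\<bar> \<le> 1 / real m" by (simp add: N.prob_space)
  qed
  have "(\<lambda>n. \<Sum>j\<in>J. (real_of_int j / real m) * measure (Q n) (S j)) \<longlonglongrightarrow> (\<Sum>j\<in>J. (real_of_int j / real m) * measure R (S j))"
    by (intro tendsto_sum tendsto_mult tendsto_const conv Sm)
  then have "(\<lambda>n. LINT w|Q n. g w) \<longlonglongrightarrow> (LINT w|R. g w)"
    using int_g Q R by simp
  then obtain n0 where n0: "\<And>n. n \<ge> n0 \<Longrightarrow> \<bar>(LINT w|Q n. g w) - (LINT w|R. g w)\<bar> < \<epsilon>/3"
    using \<open>\<epsilon> > 0\<close> LIMSEQ_D[of _ _ "\<epsilon>/3"] by (metis divide_pos_pos real_norm_def zero_less_numeral)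
  have "\<bar>(LINT w|Q n. f w) - (LINT w|R. f w)\<bar> < \<epsilon>" if "n \<ge> n0" for n
    using n0[OF that] close[OF Q(1,2), of n] close[OF R refl] m(2) by linarith
  then show "\<exists>no. \<forall>n\<ge>no. norm ((LINT w|Q n. f w) - (LINT w|R. f w)) < \<epsilon>" by auto
qed

text \<open>
  Pointwise convergence implies convergence in \<open>P\<close>-probability, and uniform absolute continuity makes
  the exceptional sets small for all the measures \<open>Q n\<close> at once.
\<close>

lemma setwise_tendsto_integral_varying_real:
  fixes f :: "nat \<Rightarrow> 'a \<Rightarrow> real"
  assumes P: "prob_space P" and Q: "\<And>n. prob_space (Q n)" "\<And>n. sets (Q n) = sets P"
    and R: "prob_space R" "sets R = sets P" and uac: "unif_abs_cont P Q"
    and conv: "\<And>A. A \<in> sets P \<Longrightarrow> (\<lambda>n. measure (Q n) A) \<longlonglongrightarrow> measure R A"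
    and f[measurable]: "\<And>n. f n \<in> borel_measurable P" "g \<in> borel_measurable P"
    and K: "\<And>n w. w \<in> space P \<Longrightarrow> \<bar>f n w\<bar> \<le> K"
    and lim: "\<And>w. w \<in> space P \<Longrightarrow> (\<lambda>n. f n w) \<longlonglongrightarrow> g w"
  shows "(\<lambda>n. LINT w|Q n. f n w) \<longlonglongrightarrow> (LINT w|R. g w)"
proof -
  interpret P: prob_space P by fact
  interpret Q: prob_space "Q n" for n by fact
  have spQ: "space (Q n) = space P" for n using Q(2) by (rule sets_eq_imp_space_eq)
  have spR: "space R = space P" using R(2) by (rule sets_eq_imp_space_eq)
  have mR[measurable_cong]: "sets R = sets P" by fact
  have mQ[measurable_cong]: "sets (Q n) = sets P" for n by fact
  have gK: "\<bar>g w\<bar> \<le> K" if "w \<in> space P" for w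
    by (rule LIMSEQ_le_const2[OF tendsto_rabs[OF lim[OF that]]]) (use K that in auto)
  have 1: "(\<lambda>n. LINT w|Q n. g w) \<longlonglongrightarrow> (LINT w|R. g w)"
    by (rule setwise_tendsto_integral_real[where K=K]) (use Q R conv gK spR in auto)
  have 2: "(\<lambda>n. (LINT w|Q n. f n w) - (LINT w|Q n. g w)) \<longlonglongrightarrow> 0"
  proof (rule LIMSEQ_I)
    fix \<epsilon> :: real assume e: "\<epsilon> > 0"
    have K0: "K \<ge> 0" using K P.not_empty by (meson abs_ge_zero ex_in_conv order_trans)
    define S where "S n = {w\<in>space P. \<bar>f n w - g w\<bar> > \<epsilon>/2}" for n
    have Sm[measurable]: "S n \<in> sets P" for n unfolding S_def by measurable
    obtain \<delta> where \<delta>: "\<delta> > 0" "\<And>n A. A \<in> sets P \<Longrightarrow> measure P A < \<delta> \<Longrightarrow> measure (Q n) A < \<epsilon>/(4 * (K+1))"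
      using uac e K0 unfolding unif_abs_cont_def
      by (metis add_nonneg_pos divide_pos_pos mult_pos_pos zero_less_numeral zero_less_one)
    have "(\<lambda>n. LINT w|P. indicat_real (S n) w) \<longlonglongrightarrow> (LINT w|P. 0)"
    proof (rule integral_dominated_convergence[where w="\<lambda>_. 1"])
      show "AE w in P. (\<lambda>n. indicat_real (S n) w) \<longlonglongrightarrow> 0"
      proof (rule AE_I2)
        fix w assume w: "w \<in> space P"
        have "\<forall>\<^sub>F n in sequentially. dist (f n w) (g w) < \<epsilon>/2"
          using lim[OF w] e half_gt_zero unfolding tendsto_iff by blast
        then have "\<forall>\<^sub>F n in sequentially. indicat_real (S n) w = 0"
          by eventually_elim (auto simp: S_def dist_real_def)
        then show "(\<lambda>n. indicat_real (S n) w) \<longlonglongrightarrow> 0" by (rule tendsto_eventually)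
      qed
    qed auto
    then have "(\<lambda>n. measure P (S n)) \<longlonglongrightarrow> 0" by simp
    then obtain n0 where n0: "\<And>n. n \<ge> n0 \<Longrightarrow> measure P (S n) < \<delta>"
      using \<delta>(1) LIMSEQ_zero_eventually_less by blast
    have "\<bar>(LINT w|Q n. f n w) - (LINT w|Q n. g w)\<bar> < \<epsilon>" if "n \<ge> n0" for n
    proof -
      have fi: "integrable (Q n) (f n)" "integrable (Q n) g"
        by (rule Q.integrable_const_bound[of _ K]; use K gK spQ in auto)+
      have Si: "integrable (Q n) (\<lambda>w. indicat_real (S n) w)" using Sm mQ by (auto simp: Q.emeasure_finite less_top[symmetric])
      have "\<bar>(LINT w|Q n. f n w) - (LINT w|Q n. g w)\<bar> = \<bar>LINT w|Q n. f n w - g w\<bar>"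
        using fi by simp
      also have "\<dots> \<le> (LINT w|Q n. \<bar>f n w - g w\<bar>)" by (rule integral_abs_bound)
      also have "\<dots> \<le> (LINT w|Q n. \<epsilon>/2 + 2 * K * indicat_real (S n) w)"
      proof (rule integral_mono)
        fix w assume "w \<in> space (Q n)"
        then have w: "w \<in> space P" by (simp add: spQ)
        show "\<bar>f n w - g w\<bar> \<le> \<epsilon>/2 + 2 * K * indicat_real (S n) w"
        proof (cases "w \<in> S n")
          case True then show ?thesis using K[OF w, of n] gK[OF w] e by auto
        next
          case False then show ?thesis using w by (auto simp: S_def)
        qed
      qed (use fi Si in auto)
      also have "\<dots> = \<epsilon>/2 + 2 * K * measure (Q n) (S n)"
        using Si Sm mQ by (simp add: Q.prob_space)
      also have "\<dots> < \<epsilon>"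
      proof -
        have "measure (Q n) (S n) < \<epsilon>/(4 * (K+1))" using \<delta>(2)[OF Sm n0[OF that]] .
        then have "2 * (K+1) * measure (Q n) (S n) < 2 * (K+1) * (\<epsilon>/(4 * (K+1)))"
          using K0 by (intro mult_strict_left_mono) auto
        also have "\<dots> = \<epsilon>/2" using K0 by (simp add: field_simps)
        finally have "2 * (K+1) * measure (Q n) (S n) < \<epsilon>/2" .
        moreover have "2 * K * measure (Q n) (S n) \<le> 2 * (K+1) * measure (Q n) (S n)"
          by (intro mult_right_mono) auto
        ultimately show ?thesis by linarith
      qed
      finally show ?thesis .
    qed
    then show "\<exists>no. \<forall>n\<ge>no. norm ((LINT w|Q n. f n w) - (LINT w|Q n. g w) - 0) < \<epsilon>" by auto
  qed
  show ?thesis using tendsto_add[OF 1 2] by simp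
qed

lemma setwise_tendsto_integral_varying:
  fixes f :: "nat \<Rightarrow> 'a \<Rightarrow> complex"
  assumes P: "prob_space P" and Q: "\<And>n. prob_space (Q n)" "\<And>n. sets (Q n) = sets P"
    and R: "prob_space R" "sets R = sets P" and uac: "unif_abs_cont P Q"
    and conv: "\<And>A. A \<in> sets P \<Longrightarrow> (\<lambda>n. measure (Q n) A) \<longlonglongrightarrow> measure R A"
    and f[measurable]: "\<And>n. f n \<in> borel_measurable P" "g \<in> borel_measurable P"
    and K: "\<And>n w. w \<in> space P \<Longrightarrow> norm (f n w) \<le> K"
    and lim: "\<And>w. w \<in> space P \<Longrightarrow> (\<lambda>n. f n w) \<longlonglongrightarrow> g w"
  shows "(\<lambda>n. CLINT w|Q n. f n w) \<longlonglongrightarrow> (CLINT w|R. g w)"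
proof -
  interpret Q: prob_space "Q n" for n by fact
  interpret R: prob_space R by fact
  have spQ: "space (Q n) = space P" for n using Q(2) by (rule sets_eq_imp_space_eq)
  have spR: "space R = space P" using R(2) by (rule sets_eq_imp_space_eq)
  have mR[measurable_cong]: "sets R = sets P" by fact
  have mQ[measurable_cong]: "sets (Q n) = sets P" for n by fact
  have gK: "norm (g w) \<le> K" if "w \<in> space P" for w
    by (rule LIMSEQ_le_const2[OF tendsto_norm[OF lim[OF that]]]) (use K that in auto)
  have fi: "integrable (Q n) (f n)" for n
    by (rule Q.integrable_const_bound[of _ K]; use K spQ in auto)
  have gi: "integrable R g"
    by (rule R.integrable_const_bound[of _ K]; use gK spR in auto)
  have "(\<lambda>n. LINT w|Q n. Re (f n w)) \<longlonglongrightarrow> (LINT w|R. Re (g w))"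
    by (rule setwise_tendsto_integral_varying_real[OF P Q R uac conv, where K=K])
       (use K lim in \<open>auto intro: order_trans[OF abs_Re_le_cmod] tendsto_Re\<close>)
  moreover have "(\<lambda>n. LINT w|Q n. Im (f n w)) \<longlonglongrightarrow> (LINT w|R. Im (g w))"
    by (rule setwise_tendsto_integral_varying_real[OF P Q R uac conv, where K=K])
       (use K lim in \<open>auto intro: order_trans[OF abs_Im_le_cmod] tendsto_Im\<close>)
  ultimately show ?thesis unfolding tendsto_complex_iff using fi gi by simp
qed

text \<open>
  For the bounded function \<open>min f k\<close> the bound passes to the limit; then Fatou's lemma lets \<open>k\<close> grow.
\<close>

lemma setwise_integral_le:
  fixes f :: "'a \<Rightarrow> real"
  assumes Q: "\<And>n. prob_space (Q n)" "\<And>n. sets (Q n) = sets R" and R: "prob_space R"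
    and conv: "\<And>A. A \<in> sets R \<Longrightarrow> (\<lambda>n. measure (Q n) A) \<longlonglongrightarrow> measure R A"
    and f[measurable]: "f \<in> borel_measurable R" and nn: "\<And>w. 0 \<le> f w"
    and v: "\<And>n. integrable (Q n) f" "\<And>n. (LINT w|Q n. f w) \<le> v"
  shows "integrable R f" "(LINT w|R. f w) \<le> v"
proof -
  interpret R: prob_space R by fact
  have v0: "0 \<le> v" using order_trans[OF Bochner_Integration.integral_nonneg v(2)] nn by blast
  have k: "(\<integral>\<^sup>+w. ennreal (min (f w) (real k)) \<partial>R) \<le> ennreal v" for k
  proof -
    have "(\<lambda>n. LINT w|Q n. min (f w) (real k)) \<longlonglongrightarrow> (LINT w|R. min (f w) (real k))"
      by (rule setwise_tendsto_integral_real[OF Q R conv, where K="real k"]) (use nn in \<open>auto simp: min_def\<close>)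
    moreover have "(LINT w|Q n. min (f w) (real k)) \<le> v" for n
    proof -
      interpret Qn: prob_space "Q n" by (rule Q)
      have "(LINT w|Q n. min (f w) (real k)) \<le> (LINT w|Q n. f w)"
        using v(1)[of n] by (intro integral_mono integrable_min) auto
      then show ?thesis using v(2)[of n] by simp
    qed
    ultimately have "(LINT w|R. min (f w) (real k)) \<le> v" by (intro LIMSEQ_le_const2) auto
    moreover have "integrable R (\<lambda>w. min (f w) (real k))"
      by (rule R.integrable_const_bound[where B="real k"]) (use nn in \<open>auto simp: min_def\<close>)
    ultimately show ?thesis using nn by (simp add: nn_integral_eq_integral ennreal_leI)
  qed
  have "(\<integral>\<^sup>+w. ennreal (f w) \<partial>R) = (\<integral>\<^sup>+w. liminf (\<lambda>k. ennreal (min (f w) (real k))) \<partial>R)"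
  proof (intro nn_integral_cong)
    fix w
    obtain k0 :: nat where "f w \<le> real k0" using real_arch_simple by blast
    then have "\<forall>\<^sub>F k in sequentially. ennreal (min (f w) (real k)) = ennreal (f w)"
      by (intro eventually_sequentiallyI[of k0]) (auto simp: min_def)
    then have "(\<lambda>k. ennreal (min (f w) (real k))) \<longlonglongrightarrow> ennreal (f w)" by (rule tendsto_eventually)
    then show "ennreal (f w) = liminf (\<lambda>k. ennreal (min (f w) (real k)))"
      by (simp add: lim_imp_Liminf)
  qed
  also have "\<dots> \<le> liminf (\<lambda>k. \<integral>\<^sup>+w. ennreal (min (f w) (real k)) \<partial>R)"
    by (rule nn_integral_liminf) measurable
  also have "\<dots> \<le> ennreal v"
    using k by (intro Liminf_le) auto
  finally have le: "(\<integral>\<^sup>+w. ennreal (f w) \<partial>R) \<le> ennreal v" .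
  show i: "integrable R f"
    using le nn by (intro integrableI_bounded) (auto simp: less_top[symmetric] top_unique)
  then have "ennreal (LINT w|R. f w) \<le> ennreal v"
    using le nn by (simp add: nn_integral_eq_integral)
  then show "(LINT w|R. f w) \<le> v" using v0 by simp
qed

section \<open>The Kantorovich distance\<close>

lemma return_zero_in_P1: "return borel 0 \<in> P1"
proof -
  have "integrable (return borel 0) (\<lambda>x::real. \<bar>x\<bar>)"
    unfolding integrable_iff_bounded by (simp add: nn_integral_return)
  then show ?thesis by (simp add: P1_def prob_space_return)
qed

lemma P1_I:
  assumes "prob_space \<mu>" "sets \<mu> = sets borel" "integrable \<mu> (\<lambda>x. \<bar>x\<bar>)"
  shows "\<mu> \<in> P1"
  using assms by (simp add: P1_def)

lemma (in prob_space) distr_in_P1_iff: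
  assumes [measurable]: "X \<in> borel_measurable M"
  shows "distr M borel X \<in> P1 \<longleftrightarrow> integrable M (X :: 'a \<Rightarrow> real)"
proof -
  have "integrable M (\<lambda>w. \<bar>X w\<bar>) \<longleftrightarrow> integrable M X"
    by (rule integrable_abs_iff) simp
  then show ?thesis
    unfolding P1_def using prob_space_distr[OF assms] integrable_distr_eq[OF assms, of "\<lambda>x. \<bar>x\<bar>"]
    by simp
qed

lemma kantorovich_dirac_le:
  assumes "\<mu> \<in> P1"
  shows "kantorovich \<mu> (return borel 0) \<le> (LINT y|\<mu>. \<bar>y\<bar>)"
proof (rule kantorovich_least[OF assms return_zero_in_P1])
  fix h :: "real \<Rightarrow> real" assume h: "1-lipschitz_on UNIV h"
  have [measurable]: "h \<in> borel_measurable borel"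
    using lipschitz_on_continuous_on[OF h] by (rule borel_measurable_continuous_onI)
  show "\<bar>(LINT y|\<mu>. h y) - (LINT y|return borel 0. h y)\<bar> \<le> (LINT y|\<mu>. \<bar>y\<bar>)"
    using lipschitz_integrable_P1(2)[OF assms h] by (simp add: integral_return)
qed

text \<open>
  The pair \<open>(X, Y)\<close> couples the two laws, and a 1-Lipschitz function cannot separate \<open>X\<close> and \<open>Y\<close> by more
  than \<open>\<bar>X - Y\<bar>\<close>.
\<close>

lemma (in prob_space) kantorovich_distr_le:
  fixes X Y :: "'a \<Rightarrow> real"
  assumes X: "integrable M X" and Y: "integrable M Y"
  shows "kantorovich (distr M borel X) (distr M borel Y) \<le> (LINT w|M. \<bar>X w - Y w\<bar>)"
proof (rule kantorovich_least)
  have [measurable]: "X \<in> borel_measurable M" "Y \<in> borel_measurable M" using X Y by auto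
  show XP: "distr M borel X \<in> P1" and YP: "distr M borel Y \<in> P1"
    using X Y by (simp_all add: distr_in_P1_iff)
  fix h :: "real \<Rightarrow> real" assume h: "1-lipschitz_on UNIV h"
  have [measurable]: "h \<in> borel_measurable borel"
    using lipschitz_on_continuous_on[OF h] by (rule borel_measurable_continuous_onI)
  have hX: "integrable M (\<lambda>w. h (X w))" and hY: "integrable M (\<lambda>w. h (Y w))"
    using lipschitz_integrable_P1(1)[OF XP h] lipschitz_integrable_P1(1)[OF YP h]
    by (simp_all add: integrable_distr_eq)
  have "\<bar>(LINT y|distr M borel X. h y) - (LINT y|distr M borel Y. h y)\<bar> = \<bar>LINT w|M. h (X w) - h (Y w)\<bar>"
    using hX hY by (simp add: integral_distr)
  also have "\<dots> \<le> (LINT w|M. \<bar>h (X w) - h (Y w)\<bar>)" by (rule integral_abs_bound)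
  also have "\<dots> \<le> (LINT w|M. \<bar>X w - Y w\<bar>)"
    using hX hY X Y lipschitz_onD[OF h] by (intro integral_mono) (auto simp: dist_real_def)
  finally show "\<bar>(LINT y|distr M borel X. h y) - (LINT y|distr M borel Y. h y)\<bar> \<le> (LINT w|M. \<bar>X w - Y w\<bar>)" .
qed

lemma abs_le_one_plus_square: "\<bar>y\<bar> \<le> 1 + y\<^sup>2" for y :: real
proof -
  have "0 \<le> (\<bar>y\<bar> - 1)\<^sup>2" by simp
  then show ?thesis unfolding power2_diff by simp
qed

lemma square_integrable_imp_P1:
  assumes p: "prob_space \<mu>" and s: "sets \<mu> = sets borel" and i: "integrable \<mu> (\<lambda>y. y\<^sup>2)"
  shows "\<mu> \<in> P1"
proof (rule P1_I[OF p s])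
  interpret prob_space \<mu> by fact
  have [measurable_cong]: "sets \<mu> = sets borel" by fact
  show "integrable \<mu> (\<lambda>y. \<bar>y\<bar>)"
  proof (rule Bochner_Integration.integrable_bound)
    show "integrable \<mu> (\<lambda>y. 1 + y\<^sup>2)" using i by simp
    show "AE y in \<mu>. norm \<bar>y\<bar> \<le> norm (1 + y\<^sup>2)"
      using abs_le_one_plus_square by (intro AE_I2) (simp add: add_nonneg_nonneg)
  qed simp
qed

text \<open>
  Replace \<open>y\<close> by the next lower multiple of \<open>1 / m\<close> if \<open>\<bar>y\<bar> \<le> R\<close>, and by \<open>0\<close> otherwise. A 1-Lipschitz
  function that vanishes at \<open>0\<close> changes by at most \<open>1 / m + y\<^sup>2 / R\<close>, so its integral changes little
  under all the measures. What remains is a finite sum of measures of sets, which converges at a rate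
  that is the same for all 1-Lipschitz functions.
\<close>

lemma kantorovich_tendsto_of_setwise:
  fixes \<mu> :: "nat \<Rightarrow> real measure"
  assumes p: "\<And>n. prob_space (\<mu> n)" "prob_space \<nu>"
    and s: "\<And>n. sets (\<mu> n) = sets borel" "sets \<nu> = sets borel"
    and conv: "\<And>C. C \<in> sets borel \<Longrightarrow> (\<lambda>n. measure (\<mu> n) C) \<longlonglongrightarrow> measure \<nu> C"
    and i: "\<And>n. integrable (\<mu> n) (\<lambda>y. y\<^sup>2)" "integrable \<nu> (\<lambda>y. y\<^sup>2)"
    and c: "\<And>n. (LINT y|\<mu> n. y\<^sup>2) \<le> c" "(LINT y|\<nu>. y\<^sup>2) \<le> c"
  shows "(\<lambda>n. kantorovich (\<mu> n) \<nu>) \<longlonglongrightarrow> 0"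
proof (rule LIMSEQ_I)
  fix \<epsilon> :: real assume e: "\<epsilon> > 0"
  have c0: "c \<ge> 0" using c(2) Bochner_Integration.integral_nonneg[of \<nu> "\<lambda>y. y\<^sup>2"] by (smt (verit) zero_le_power2)
  obtain m :: nat where m: "m > 0" "1 / real m < \<epsilon>/8"
    using reals_Archimedean[of "\<epsilon>/8"] e by (metis divide_pos_pos inverse_eq_divide zero_less_Suc zero_less_numeral)
  \<comment> \<open>Both \<open>1 / m\<close> and \<open>c / R\<close> are at most \<open>\<epsilon> / 8\<close>; each occurs for two measures.\<close>
  define R where "R = 8 * (c + 1) / \<epsilon>"
  have R: "R > 0" "c / R \<le> \<epsilon>/8"
    using c0 e by (auto simp: R_def field_simps)
  define S where "S j = {y. \<bar>y\<bar> \<le> R \<and> \<lfloor>real m * y\<rfloor> = j}" for j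
  define J where "J = {\<lfloor>- (real m * R)\<rfloor>..\<lfloor>real m * R\<rfloor>}"
  have Sm[measurable]: "S j \<in> sets borel" for j unfolding S_def by measurable
  define D where "D n = (\<Sum>j\<in>J. \<bar>real_of_int j / real m\<bar> * \<bar>measure (\<mu> n) (S j) - measure \<nu> (S j)\<bar>)" for n
  have "D \<longlonglongrightarrow> (\<Sum>j\<in>J. \<bar>real_of_int j / real m\<bar> * \<bar>measure \<nu> (S j) - measure \<nu> (S j)\<bar>)"
    unfolding D_def by (intro tendsto_sum tendsto_mult tendsto_const tendsto_rabs tendsto_diff conv Sm)
  then have "D \<longlonglongrightarrow> 0" by simp
  then obtain n0 where n0: "\<And>n. n \<ge> n0 \<Longrightarrow> D n < \<epsilon>/4"
    using LIMSEQ_zero_eventually_less[of D "\<epsilon>/4"] e by auto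
  have "kantorovich (\<mu> n) \<nu> < \<epsilon>" if n: "n \<ge> n0" for n
  proof -
    have "kantorovich (\<mu> n) \<nu> \<le> 4 * (\<epsilon>/8) + D n"
    proof (rule kantorovich_least)
      show P: "\<mu> n \<in> P1" "\<nu> \<in> P1" using p s i by (auto intro: square_integrable_imp_P1)
      fix h0 :: "real \<Rightarrow> real" assume h0: "1-lipschitz_on UNIV h0"
      define h where "h y = h0 y - h0 0" for y
      have hy: "\<bar>h y - h z\<bar> \<le> \<bar>y - z\<bar>" "\<bar>h y\<bar> \<le> \<bar>y\<bar>" for y z
        using lipschitz_onD[OF h0, of y z] lipschitz_onD[OF h0, of y 0] by (auto simp: h_def dist_real_def)
      have [measurable]: "h0 \<in> borel_measurable borel"
        using lipschitz_on_continuous_on[OF h0] by (rule borel_measurable_continuous_onI)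
      have hm[measurable]: "h \<in> borel_measurable borel" unfolding h_def by measurable
      define g where "g y = (\<Sum>j\<in>J. h (real_of_int j / real m) * indicator (S j) y)" for y
      have gm[measurable]: "g \<in> borel_measurable borel" unfolding g_def by measurable
      have hg: "\<bar>h y - g y\<bar> \<le> 1 / real m + y\<^sup>2 / R" for y
      proof (cases "\<bar>y\<bar> \<le> R")
        case True
        have "- (real m * R) \<le> real m * y" "real m * y \<le> real m * R"
          using True m mult_left_mono[of "-R" y "real m"] mult_left_mono[of y R "real m"] by (simp_all add: abs_le_iff)
        then have J: "\<lfloor>real m * y\<rfloor> \<in> J" by (auto simp: J_def intro!: floor_mono)
        have "g y = (\<Sum>j\<in>J. if j = \<lfloor>real m * y\<rfloor> then h (real_of_int j / real m) else 0)"
          unfolding g_def using True by (intro sum.cong) (auto simp: S_def indicator_def)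
        also have "\<dots> = h (real_of_int \<lfloor>real m * y\<rfloor> / real m)" using J by (simp add: J_def)
        finally have "\<bar>h y - g y\<bar> \<le> \<bar>y - real_of_int \<lfloor>real m * y\<rfloor> / real m\<bar>" using hy by simp
        also have "\<dots> = \<bar>(real m * y - real_of_int \<lfloor>real m * y\<rfloor>) / real m\<bar>"
          using m by (simp add: diff_divide_distrib)
        also have "\<dots> \<le> 1 / real m"
        proof -
          have "\<bar>real m * y - real_of_int \<lfloor>real m * y\<rfloor>\<bar> \<le> 1" by linarith
          then show ?thesis using m by (simp add: divide_right_mono)
        qed
        finally show ?thesis using R by (simp add: add_increasing2)
      next
        case False
        then have "g y = 0" by (auto simp: g_def S_def)
        moreover have "\<bar>y\<bar> \<le> y\<^sup>2 / R"
        proof -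
          have "\<bar>y\<bar> * R \<le> \<bar>y\<bar> * \<bar>y\<bar>" using False by (intro mult_left_mono) auto
          then show ?thesis using R by (simp add: pos_le_divide_eq power2_eq_square)
        qed
        ultimately show ?thesis using hy(2)[of y] by (simp add: add_increasing)
      qed
      have close: "\<bar>(LINT y|N. h y) - (\<Sum>j\<in>J. h (real_of_int j / real m) * measure N (S j))\<bar> \<le> 2 * (\<epsilon>/8)"
        and eq0: "(LINT y|N. h y) = (LINT y|N. h0 y) - h0 0"
        if N: "N \<in> P1" and iN: "integrable N (\<lambda>y. y\<^sup>2)" and cN: "(LINT y|N. y\<^sup>2) \<le> c" for N
      proof -
        interpret N: prob_space N using N by (simp add: P1_def)
        have sN[measurable_cong]: "sets N = sets borel" using N by (simp add: P1_def)
        have h0i: "integrable N h0" using lipschitz_integrable_P1(1)[OF N h0] .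
        then have hi: "integrable N h" unfolding h_def by simp
        show "(LINT y|N. h y) = (LINT y|N. h0 y) - h0 0" unfolding h_def using h0i by (simp add: N.prob_space)
        have Si: "integrable N (\<lambda>y. h (real_of_int j / real m) * indicator (S j) y)" for j
          using Sm sN by (intro integrable_mult_right) (auto simp: N.emeasure_finite less_top[symmetric])
        have gi: "integrable N g" unfolding g_def using Si by (intro Bochner_Integration.integrable_sum)
        have "(LINT y|N. g y) = (\<Sum>j\<in>J. h (real_of_int j / real m) * measure N (S j))"
          unfolding g_def using Si Sm sN by (subst Bochner_Integration.integral_sum) auto
        then have "\<bar>(LINT y|N. h y) - (\<Sum>j\<in>J. h (real_of_int j / real m) * measure N (S j))\<bar> = \<bar>LINT y|N. h y - g y\<bar>"
          using hi gi by simp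
        also have "\<dots> \<le> (LINT y|N. \<bar>h y - g y\<bar>)" by (rule integral_abs_bound)
        also have "\<dots> \<le> (LINT y|N. 1 / real m + y\<^sup>2 / R)"
          using hi gi iN hg by (intro integral_mono) auto
        also have "\<dots> = 1 / real m + (LINT y|N. y\<^sup>2) / R" using iN by (simp add: N.prob_space)
        also have "\<dots> \<le> 1 / real m + c / R" using cN R by (intro add_left_mono divide_right_mono) auto
        finally show "\<bar>(LINT y|N. h y) - (\<Sum>j\<in>J. h (real_of_int j / real m) * measure N (S j))\<bar> \<le> 2 * (\<epsilon>/8)"
          using R(2) m(2) by linarith
      qed
      have "\<bar>(\<Sum>j\<in>J. h (real_of_int j / real m) * measure (\<mu> n) (S j)) - (\<Sum>j\<in>J. h (real_of_int j / real m) * measure \<nu> (S j))\<bar>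
          = \<bar>\<Sum>j\<in>J. h (real_of_int j / real m) * (measure (\<mu> n) (S j) - measure \<nu> (S j))\<bar>"
        by (simp add: sum_subtractf right_diff_distrib)
      also have "\<dots> \<le> D n"
        unfolding D_def by (rule order_trans[OF sum_abs sum_mono]) (simp only: abs_mult, rule mult_right_mono[OF hy(2)], simp)
      finally show "\<bar>(LINT y|\<mu> n. h0 y) - (LINT y|\<nu>. h0 y)\<bar> \<le> 4 * (\<epsilon>/8) + D n"
        using close[OF P(1) i(1) c(1)] close[OF P(2) i(2) c(2)] eq0[OF P(1) i(1) c(1)] eq0[OF P(2) i(2) c(2)]
        by linarith
    qed
    then show ?thesis using n0[OF n] e by linarith
  qed
  then show "\<exists>no. \<forall>n\<ge>no. norm (kantorovich (\<mu> n) \<nu> - 0) < \<epsilon>" by auto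
qed

text \<open>
  The modulus is the one of a Brownian motion with an integrable drift, measured in mean.
\<close>

lemma continuous_map_P1I:
  assumes P: "\<And>s. s \<in> {0..T} \<Longrightarrow> m s \<in> P1"
    and K: "\<And>s t. 0 \<le> s \<Longrightarrow> s \<le> t \<Longrightarrow> t \<le> T \<Longrightarrow> kantorovich (m s) (m t) \<le> sqrt (t - s) + c * (t - s)"
  shows "continuous_map (top_of_set {0..T}) P1.mtopology m"
  unfolding P1.continuous_map_to_metric
proof (intro ballI allI impI)
  fix s and \<epsilon> :: real assume "s \<in> topspace (top_of_set {0..T})" and e: "\<epsilon> > 0"
  then have s: "s \<in> {0..T}" by simp
  have "((\<lambda>d. sqrt \<bar>d\<bar> + c * \<bar>d\<bar>) \<longlongrightarrow> sqrt \<bar>0\<bar> + c * \<bar>0\<bar>) (nhds 0)"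
    by (intro tendsto_intros filterlim_ident)
  then have "\<forall>\<^sub>F d in nhds 0. sqrt \<bar>d\<bar> + c * \<bar>d\<bar> < \<epsilon>"
    using e order_tendstoD(2)[of "\<lambda>d. sqrt \<bar>d\<bar> + c * \<bar>d\<bar>" 0 "nhds 0" \<epsilon>] by simp
  then obtain \<delta> where \<delta>: "\<delta> > 0" "\<And>d. \<bar>d\<bar> < \<delta> \<Longrightarrow> sqrt \<bar>d\<bar> + c * \<bar>d\<bar> < \<epsilon>"
    unfolding eventually_nhds_metric by (auto simp: dist_real_def)
  show "\<exists>U. openin (top_of_set {0..T}) U \<and> s \<in> U \<and> (\<forall>t\<in>U. m t \<in> P1.mball (m s) \<epsilon>)"
  proof (intro exI[of _ "{0..T} \<inter> ball s \<delta>"] conjI ballI)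
    show "openin (top_of_set {0..T}) ({0..T} \<inter> ball s \<delta>)" by (simp add: openin_open_Int)
    show "s \<in> {0..T} \<inter> ball s \<delta>" using s \<delta> by simp
    fix t assume "t \<in> {0..T} \<inter> ball s \<delta>"
    then have t: "t \<in> {0..T}" "\<bar>t - s\<bar> < \<delta>" by (auto simp: dist_real_def)
    have "kantorovich (m s) (m t) \<le> sqrt \<bar>t - s\<bar> + c * \<bar>t - s\<bar>"
      using K[of s t] K[of t s] P1.commute[of "m s" "m t"] s t(1) by (cases "s \<le> t") auto
    also have "\<dots> < \<epsilon>" using \<delta>(2) t(2) by simp
    finally show "m t \<in> P1.mball (m s) \<epsilon>" using P s t(1) by (simp add: P1.in_mball)
  qed
qed

lemma measurable_continuous_flow:
  assumes "continuous_map (top_of_set {0..T}) P1.mtopology m"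
  shows "m \<in> measurable (restrict_space borel {0..T}) borel_P1"
  unfolding borel_P1_def
proof (rule measurable_measure_of)
  show "{U. openin P1.mtopology U} \<subseteq> Pow P1"
    using openin_subset by fastforce
  show "m \<in> space (restrict_space borel {0..T}) \<rightarrow> P1"
    using continuous_map_image_subset_topspace[OF assms] by (auto simp: space_restrict_space)
  fix U assume "U \<in> {U. openin P1.mtopology U}"
  then have "openin P1.mtopology U" by (rule CollectD)
  from openin_continuous_map_preimage[OF assms this]
  have "openin (top_of_set {0..T}) {s \<in> {0..T}. m s \<in> U}"
    by (simp only: topspace_euclidean_subtopology)
  then obtain V where V: "open V" "{s \<in> {0..T}. m s \<in> U} = {0..T} \<inter> V"
    by (rule openin_subtopology[THEN iffD1, THEN exE]) (metis Int_commute open_openin)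
  have "m -` U \<inter> space (restrict_space borel {0..T}) = {0..T} \<inter> V"
    unfolding V(2)[symmetric] space_restrict_space by auto
  then show "m -` U \<inter> space (restrict_space borel {0..T}) \<in> sets (restrict_space borel {0..T})"
    using V(1) by (auto simp: sets_restrict_space)
qed

text \<open>
  Jensen's inequality, from \<open>2 m \<bar>y\<bar> \<le> y\<^sup>2 + m\<^sup>2\<close> with \<open>m\<close> the mean of \<open>\<bar>Y\<bar>\<close>.
\<close>

lemma (in prob_space) abs_mean_le:
  fixes Y :: "'a \<Rightarrow> real"
  assumes [measurable]: "Y \<in> borel_measurable M" and Y2: "integrable M (\<lambda>w. (Y w)\<^sup>2)"
    and \<sigma>: "expectation (\<lambda>w. (Y w)\<^sup>2) \<le> \<sigma>\<^sup>2" "\<sigma> \<ge> 0"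
  shows "integrable M (\<lambda>w. \<bar>Y w\<bar>)" "expectation (\<lambda>w. \<bar>Y w\<bar>) \<le> \<sigma>"
proof -
  show i: "integrable M (\<lambda>w. \<bar>Y w\<bar>)"
    by (rule Bochner_Integration.integrable_bound[of _ "\<lambda>w. 1 + (Y w)\<^sup>2"])
      (use Y2 abs_le_one_plus_square in \<open>auto simp: add_nonneg_nonneg\<close>)
  define m where "m = expectation (\<lambda>w. \<bar>Y w\<bar>)"
  have "2 * m * m = expectation (\<lambda>w. 2 * m * \<bar>Y w\<bar>)" by (simp add: m_def)
  also have "\<dots> \<le> expectation (\<lambda>w. (Y w)\<^sup>2 + m\<^sup>2)"
  proof (rule integral_mono)
    show "2 * m * \<bar>Y w\<bar> \<le> (Y w)\<^sup>2 + m\<^sup>2" for w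
      using sum_squares_bound[of m "\<bar>Y w\<bar>"] by simp
  qed (use i Y2 in auto)
  also have "\<dots> \<le> \<sigma>\<^sup>2 + m\<^sup>2" using Y2 \<sigma> by (simp add: prob_space)
  finally have "m\<^sup>2 \<le> \<sigma>\<^sup>2" by (simp add: power2_eq_square)
  then show "expectation (\<lambda>w. \<bar>Y w\<bar>) \<le> \<sigma>" using \<sigma>(2) power2_le_imp_le unfolding m_def by blast
qed

lemma distributed_normal_square:
  fixes Y :: "'a \<Rightarrow> real"
  assumes d: "distributed M lborel Y (normal_density 0 \<sigma>)" and \<sigma>: "\<sigma> > 0"
  shows "integrable M (\<lambda>w. (Y w)\<^sup>2)" "(LINT w|M. (Y w)\<^sup>2) = \<sigma>\<^sup>2"
proof -
  show "integrable M (\<lambda>w. (Y w)\<^sup>2)"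
    using integrable_normal_moment[of \<sigma> 0 2] \<sigma> distributed_integrable[OF d, of "\<lambda>y. y\<^sup>2"] by simp
  show "(LINT w|M. (Y w)\<^sup>2) = \<sigma>\<^sup>2"
    using integral_normal_moment_even[of \<sigma> 0 1] \<sigma> distributed_integral[OF d, of "\<lambda>y. y\<^sup>2"]
    by (simp add: fact_numeral)
qed

section \<open>Continuous processes and integrals over intervals\<close>

text \<open>
  Reading the process at the last multiple of \<open>1 / (n + 1)\<close> before \<open>t\<close> involves only countably many of
  the variables \<open>f t\<close>, and path continuity gives convergence as \<open>n\<close> grows.
\<close>

lemma borel_measurable_continuous_process:
  fixes f :: "real \<Rightarrow> 'w \<Rightarrow> real"
  assumes m: "\<And>t. f t \<in> borel_measurable M"
    and c: "\<And>w. w \<in> space M \<Longrightarrow> continuous_on UNIV (\<lambda>t. f t w)"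
  shows "(\<lambda>(t, w). f t w) \<in> borel_measurable (borel \<Otimes>\<^sub>M M)"
proof (rule borel_measurable_LIMSEQ_real)
  fix n :: nat
  have "(\<lambda>p. f (real_of_int \<lfloor>real (Suc n) * fst p\<rfloor> / real (Suc n)) (snd p)) \<in> borel_measurable (borel \<Otimes>\<^sub>M M)"
    by (rule measurable_compose_countable'[where I=UNIV and g="\<lambda>p. \<lfloor>real (Suc n) * fst p\<rfloor>" and
        f="\<lambda>i p. f (real_of_int i / real (Suc n)) (snd p)"])
      (auto intro: measurable_compose[OF measurable_snd m])
  then show "(\<lambda>p. f (real_of_int \<lfloor>real (Suc n) * fst p\<rfloor> / real (Suc n)) (snd p)) \<in> borel_measurable (borel \<Otimes>\<^sub>M M)" .
next
  fix p :: "real \<times> 'w" assume "p \<in> space (borel \<Otimes>\<^sub>M M)"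
  then have w: "snd p \<in> space M" by (auto simp: space_pair_measure)
  have "(\<lambda>n. real_of_int \<lfloor>real (Suc n) * fst p\<rfloor> / real (Suc n)) \<longlonglongrightarrow> fst p"
  proof (rule real_tendsto_sandwich)
    show "\<forall>\<^sub>F n in sequentially. fst p - 1 / real (Suc n) \<le> real_of_int \<lfloor>real (Suc n) * fst p\<rfloor> / real (Suc n)"
    proof (rule always_eventually, rule allI)
      fix n
      have "real (Suc n) * fst p - 1 \<le> real_of_int \<lfloor>real (Suc n) * fst p\<rfloor>" by linarith
      then have "(real (Suc n) * fst p - 1) / real (Suc n) \<le> real_of_int \<lfloor>real (Suc n) * fst p\<rfloor> / real (Suc n)"
        by (rule divide_right_mono) simp
      then show "fst p - 1 / real (Suc n) \<le> real_of_int \<lfloor>real (Suc n) * fst p\<rfloor> / real (Suc n)"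
        by (simp add: diff_divide_distrib del: of_nat_Suc)
    qed
    show "\<forall>\<^sub>F n in sequentially. real_of_int \<lfloor>real (Suc n) * fst p\<rfloor> / real (Suc n) \<le> fst p"
    proof (rule always_eventually, rule allI)
      fix n
      have "real_of_int \<lfloor>real (Suc n) * fst p\<rfloor> \<le> real (Suc n) * fst p" by linarith
      then show "real_of_int \<lfloor>real (Suc n) * fst p\<rfloor> / real (Suc n) \<le> fst p"
        by (simp add: field_simps)
    qed
    have "(\<lambda>n. 1 / real (Suc n)) \<longlonglongrightarrow> 0" using LIMSEQ_Suc[OF lim_1_over_n] by simp
    then show "(\<lambda>n. fst p - 1 / real (Suc n)) \<longlonglongrightarrow> fst p"
      using tendsto_diff[of "\<lambda>_. fst p" "fst p"] by fastforce
  qed simp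
  moreover have "isCont (\<lambda>t. f t (snd p)) (fst p)"
    using c[OF w] by (simp add: continuous_on_eq_continuous_at)
  ultimately show "(\<lambda>n. f (real_of_int \<lfloor>real (Suc n) * fst p\<rfloor> / real (Suc n)) (snd p)) \<longlonglongrightarrow> (case p of (t, w) \<Rightarrow> f t w)"
    unfolding case_prod_beta by (rule isCont_tendsto_compose[rotated])
qed

lemma set_integral_interval_add:
  fixes f :: "real \<Rightarrow> real"
  assumes f: "set_integrable lborel {a..c} f" and "a \<le> u" "u \<le> c"
  shows "(LBINT s:{a..c}. f s) = (LBINT s:{a..u}. f s) + (LBINT s:{u..c}. f s)"
proof -
  have i: "set_integrable lborel {a..u} f" "set_integrable lborel {u..c} f"
    using assms by (auto intro: set_integrable_subset[OF f])
  have "(LBINT s:{a..c}. f s) = (LBINT s. indicator {a..u} s *\<^sub>R f s + indicator {u..c} s *\<^sub>R f s)"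
    unfolding set_lebesgue_integral_def
  proof (rule integral_cong_AE)
    show "AE s in lborel. indicator {a..c} s *\<^sub>R f s = indicator {a..u} s *\<^sub>R f s + indicator {u..c} s *\<^sub>R f s"
      using AE_lborel_singleton[of u] by eventually_elim (use assms in \<open>auto split: split_indicator\<close>)
    show "(\<lambda>s. indicator {a..c} s *\<^sub>R f s) \<in> borel_measurable lborel"
      "(\<lambda>s. indicator {a..u} s *\<^sub>R f s + indicator {u..c} s *\<^sub>R f s) \<in> borel_measurable lborel"
      using f i unfolding set_integrable_def by (auto intro: borel_measurable_add borel_measurable_integrable)
  qed
  then show ?thesis using i unfolding set_lebesgue_integral_def set_integrable_def by simp
qed

lemma abs_set_integral_le:
  fixes f :: "real \<Rightarrow> real"
  assumes f: "set_integrable lborel {a..c} f" and "a \<le> c" and K: "\<And>s. s \<in> {a..c} \<Longrightarrow> \<bar>f s\<bar> \<le> K"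
  shows "\<bar>LBINT s:{a..c}. f s\<bar> \<le> K * (c - a)"
proof -
  have K0: "K \<ge> 0" using K[of a] assms(2) abs_ge_zero[of "f a"] by simp
  have "\<bar>LBINT s:{a..c}. f s\<bar> \<le> (LBINT s. \<bar>indicator {a..c} s *\<^sub>R f s\<bar>)"
    unfolding set_lebesgue_integral_def by (rule integral_abs_bound)
  also have "\<dots> \<le> (LBINT s. K * indicator {a..c} s)"
  proof (rule integral_mono)
    show "integrable lborel (\<lambda>s. K * indicator {a..c} s)"
      by (intro integrable_mult_right integrable_real_indicator) (auto simp: emeasure_lborel_Icc_eq)
  qed (use f K K0 in \<open>auto simp: set_integrable_def split: split_indicator\<close>)
  also have "\<dots> = K * (c - a)" using assms(2) by simp
  finally show ?thesis .
qed

lemma set_integral_point: "(LBINT s:{u..u}. f s) = (0 :: real)" for u :: real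
  unfolding set_lebesgue_integral_def
proof (rule integral_eq_zero_AE)
  show "AE s in lborel. indicator {u..u} s *\<^sub>R f s = 0"
    using AE_lborel_singleton[of u] by eventually_elim (auto split: split_indicator)
qed

section \<open>Levy's construction of Brownian paths\<close>

definition tent :: "real \<Rightarrow> real" where
  "tent x = max 0 (1 - \<bar>2 * x - 1\<bar>)"

text \<open>
  The partial sums of Levy's series for a Brownian path on \<open>[0, 1]\<close>. The first coefficient is the value
  at time \<open>1\<close>; level \<open>n\<close> shifts the path at the midpoints of the grid of mesh \<open>2\<^sup>-\<^sup>n\<close> by the coefficients
  with the indices \<open>2\<^sup>n, \<dots>, 2\<^sup>n\<^sup>+\<^sup>1 - 1\<close>, scaled to the conditional standard deviation \<open>sqrt (2\<^sup>-\<^sup>n) / 2\<close> of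
  Brownian motion there.
\<close>

primrec levy :: "nat \<Rightarrow> (nat \<Rightarrow> real) \<Rightarrow> real \<Rightarrow> real" where
  "levy 0 z t = z 0 * t"
| "levy (Suc n) z t = levy n z t + sqrt (1 / 2 ^ n) / 2 * (\<Sum>k<2 ^ n. z (2 ^ n + k) * tent (2 ^ n * t - real k))"

lemma tent_int: "tent (of_int p) = 0"
proof -
  have "p \<le> 0 \<or> p \<ge> 1" by linarith
  then have "real_of_int p \<le> 0 \<or> real_of_int p \<ge> 1" by linarith
  then have "\<bar>2 * real_of_int p - 1\<bar> \<ge> 1" by linarith
  then show ?thesis by (simp add: tent_def)
qed

lemma tent_half_int: "tent (of_int p + 1/2) = (if p = 0 then 1 else 0)"
proof (cases "p = 0")
  case False
  then have "\<bar>p\<bar> \<ge> 1" by linarith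
  then have "\<bar>2 * real_of_int p\<bar> \<ge> 1" by linarith
  then show ?thesis using False by (simp add: tent_def algebra_simps)
qed (simp add: tent_def)

lemma tent_nonneg: "0 \<le> tent x" and tent_le_one: "tent x \<le> 1"
  by (auto simp: tent_def)

lemma tent_pos_iff: "tent x > 0 \<longleftrightarrow> 0 < x \<and> x < 1"
  by (auto simp: tent_def)

text \<open>
  The function \<open>max 0 (N - \<bar>y\<bar>)\<close> is affine between consecutive integers.
\<close>

lemma hat_midpoint_int:
  fixes p N :: int
  assumes "N \<ge> 1"
  shows "max 0 (of_int N - \<bar>of_int p + 1/2\<bar>) =
    (max 0 (of_int N - \<bar>of_int p\<bar>) + max 0 (of_int N - \<bar>of_int p + 1\<bar>)) / (2::real)"
proof -
  consider "p \<ge> N" | "0 \<le> p" "p \<le> N - 1" | "p \<le> - 1" "- N \<le> p" | "p \<le> - N - 1" by linarith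
  then show ?thesis
  proof cases
    case 1
    then have "real_of_int p \<ge> of_int N" "real_of_int N \<ge> 1" using assms by linarith+
    then show ?thesis by (auto simp: max_def abs_if)
  next
    case 2
    then have "real_of_int p \<ge> 0" "real_of_int p \<le> of_int N - 1" using assms by linarith+
    then show ?thesis by (auto simp: max_def abs_if)
  next
    case 3
    then have "real_of_int p \<le> - 1" "- of_int N \<le> real_of_int p" using assms by linarith+
    then show ?thesis by (auto simp: max_def abs_if)
  next
    case 4
    then have "real_of_int p \<le> - of_int N - 1" "real_of_int N \<ge> 1" using assms by linarith+
    then show ?thesis by (auto simp: max_def abs_if)
  qed
qed

text \<open>
  A tent of a coarser level has its three break points on the grid of level \<open>n\<close>; in units of that grid
  it is the integer hat function.
\<close>

lemma tent_midpoint: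
  assumes "m < n"
  shows "tent (2 ^ m * ((2 * real k + 1) / 2 ^ Suc n) - real j) =
    (tent (2 ^ m * (real k / 2 ^ n) - real j) + tent (2 ^ m * ((real k + 1) / 2 ^ n) - real j)) / 2"
proof -
  obtain d where n: "n = Suc (m + d)" using assms less_imp_Suc_add by blast
  define N :: int where "N = 2 ^ d"
  define p :: int where "p = int k - 2 * N * int j - N"
  have N: "N \<ge> 1" by (simp add: N_def)
  have Nr: "real_of_int N = 2 ^ d" by (simp add: N_def)
  have scale: "tent (2 ^ m * ((real k + y) / 2 ^ n) - real j) = max 0 (of_int N - \<bar>of_int p + y\<bar>) / of_int N" for y
  proof -
    have "2 * (2 ^ m * ((real k + y) / 2 ^ n) - real j) - 1 = (of_int p + y) / of_int N"
      by (simp add: n p_def Nr power_add field_simps)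
    then have "tent (2 ^ m * ((real k + y) / 2 ^ n) - real j) = max 0 (1 - \<bar>(of_int p + y) / of_int N\<bar>)"
      by (simp add: tent_def)
    also have "1 - \<bar>(of_int p + y) / of_int N\<bar> = (of_int N - \<bar>of_int p + y\<bar>) / of_int N"
      using N by (simp add: diff_divide_distrib)
    also have "max 0 ((of_int N - \<bar>of_int p + y\<bar>) / of_int N) = max 0 (of_int N - \<bar>of_int p + y\<bar>) / of_int N"
      using N by (auto simp: max_def field_simps)
    finally show ?thesis .
  qed
  have "(2 * real k + 1) / 2 ^ Suc n = (real k + 1/2) / 2 ^ n" by (simp add: field_simps)
  then have "tent (2 ^ m * ((2 * real k + 1) / 2 ^ Suc n) - real j) = max 0 (of_int N - \<bar>of_int p + 1/2\<bar>) / of_int N"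
    using scale[of "1/2"] by simp
  also have "\<dots> = (max 0 (of_int N - \<bar>of_int p\<bar>) / of_int N + max 0 (of_int N - \<bar>of_int p + 1\<bar>) / of_int N) / 2"
    unfolding hat_midpoint_int[OF N] by (simp add: add_divide_distrib)
  finally show ?thesis using scale[of 0] scale[of 1] by simp
qed

lemma levy_midpoint:
  assumes "m \<le> n"
  shows "levy m z ((2 * real k + 1) / 2 ^ Suc n) = (levy m z (real k / 2 ^ n) + levy m z ((real k + 1) / 2 ^ n)) / 2"
  using assms
proof (induction m)
  case 0
  show ?case by (simp add: field_simps)
next
  case (Suc m)
  then have "m < n" by simp
  let ?z = "\<lambda>j. z (2 ^ m + j)"
  let ?a = "\<lambda>j. tent (2 ^ m * (real k / 2 ^ n) - real j)"
  let ?b = "\<lambda>j. tent (2 ^ m * ((real k + 1) / 2 ^ n) - real j)"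
  have "(\<Sum>j<2 ^ m. ?z j * ((?a j + ?b j) / 2)) = (\<Sum>j<2 ^ m. ?z j * ?a j / 2 + ?z j * ?b j / 2)"
    by (intro sum.cong refl) (simp only: distrib_left times_divide_eq_right add_divide_distrib)
  also have "\<dots> = ((\<Sum>j<2 ^ m. ?z j * ?a j) + (\<Sum>j<2 ^ m. ?z j * ?b j)) / 2"
    by (simp only: sum.distrib sum_divide_distrib add_divide_distrib)
  finally have s: "(\<Sum>j<2 ^ m. ?z j * ((?a j + ?b j) / 2)) = ((\<Sum>j<2 ^ m. ?z j * ?a j) + (\<Sum>j<2 ^ m. ?z j * ?b j)) / 2" .
  have alg: "(p + q) / 2 + c * ((x + y) / 2) = (p + c * x + (q + c * y)) / 2" for p q c x y :: real
    by (simp add: field_simps)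
  have "levy m z ((2 * real k + 1) / 2 ^ Suc n) = (levy m z (real k / 2 ^ n) + levy m z ((real k + 1) / 2 ^ n)) / 2"
    using Suc by simp
  then show ?case
    unfolding levy.simps tent_midpoint[OF \<open>m < n\<close>] s by (simp only: alg)
qed

lemma levy_dyadic_old: "levy (Suc n) z (real k / 2 ^ n) = levy n z (real k / 2 ^ n)"
proof -
  have "tent (2 ^ n * (real k / 2 ^ n) - real j) = 0" for j
    using tent_int[of "int k - int j"] by simp
  then show ?thesis by simp
qed

lemma levy_dyadic_stable:
  assumes "m \<ge> n"
  shows "levy m z (real k / 2 ^ n) = levy n z (real k / 2 ^ n)"
  using assms
proof (induction m rule: dec_induct)
  case (step m)
  have "real k / 2 ^ n = real (k * 2 ^ (m - n)) / 2 ^ m"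
    using step(1) by (simp add: field_simps flip: power_add)
  then show ?case using step levy_dyadic_old[of m z "k * 2 ^ (m - n)"] by simp
qed simp

lemma levy_dyadic_new:
  assumes "k < 2 ^ n"
  shows "levy (Suc n) z ((2 * real k + 1) / 2 ^ Suc n) =
    (levy n z (real k / 2 ^ n) + levy n z ((real k + 1) / 2 ^ n)) / 2 + sqrt (1 / 2 ^ n) / 2 * z (2 ^ n + k)"
proof -
  have "tent (2 ^ n * ((2 * real k + 1) / 2 ^ Suc n) - real j) = (if j = k then 1 else 0)" for j
  proof -
    have "2 ^ n * ((2 * real k + 1) / 2 ^ Suc n) - real j = real_of_int (int k - int j) + 1/2"
      by (simp add: field_simps)
    then show ?thesis by (simp only: tent_half_int) auto
  qed
  then have "(\<Sum>j<2 ^ n. z (2 ^ n + j) * tent (2 ^ n * ((2 * real k + 1) / 2 ^ Suc n) - real j)) =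
    (\<Sum>j<2 ^ n. if j = k then z (2 ^ n + j) else 0)"
    by (intro sum.cong refl) (simp only: if_distrib[of "\<lambda>x. _ * x"] mult_1_right mult_zero_right)
  also have "\<dots> = z (2 ^ n + k)" using assms by simp
  finally show ?thesis
    unfolding levy.simps levy_midpoint[OF order_refl] by simp
qed

lemma sum_lessThan_double: "(\<Sum>k<2 * m. f k) = (\<Sum>k<m. f (2 * k) + f (2 * k + 1))" for f :: "nat \<Rightarrow> real"
  by (induction m) (auto simp: algebra_simps)

lemma sum_lessThan_split: "(\<Sum>i<m + l. f i) = (\<Sum>i<m. f i) + (\<Sum>i<l. f (m + i))" for f :: "nat \<Rightarrow> real"
  by (induction l) (auto simp: algebra_simps)

text \<open>
  Up to the factor \<open>2\<^sup>-\<^sup>n\<^sup>/\<^sup>2\<close>, the coefficients determine the increments of level \<open>n\<close> by an orthogonal map,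
  and this is all that is needed for the joint law of the increments. In the inductive step an
  increment \<open>\<Delta>\<close> splits into \<open>\<Delta> / 2 + c z\<close> and \<open>\<Delta> / 2 - c z\<close> with \<open>c\<^sup>2 = 2\<^sup>-\<^sup>n / 4\<close>, and
  \<open>((p + q) / 2)\<^sup>2 + ((p - q) / 2)\<^sup>2 = (p\<^sup>2 + q\<^sup>2) / 2\<close>.
\<close>

lemma levy_increments_isometry:
  "\<exists>w. (\<forall>z. (\<Sum>k<2 ^ n. u k * (levy n z ((real k + 1) / 2 ^ n) - levy n z (real k / 2 ^ n))) = (\<Sum>i<2 ^ n. w i * z i))
     \<and> (\<Sum>i<2 ^ n. (w i)\<^sup>2) = (\<Sum>k<2 ^ n. (u k)\<^sup>2) / 2 ^ n"
proof (induction n arbitrary: u)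
  case 0
  show ?case by (rule exI[of _ u]) simp
next
  case (Suc n)
  let ?\<Delta> = "\<lambda>z k. levy n z ((real k + 1) / 2 ^ n) - levy n z (real k / 2 ^ n)"
  let ?D = "\<lambda>z k. levy (Suc n) z ((real k + 1) / 2 ^ Suc n) - levy (Suc n) z (real k / 2 ^ Suc n)"
  define c :: real where "c = sqrt (1 / 2 ^ n) / 2"
  have c2: "c\<^sup>2 = 1 / 2 ^ n / 4" by (simp add: c_def power_divide)
  define v where "v k = (u (2 * k) + u (2 * k + 1)) / 2" for k
  obtain w where w: "\<And>z. (\<Sum>k<2 ^ n. v k * ?\<Delta> z k) = (\<Sum>i<2 ^ n. w i * z i)"
    "(\<Sum>i<2 ^ n. (w i)\<^sup>2) = (\<Sum>k<2 ^ n. (v k)\<^sup>2) / 2 ^ n"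
    using Suc.IH[of v] by auto
  define w' where "w' i = (if i < 2 ^ n then w i else c * (u (2 * (i - 2 ^ n)) - u (2 * (i - 2 ^ n) + 1)))" for i
  have D: "?D z (2 * k) = ?\<Delta> z k / 2 + c * z (2 ^ n + k)" "?D z (2 * k + 1) = ?\<Delta> z k / 2 - c * z (2 ^ n + k)"
    if "k < 2 ^ n" for z k
  proof -
    have e: "real (2 * k) / 2 ^ Suc n = real k / 2 ^ n" "(real (2 * k) + 1) / 2 ^ Suc n = (2 * real k + 1) / 2 ^ Suc n"
      "real (2 * k + 1) / 2 ^ Suc n = (2 * real k + 1) / 2 ^ Suc n"
      "(real (2 * k + 1) + 1) / 2 ^ Suc n = real (k + 1) / 2 ^ n" "(real k + 1) / 2 ^ n = real (k + 1) / 2 ^ n"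
      by (auto simp: field_simps)
    show "?D z (2 * k) = ?\<Delta> z k / 2 + c * z (2 ^ n + k)"
      unfolding e levy_dyadic_new[OF that] levy_dyadic_old c_def by (simp add: field_simps)
    show "?D z (2 * k + 1) = ?\<Delta> z k / 2 - c * z (2 ^ n + k)"
      unfolding e levy_dyadic_new[OF that] levy_dyadic_old c_def by (simp add: field_simps)
  qed
  show ?case
  proof (intro exI[of _ w'] conjI allI)
    fix z
    have "(\<Sum>k<2 ^ Suc n. u k * ?D z k) = (\<Sum>k<2 ^ n. u (2 * k) * ?D z (2 * k) + u (2 * k + 1) * ?D z (2 * k + 1))"
      unfolding power_Suc sum_lessThan_double ..
    also have "\<dots> = (\<Sum>k<2 ^ n. v k * ?\<Delta> z k + c * (u (2 * k) - u (2 * k + 1)) * z (2 ^ n + k))"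
    proof (rule sum.cong[OF refl])
      fix k :: nat assume "k \<in> {..<2 ^ n}"
      then have k: "k < 2 ^ n" by simp
      have alg: "a * (d / 2 + y) + b * (d / 2 - y) = (a + b) / 2 * d + (a - b) * y" for a b d y :: real
        by (simp add: field_simps)
      show "u (2 * k) * ?D z (2 * k) + u (2 * k + 1) * ?D z (2 * k + 1) =
        v k * ?\<Delta> z k + c * (u (2 * k) - u (2 * k + 1)) * z (2 ^ n + k)"
        unfolding D[OF k] v_def alg by simp
    qed
    also have "\<dots> = (\<Sum>i<2 ^ n. w i * z i) + (\<Sum>k<2 ^ n. c * (u (2 * k) - u (2 * k + 1)) * z (2 ^ n + k))"
      by (simp only: sum.distrib w(1))
    also have "\<dots> = (\<Sum>i<2 ^ n + 2 ^ n. w' i * z i)"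
      unfolding sum_lessThan_split by (simp add: w'_def)
    finally show "(\<Sum>k<2 ^ Suc n. u k * ?D z k) = (\<Sum>i<2 ^ Suc n. w' i * z i)"
      by (simp only: power_Suc mult_2)
  next
    have "(\<Sum>i<2 ^ n + 2 ^ n. (w' i)\<^sup>2) = (\<Sum>k<2 ^ n. (v k)\<^sup>2) / 2 ^ n + (\<Sum>k<2 ^ n. c\<^sup>2 * (u (2 * k) - u (2 * k + 1))\<^sup>2)"
      unfolding sum_lessThan_split by (simp add: w'_def w(2) power_mult_distrib)
    also have "\<dots> = (\<Sum>k<2 ^ n. (v k)\<^sup>2 / 2 ^ n + c\<^sup>2 * (u (2 * k) - u (2 * k + 1))\<^sup>2)"
      by (simp add: sum.distrib sum_divide_distrib)
    also have "\<dots> = (\<Sum>k<2 ^ n. (u (2 * k))\<^sup>2 / 2 ^ Suc n + (u (2 * k + 1))\<^sup>2 / 2 ^ Suc n)"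
    proof (intro sum.cong refl)
      fix k
      have "((a + b) / 2)\<^sup>2 / N + 1 / N / 4 * (a - b)\<^sup>2 = a\<^sup>2 / (2 * N) + b\<^sup>2 / (2 * N)" if "N > 0" for a b N :: real
        using that by (simp add: field_simps power2_eq_square)
      then show "(v k)\<^sup>2 / 2 ^ n + c\<^sup>2 * (u (2 * k) - u (2 * k + 1))\<^sup>2 = (u (2 * k))\<^sup>2 / 2 ^ Suc n + (u (2 * k + 1))\<^sup>2 / 2 ^ Suc n"
        unfolding c2 v_def by simp
    qed
    also have "\<dots> = (\<Sum>k<2 ^ Suc n. (u k)\<^sup>2 / 2 ^ Suc n)"
      unfolding power_Suc[of 2 n] sum_lessThan_double ..
    finally show "(\<Sum>i<2 ^ Suc n. (w' i)\<^sup>2) = (\<Sum>k<2 ^ Suc n. (u k)\<^sup>2) / 2 ^ Suc n"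
      by (simp only: power_Suc[of 2 n] mult_2 sum_divide_distrib)
  qed
qed

text \<open>
  A bound for the contribution of level \<open>n\<close> to the series. Its mean under independent standard normal
  coefficients is summable because \<open>(9/10)\<^sup>3 > 1/2\<close>.
\<close>

definition levy_bound :: "nat \<Rightarrow> (nat \<Rightarrow> real) \<Rightarrow> real" where
  "levy_bound n z = (9/10) ^ n + (\<Sum>k<2 ^ n. (z (2 ^ n + k)) ^ 4) / (16 * 4 ^ n * ((9/10) ^ n) ^ 3)"

text \<open>
  At most one tent of a level is positive at a given time, so the fourth power of the contribution is
  at most the sum of the fourth powers of the scaled coefficients. The inequality \<open>y \<le> 1 + y\<^sup>4\<close>, applied
  to multiples of \<open>(9/10)\<^sup>n\<close>, replaces a fourth root by expressions with computable means.
\<close>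

lemma levy_step_bound: "\<bar>levy (Suc n) z t - levy n z t\<bar> \<le> levy_bound n z"
proof -
  define c :: real where "c = sqrt (1 / 2 ^ n) / 2"
  define S where "S = (\<Sum>k<2 ^ n. (z (2 ^ n + k)) ^ 4)"
  define \<theta> :: real where "\<theta> = (9/10) ^ n"
  have \<theta>: "\<theta> > 0" by (simp add: \<theta>_def)
  define a where "a = c * (\<Sum>k<2 ^ n. z (2 ^ n + k) * tent (2 ^ n * t - real k))"
  have c4: "c ^ 4 = 1 / (16 * 4 ^ n)"
  proof -
    have "c ^ 4 = (c\<^sup>2)\<^sup>2" by simp
    also have "c\<^sup>2 = 1 / 2 ^ n / 4" by (simp add: c_def power_divide)
    finally show ?thesis by (simp add: power_divide power2_eq_square flip: power_mult_distrib)
  qed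
  have S: "S \<ge> 0" unfolding S_def by (intro sum_nonneg) auto
  \<comment> \<open>Only the one tent that is positive at \<open>t\<close> contributes to the sum.\<close>
  have a4: "a ^ 4 \<le> c ^ 4 * S"
  proof (cases "\<exists>k<2 ^ n. tent (2 ^ n * t - real k) > 0")
    case True
    then obtain k where k: "k < 2 ^ n" "tent (2 ^ n * t - real k) > 0" by auto
    have "tent (2 ^ n * t - real j) = 0" if "j \<noteq> k" for j
    proof (rule ccontr)
      assume "\<not> ?thesis"
      then have "tent (2 ^ n * t - real j) > 0" using tent_nonneg[of "2 ^ n * t - real j"] by linarith
      then have "\<bar>real j - real k\<bar> < 1" using k(2) unfolding tent_pos_iff by linarith
      then show False using that by linarith
    qed
    then have "(\<Sum>j<2 ^ n. z (2 ^ n + j) * tent (2 ^ n * t - real j)) = (\<Sum>j<2 ^ n. if j = k then z (2 ^ n + j) * tent (2 ^ n * t - real j) else 0)"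
      by (intro sum.cong) auto
    also have "\<dots> = z (2 ^ n + k) * tent (2 ^ n * t - real k)" using k(1) by simp
    finally have "a ^ 4 = c ^ 4 * ((z (2 ^ n + k)) ^ 4 * (tent (2 ^ n * t - real k)) ^ 4)"
      by (simp add: a_def power_mult_distrib)
    also have "\<dots> \<le> c ^ 4 * (z (2 ^ n + k)) ^ 4"
      using tent_nonneg tent_le_one by (intro mult_left_mono mult_right_le_one_le power_le_one) auto
    also have "(z (2 ^ n + k)) ^ 4 \<le> S"
      unfolding S_def using k(1) by (intro member_le_sum) auto
    finally show ?thesis by (simp add: mult_left_mono)
  next
    case False
    then have "tent (2 ^ n * t - real k) = 0" if "k < 2 ^ n" for k
      using that tent_nonneg[of "2 ^ n * t - real k"] by force
    then have "a = 0" by (simp add: a_def)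
    then show ?thesis using S by simp
  qed
  have le: "y \<le> 1 + y ^ 4" if "y \<ge> 0" for y :: real
  proof (cases "y \<le> 1")
    case False
    then show ?thesis using self_le_power[of y 4] by simp
  qed (use that in \<open>simp add: add_increasing2\<close>)
  have "\<bar>a\<bar> / \<theta> \<le> 1 + (\<bar>a\<bar> / \<theta>) ^ 4" using \<theta> by (intro le) auto
  then have "\<bar>a\<bar> \<le> \<theta> * (1 + (\<bar>a\<bar> / \<theta>) ^ 4)" using \<theta> by (simp add: pos_divide_le_eq mult.commute)
  also have "\<dots> = \<theta> + a ^ 4 / \<theta> ^ 3" using \<theta> by (simp add: field_simps power4_eq_xxxx power3_eq_cube)
  also have "\<dots> \<le> \<theta> + c ^ 4 * S / \<theta> ^ 3" using a4 \<theta> by (intro add_left_mono divide_right_mono) auto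
  finally show ?thesis
    by (simp add: a_def c_def[symmetric] levy_bound_def c4 S_def \<theta>_def)
qed

lemma continuous_on_levy: "continuous_on A (levy n z)"
  unfolding tent_def by (induction n) (auto simp: tent_def intro!: continuous_intros)

text \<open>
  The value \<open>0\<close> outside the set of summability makes every path continuous.
\<close>

definition levy_lim :: "(nat \<Rightarrow> real) \<Rightarrow> real \<Rightarrow> real" where
  "levy_lim z t = (if summable (\<lambda>n. levy_bound n z) then lim (\<lambda>n. levy n z t) else 0)"

lemma uniform_limit_levy:
  assumes "summable (\<lambda>n. levy_bound n z)"
  shows "uniform_limit UNIV (\<lambda>n. levy n z) (levy_lim z) sequentially"
proof -
  have tele: "(\<Sum>i<n. levy (Suc i) z t - levy i z t) = levy n z t - levy 0 z t" for n t
    by (rule sum_lessThan_telescope)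
  have "uniform_limit UNIV (\<lambda>n t. \<Sum>i<n. levy (Suc i) z t - levy i z t)
     (\<lambda>t. \<Sum>i. levy (Suc i) z t - levy i z t) sequentially"
    by (rule Weierstrass_m_test[OF _ assms]) (use levy_step_bound in auto)
  then have "uniform_limit UNIV (\<lambda>n t. (\<Sum>i<n. levy (Suc i) z t - levy i z t) + levy 0 z t)
     (\<lambda>t. (\<Sum>i. levy (Suc i) z t - levy i z t) + levy 0 z t) sequentially"
    by (intro uniform_limit_add uniform_limit_const)
  then have u: "uniform_limit UNIV (\<lambda>n. levy n z)
     (\<lambda>t. (\<Sum>i. levy (Suc i) z t - levy i z t) + levy 0 z t) sequentially"
    by (simp only: tele diff_add_cancel)
  have "levy_lim z t = (\<Sum>i. levy (Suc i) z t - levy i z t) + levy 0 z t" for t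
    using limI[OF tendsto_uniform_limitI[OF u UNIV_I]] assms by (simp only: levy_lim_def if_True)
  then show ?thesis using u by presburger
qed

lemma levy_lim_tendsto:
  assumes "summable (\<lambda>n. levy_bound n z)"
  shows "(\<lambda>n. levy n z t) \<longlonglongrightarrow> levy_lim z t"
  using tendsto_uniform_limitI[OF uniform_limit_levy[OF assms]] by simp

lemma continuous_on_levy_lim: "continuous_on UNIV (levy_lim z)"
proof (cases "summable (\<lambda>n. levy_bound n z)")
  case True
  show ?thesis
    by (rule uniform_limit_theorem[OF _ uniform_limit_levy[OF True]]) (auto simp: continuous_on_levy)
next
  case False
  then show ?thesis by (simp add: levy_lim_def[abs_def])
qed

lemma levy_lim_dyadic:
  assumes "summable (\<lambda>n. levy_bound n z)"
  shows "levy_lim z (real k / 2 ^ n) = levy n z (real k / 2 ^ n)"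
proof (rule LIMSEQ_unique[OF levy_lim_tendsto[OF assms]])
  have "\<forall>\<^sub>F m in sequentially. levy m z (real k / 2 ^ n) = levy n z (real k / 2 ^ n)"
    using eventually_ge_at_top[of n] by eventually_elim (rule levy_dyadic_stable)
  then show "(\<lambda>m. levy m z (real k / 2 ^ n)) \<longlonglongrightarrow> levy n z (real k / 2 ^ n)" by (rule tendsto_eventually)
qed

lemma levy_lim_zero: "levy_lim z 0 = 0"
proof (cases "summable (\<lambda>n. levy_bound n z)")
  case True
  then show ?thesis using levy_lim_dyadic[OF True, of 0 0] by simp
qed (simp add: levy_lim_def)

section \<open>Brownian motion on a countably generated space\<close>

definition past :: "'w measure \<Rightarrow> (real \<Rightarrow> 'w \<Rightarrow> real) \<Rightarrow> real \<Rightarrow> 'w measure" where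
  "past M W s = sigma (space M) {W r -` C \<inter> space M | r C. r \<in> {0..s} \<and> C \<in> sets borel}"

lemma space_past[simp]: "space (past M W s) = space M"
  unfolding past_def by (rule space_measure_of) auto

lemma sets_past: "sets (past M W s) = sigma_sets (space M) {W r -` C \<inter> space M | r C. r \<in> {0..s} \<and> C \<in> sets borel}"
  unfolding past_def by (rule sets_measure_of) auto

lemma measurable_past: "0 \<le> r \<Longrightarrow> r \<le> s \<Longrightarrow> W r \<in> borel_measurable (past M W s)"
  by (rule measurableI) (auto simp: sets_past intro!: sigma_sets.Basic)

lemma sets_past_mono: "s \<le> t \<Longrightarrow> sets (past M W s) \<subseteq> sets (past M W t)"
  unfolding sets_past by (rule sigma_sets_mono') force

lemma subalgebra_past:
  assumes "\<And>r. W r \<in> borel_measurable M"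
  shows "subalgebra M (past M W s)"
  unfolding subalgebra_def sets_past
  using measurable_sets[OF assms] by (auto intro!: sets.sigma_sets_subset)

lemma complex_integral_indicator:
  assumes "A \<in> sets M"
  shows "(CLINT w|M. indicator A w) = complex_of_real (measure M A)"
proof -
  have "(CLINT w|M. indicator A w) = (CLINT w|M. complex_of_real (indicator A w))"
    by (intro Bochner_Integration.integral_cong) (auto simp: indicator_def)
  also have "\<dots> = complex_of_real (measure M A)"
    using assms by (subst integral_complex_of_real) simp
  finally show ?thesis .
qed

text \<open>
  The exponentials of the values of \<open>W\<close> at finitely many past times are replaced by indicators, one time
  after the other, by uniqueness of Fourier transforms. The resulting cylinder sets are stable under
  intersection and generate the past.
\<close>

lemma (in prob_space) past_orthogonal:
  fixes W :: "real \<Rightarrow> 'a \<Rightarrow> real" and D :: "'a \<Rightarrow> complex"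
  assumes W[measurable]: "\<And>r. W r \<in> borel_measurable M"
    and D: "integrable M D"
    and fd: "\<And>J v. finite J \<Longrightarrow> J \<subseteq> {0..s} \<Longrightarrow> (CLINT w|M. D w * iexp (\<Sum>r\<in>J. v r * W r w)) = 0"
    and A: "A \<in> sets (past M W s)"
  shows "(CLINT w|M. indicator A w * D w) = 0"
proof -
  have [measurable]: "D \<in> borel_measurable M" using D by auto
  define E where "E = {{w\<in>space M. \<forall>r\<in>J. W r w \<in> C r} | J C. finite J \<and> J \<subseteq> {0..s} \<and> (\<forall>r. C r \<in> sets borel)}"
  have cyl_sets: "{w\<in>space M. \<forall>r\<in>J. W r w \<in> C r} \<in> sets M" if "finite J" "\<And>r. C r \<in> sets borel" for J C
    using that by measurable
  have cyl: "(CLINT w|M. D w * indicator {w\<in>space M. \<forall>r\<in>J. W r w \<in> C r} w) = 0"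
    if S: "finite J" "J \<subseteq> {0..s}" and C: "\<And>r. C r \<in> sets borel" for J C
  proof -
    have claim: "(CLINT w|M. D w * indicator {w\<in>space M. \<forall>r\<in>J'. W r w \<in> C r} w * iexp (\<Sum>r\<in>J. v r * W r w)) = 0"
      if "finite J'" "J' \<subseteq> J" for J' v
      using that
    proof (induction J' arbitrary: v rule: finite_induct)
      case empty
      have "(CLINT w|M. D w * indicator {w\<in>space M. \<forall>r\<in>{}. W r w \<in> C r} w * iexp (\<Sum>r\<in>J. v r * W r w))
        = (CLINT w|M. D w * iexp (\<Sum>r\<in>J. v r * W r w))"
        by (intro Bochner_Integration.integral_cong) auto
      then show ?case using fd[OF S] by simp
    next
      case (insert r J')
      let ?I = "\<lambda>w. indicator {w\<in>space M. \<forall>r\<in>J'. W r w \<in> C r} w :: complex"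
      let ?H = "\<lambda>w. D w * ?I w * iexp (\<Sum>r\<in>J. v r * W r w)"
      have m: "{w\<in>space M. \<forall>r\<in>J'. W r w \<in> C r} \<in> sets M"
        using insert(1) C by (rule cyl_sets)
      have H: "integrable M ?H"
        using m by (intro Bochner_Integration.integrable_bound[OF D]) (auto simp: norm_mult split: split_indicator)
      have "(CLINT w|M. ?H w * iexp (y * W r w)) = 0" for y
      proof -
        have "(\<Sum>q\<in>J. (v(r := v r + y)) q * W q w) = (\<Sum>q\<in>J. v q * W q w) + y * W r w" for w
        proof -
          have "r \<in> J" using insert by auto
          have "(\<Sum>q\<in>J. (v(r := v r + y)) q * W q w) = (\<Sum>q\<in>J. v q * W q w + (if q = r then y * W r w else 0))"
            by (intro sum.cong) (auto simp: distrib_right)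
          also have "\<dots> = (\<Sum>q\<in>J. v q * W q w) + y * W r w"
            using S(1) \<open>r \<in> J\<close> by (simp add: sum.distrib)
          finally show ?thesis .
        qed
        then have "(CLINT w|M. ?H w * iexp (y * W r w)) = (CLINT w|M. D w * ?I w * iexp (\<Sum>q\<in>J. (v(r := v r + y)) q * W q w))"
          by (intro Bochner_Integration.integral_cong refl) (simp only: of_real_add distrib_left exp_add mult.assoc)
        also have "\<dots> = 0" using insert by auto
        finally show ?thesis .
      qed
      then have "(CLINT w|M. ?H w * indicator (C r) (W r w)) = 0"
        by (intro fourier_zero_imp_zero[OF finite_measure_axioms H W _ C])
      moreover have "(CLINT w|M. D w * indicator {w\<in>space M. \<forall>r\<in>insert r J'. W r w \<in> C r} w * iexp (\<Sum>r\<in>J. v r * W r w))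
        = (CLINT w|M. ?H w * indicator (C r) (W r w))"
        by (intro Bochner_Integration.integral_cong) (auto simp: indicator_def)
      ultimately show ?case by simp
    qed
    show ?thesis using claim[OF S(1) order_refl, of "\<lambda>_. 0"] by simp
  qed
  have "Int_stable E"
  proof (rule Int_stableI)
    fix a b assume "a \<in> E" "b \<in> E"
    then obtain J C J' C' where a: "a = {w\<in>space M. \<forall>r\<in>J. W r w \<in> C r}" "finite J" "J \<subseteq> {0..s}" "\<forall>r. C r \<in> sets borel"
      and b: "b = {w\<in>space M. \<forall>r\<in>J'. W r w \<in> C' r}" "finite J'" "J' \<subseteq> {0..s}" "\<forall>r. C' r \<in> sets borel"
      unfolding E_def by blast
    have "a \<inter> b = {w\<in>space M. \<forall>r\<in>J \<union> J'. W r w \<in> (if r \<in> J then C r else UNIV) \<inter> (if r \<in> J' then C' r else UNIV)}"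
      unfolding a b by auto
    then show "a \<inter> b \<in> E"
      unfolding E_def using a b
      by (intro CollectI exI[of _ "J \<union> J'"] exI[of _ "\<lambda>r. (if r \<in> J then C r else UNIV) \<inter> (if r \<in> J' then C' r else UNIV)"]) auto
  qed
  moreover have "E \<subseteq> Pow (space M)" unfolding E_def by auto
  moreover have "A \<in> sigma_sets (space M) E"
  proof -
    have "{W r -` C \<inter> space M | r C. r \<in> {0..s} \<and> C \<in> sets borel} \<subseteq> E"
    proof safe
      fix r C assume "r \<in> {0..s}" "C \<in> sets (borel :: real measure)"
      then show "W r -` C \<inter> space M \<in> E"
        unfolding E_def by (intro CollectI exI[of _ "{r}"] exI[of _ "\<lambda>_. C"]) auto
    qed
    then show ?thesis using A sigma_sets_mono' unfolding sets_past by blast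
  qed
  ultimately have "A \<in> sets M \<and> (CLINT w:A|M. D w) = 0"
  proof (induction rule: sigma_sets_induct_disjoint)
    case (basic A)
    then obtain J C where a: "A = {w\<in>space M. \<forall>r\<in>J. W r w \<in> C r}" "finite J" "J \<subseteq> {0..s}" "\<And>r. C r \<in> sets borel"
      unfolding E_def by blast
    have "(CLINT w:A|M. D w) = (CLINT w|M. D w * indicator A w)"
      unfolding set_lebesgue_integral_def by (intro Bochner_Integration.integral_cong) (auto simp: indicator_def)
    then show ?case using cyl[OF a(2,3,4)] cyl_sets[OF a(2,4)] unfolding a(1) by simp
  next
    case empty
    then show ?case by (simp add: set_lebesgue_integral_def)
  next
    case (compl A)
    have "(CLINT w|M. D w * iexp (\<Sum>r\<in>{}. 0 * W r w)) = 0" by (rule fd) auto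
    then have "0 = (CLINT w:A \<union> (space M - A)|M. D w)"
      using compl sets.sets_into_space[of A M] by (simp add: Un_absorb1 set_integral_space[OF D])
    also have "\<dots> = (CLINT w:A|M. D w) + (CLINT w:space M - A|M. D w)"
      using compl D by (intro set_integral_Un) (auto simp: set_integrable_def intro!: integrable_mult_indicator)
    finally show ?case using compl by auto
  next
    case (union A)
    have "(CLINT w:(\<Union>i. A i)|M. D w) = (\<Sum>i. (CLINT w:(A i)|M. D w))"
      using union D by (intro lebesgue_integral_countable_add)
        (auto simp: set_integrable_def disjoint_family_on_def intro!: integrable_mult_indicator)
    then show ?case using union by auto
  qed
  moreover have "(CLINT w:A|M. D w) = (CLINT w|M. indicator A w * D w)"
    unfolding set_lebesgue_integral_def by (intro Bochner_Integration.integral_cong) (auto simp: indicator_def)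
  ultimately show ?thesis by simp
qed

text \<open>
  Brownian motion on \<open>[0, T]\<close> with all paths continuous. The last assumption encodes both the normal law
  of the increments and their independence of the past.
\<close>

locale wiener = prob_space P for P :: "'w measure" +
  fixes W :: "real \<Rightarrow> 'w \<Rightarrow> real" and T :: real
  assumes T_pos: "T > 0"
    and W_measurable[measurable]: "\<And>t. W t \<in> borel_measurable P"
    and W_continuous: "\<And>w. w \<in> space P \<Longrightarrow> continuous_on UNIV (\<lambda>t. W t w)"
    and W_zero: "\<And>w. w \<in> space P \<Longrightarrow> W 0 w = 0"
    and W_increment: "\<And>s t u A. 0 \<le> s \<Longrightarrow> s \<le> t \<Longrightarrow> t \<le> T \<Longrightarrow> A \<in> sets (past P W s) \<Longrightarrow>
      (CLINT w|P. indicator A w * iexp (u * (W t w - W s w))) = prob A * exp (- (u\<^sup>2 * (t - s)) / 2)"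

locale gaussian_sequence = prob_space M for M :: "'a measure" +
  fixes z :: "nat \<Rightarrow> 'a \<Rightarrow> real"
  assumes z_indep: "indep_vars (\<lambda>_. borel) z UNIV"
    and z_normal: "\<And>i. distributed M lborel (z i) std_normal_density"
begin

abbreviation Z :: "'a \<Rightarrow> nat \<Rightarrow> real" where "Z w \<equiv> (\<lambda>i. z i w)"

definition V :: "real \<Rightarrow> 'a \<Rightarrow> real" where "V t w = levy_lim (Z w) t"

lemma z_measurable[measurable]: "z i \<in> borel_measurable M"
  using z_normal[of i] by (simp add: distributed_def)

lemma levy_measurable[measurable]: "(\<lambda>w. levy n (Z w) t) \<in> borel_measurable M"
  by (induction n) simp_all

lemma levy_bound_measurable[measurable]: "(\<lambda>w. levy_bound n (Z w)) \<in> borel_measurable M"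
  unfolding levy_bound_def by measurable

lemma V_measurable[measurable]: "V t \<in> borel_measurable M"
proof -
  have "{w\<in>space M. summable (\<lambda>n. levy_bound n (Z w))} = {w\<in>space M. Cauchy (\<lambda>n. \<Sum>i<n. levy_bound i (Z w))}"
    by (simp add: summable_iff_convergent Cauchy_convergent_iff)
  also have "\<dots> \<in> sets M" by measurable
  finally have [measurable]: "Measurable.pred M (\<lambda>w. summable (\<lambda>n. levy_bound n (Z w)))" by (simp add: pred_def)
  show ?thesis unfolding V_def[abs_def] levy_lim_def by measurable
qed

lemma z_fourth_moment: "(\<integral>\<^sup>+w. ennreal ((z i w) ^ 4) \<partial>M) = ennreal 3"
proof -
  have "(\<integral>\<^sup>+w. ennreal ((z i w) ^ 4) \<partial>M) = (\<integral>\<^sup>+x. ennreal (std_normal_density x) * ennreal (x ^ 4) \<partial>lborel)"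
    by (rule distributed_nn_integral[OF z_normal, symmetric]) simp
  also have "\<dots> = (\<integral>\<^sup>+x. ennreal (std_normal_density x * x ^ 4) \<partial>lborel)"
    by (intro nn_integral_cong) (simp add: ennreal_mult)
  also have "\<dots> = ennreal (LINT x|lborel. std_normal_density x * x ^ 4)"
    using integrable_std_normal_moment[of 4] by (intro nn_integral_eq_integral) auto
  also have "(LINT x|lborel. std_normal_density x * x ^ 4) = 3"
    using integral_std_normal_moment_even[of 2] by (simp add: fact_numeral)
  finally show ?thesis .
qed

lemma AE_levy_bound_summable: "AE w in M. summable (\<lambda>n. levy_bound n (Z w))"
proof -
  define f where "f n w = (\<Sum>k<2 ^ n. (z (2 ^ n + k) w) ^ 4) / (16 * 4 ^ n * ((9/10) ^ n) ^ 3)" for n w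
  have [measurable]: "f n \<in> borel_measurable M" for n unfolding f_def by measurable
  have f_nn: "f n w \<ge> 0" for n w unfolding f_def by (intro divide_nonneg_nonneg sum_nonneg) auto
  have "(\<integral>\<^sup>+w. ennreal (f n w) \<partial>M) = ennreal (3/16 * (500/729) ^ n)" for n
  proof -
    have "(\<integral>\<^sup>+w. ennreal (f n w) \<partial>M) = (\<integral>\<^sup>+w. (\<Sum>k<2 ^ n. ennreal ((z (2 ^ n + k) w) ^ 4)) * ennreal (1 / (16 * 4 ^ n * ((9/10) ^ n) ^ 3)) \<partial>M)"
      unfolding f_def by (intro nn_integral_cong) (simp add: ennreal_mult[symmetric] sum_nonneg)
    also have "\<dots> = (\<integral>\<^sup>+w. (\<Sum>k<2 ^ n. ennreal ((z (2 ^ n + k) w) ^ 4)) \<partial>M) * ennreal (1 / (16 * 4 ^ n * ((9/10) ^ n) ^ 3))"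
      by (intro nn_integral_multc) measurable
    also have "(\<integral>\<^sup>+w. (\<Sum>k<2 ^ n. ennreal ((z (2 ^ n + k) w) ^ 4)) \<partial>M) = (\<Sum>k<(2::nat) ^ n. ennreal 3)"
      by (subst nn_integral_sum) (measurable, simp only: z_fourth_moment)
    also have "\<dots> * ennreal (1 / (16 * 4 ^ n * ((9/10) ^ n) ^ 3)) = ennreal (2 ^ n * 3 * (1 / (16 * 4 ^ n * ((9/10) ^ n) ^ 3)))"
      by (subst sum_ennreal) (auto simp: ennreal_mult[symmetric])
    also have "2 ^ n * 3 * (1 / (16 * 4 ^ n * ((9/10) ^ n) ^ 3)) = 3/16 * ((500/729) ^ n :: real)"
    proof -
      have "(4::real) ^ n = 2 ^ n * 2 ^ n" by (simp flip: power_mult_distrib)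
      moreover have "((9/10) ^ n) ^ 3 = ((729/1000) :: real) ^ n"
        by (simp add: power_divide flip: power_mult power_mult[of _ 3] add: mult.commute[of n])
           (simp add: power_mult)
      moreover have "(500/729::real) ^ n = 1 / (2 ^ n * (729/1000) ^ n)"
      proof -
        have "(2::real) ^ n * (729/1000) ^ n = (729/500) ^ n" by (simp flip: power_mult_distrib)
        then show ?thesis by (simp add: power_divide)
      qed
      ultimately show ?thesis by simp
    qed
    finally show ?thesis .
  qed
  then have "(\<integral>\<^sup>+w. (\<Sum>n. ennreal (f n w)) \<partial>M) = (\<Sum>n. ennreal (3/16 * (500/729) ^ n))"
    by (subst nn_integral_suminf) auto
  also have "\<dots> < \<infinity>"
    by (subst suminf_ennreal2) (auto intro!: summable_mult summable_geometric)
  finally have "AE w in M. (\<Sum>n. ennreal (f n w)) \<noteq> \<infinity>"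
    by (intro nn_integral_noteq_infinite) auto
  then show ?thesis
  proof (rule AE_mp, intro AE_I2 impI)
    fix w assume "(\<Sum>n. ennreal (f n w)) \<noteq> \<infinity>"
    then have "summable (\<lambda>n. f n w)"
      by (intro summable_suminf_not_top) (auto simp: f_nn)
    then have "summable (\<lambda>n. (9/10) ^ n + f n w)"
      by (intro summable_add summable_geometric) auto
    then show "summable (\<lambda>n. levy_bound n (Z w))" by (simp add: levy_bound_def f_def)
  qed
qed

lemma char_linear_combination:
  "(CLINT w|M. iexp (\<Sum>i<N. a i * z i w)) = exp (- (\<Sum>i<N. (a i)\<^sup>2) / 2)"
proof -
  have "indep_vars (\<lambda>_. borel) z {..<N}" using z_indep by (rule indep_vars_subset) auto
  then have ind: "indep_vars (\<lambda>_. borel) (\<lambda>i w. a i * z i w) {..<N}"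
    by (rule indep_vars_compose2[where X=z and Y="\<lambda>i x. a i * x"]) auto
  have one: "char (distr M borel (\<lambda>w. a i * z i w)) 1 = complex_of_real (exp (- (a i)\<^sup>2 / 2))" for i
  proof -
    have "char (distr M borel (\<lambda>w. a i * z i w)) 1 = (CLINT w|M. iexp (a i * z i w))"
      unfolding char_def by (subst integral_distr) auto
    also have "\<dots> = (CLINT x|distr M lborel (z i). iexp (a i * x))"
      by (subst integral_distr) auto
    also have "\<dots> = char std_normal_distribution (a i)"
      using z_normal[of i] by (simp add: distributed_def char_def)
    finally show ?thesis by (simp add: char_std_normal_distribution)
  qed
  have "(CLINT w|M. iexp (\<Sum>i<N. a i * z i w)) = char (distr M borel (\<lambda>w. \<Sum>i<N. a i * z i w)) 1"
    unfolding char_def by (subst integral_distr) auto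
  also have "\<dots> = (\<Prod>i<N. complex_of_real (exp (- (a i)\<^sup>2 / 2)))"
    unfolding char_distr_sum[OF ind] one ..
  also have "\<dots> = complex_of_real (exp (\<Sum>i<N. - (a i)\<^sup>2 / 2))"
    by (simp only: exp_sum[OF finite_lessThan] of_real_prod)
  also have "(\<Sum>i<N. - (a i)\<^sup>2 / 2) = - (\<Sum>i<N. (a i)\<^sup>2) / 2"
    by (simp add: sum_negf sum_divide_distrib)
  finally show ?thesis .
qed

lemma char_dyadic_increments:
  "(CLINT w|M. iexp (\<Sum>k<2 ^ n. c k * (V ((real k + 1) / 2 ^ n) w - V (real k / 2 ^ n) w)))
    = exp (- ((\<Sum>k<2 ^ n. (c k)\<^sup>2) / 2 ^ n) / 2)"
proof -
  obtain a where a: "\<And>z. (\<Sum>k<2 ^ n. c k * (levy n z ((real k + 1) / 2 ^ n) - levy n z (real k / 2 ^ n))) = (\<Sum>i<2 ^ n. a i * z i)"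
    "(\<Sum>i<2 ^ n. (a i)\<^sup>2) = (\<Sum>k<2 ^ n. (c k)\<^sup>2) / 2 ^ n"
    using levy_increments_isometry[of c n] by auto
  have "(CLINT w|M. iexp (\<Sum>k<2 ^ n. c k * (V ((real k + 1) / 2 ^ n) w - V (real k / 2 ^ n) w)))
     = (CLINT w|M. iexp (\<Sum>i<2 ^ n. a i * z i w))"
  proof (rule integral_cong_AE)
    show "AE w in M. iexp (\<Sum>k<2 ^ n. c k * (V ((real k + 1) / 2 ^ n) w - V (real k / 2 ^ n) w)) = iexp (\<Sum>i<2 ^ n. a i * z i w)"
      using AE_levy_bound_summable
    proof eventually_elim
      case (elim w)
      have "V ((real k + 1) / 2 ^ n) w = levy n (Z w) ((real k + 1) / 2 ^ n)" for k
        using levy_lim_dyadic[OF elim, of "Suc k" n] by (simp add: V_def add.commute)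
      moreover have "V (real k / 2 ^ n) w = levy n (Z w) (real k / 2 ^ n)" for k
        using levy_lim_dyadic[OF elim, of k n] by (simp add: V_def)
      ultimately show ?case using a(1)[of "Z w"] by (simp only:)
    qed
  qed auto
  then show ?thesis by (simp only: char_linear_combination a(2))
qed

lemma V_zero: "V 0 w = 0" by (simp add: V_def levy_lim_zero)

lemma V_continuous: "continuous_on UNIV (\<lambda>t. V t w)"
  unfolding V_def using continuous_on_levy_lim by simp

text \<open>
  Expressed by increments of level \<open>n\<close>, the past values involve only those before \<open>K\<close> and the increment
  only those from \<open>K\<close> to \<open>L\<close>. The coefficient sequences are orthogonal, so the exponents add.
\<close>

lemma char_dyadic_past:
  fixes k :: "'j \<Rightarrow> nat"
  assumes J: "finite J" "\<And>j. j \<in> J \<Longrightarrow> k j \<le> K" and K: "K \<le> L" "L \<le> 2 ^ n"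
  shows "(CLINT w|M. iexp (\<Sum>j\<in>J. v j * V (real (k j) / 2 ^ n) w) * iexp (u * (V (real L / 2 ^ n) w - V (real K / 2 ^ n) w)))
    = (CLINT w|M. iexp (\<Sum>j\<in>J. v j * V (real (k j) / 2 ^ n) w)) * exp (- (u\<^sup>2 * (real L / 2 ^ n - real K / 2 ^ n)) / 2)"
proof -
  let ?\<Delta> = "\<lambda>w l. V ((real l + 1) / 2 ^ n) w - V (real l / 2 ^ n) w"
  have tele: "V (real m / 2 ^ n) w = (\<Sum>l<2 ^ n. (if l < m then 1 else 0) * ?\<Delta> w l)" if "m \<le> 2 ^ n" for m w
  proof -
    have "V (real m / 2 ^ n) w = (\<Sum>l<m. V (real (Suc l) / 2 ^ n) w - V (real l / 2 ^ n) w)"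
      using sum_lessThan_telescope[of "\<lambda>l. V (real l / 2 ^ n) w" m] by (simp add: V_zero)
    also have "\<dots> = (\<Sum>l<m. ?\<Delta> w l)" by (simp add: add.commute)
    also have "\<dots> = (\<Sum>l<2 ^ n. if l \<in> {..<m} then ?\<Delta> w l else 0)"
      using that by (subst sum.inter_restrict[symmetric]) (auto intro!: sum.cong)
    finally show ?thesis by (simp add: if_distrib[of "\<lambda>x. x * _"] cong: if_cong)
  qed
  define a where "a l = (\<Sum>j\<in>J. if l < k j then v j else 0)" for l
  define d where "d l = u * ((if l < L then 1 else 0) - (if l < K then 1 else 0))" for l :: nat
  have a: "(\<Sum>j\<in>J. v j * V (real (k j) / 2 ^ n) w) = (\<Sum>l<2 ^ n. a l * ?\<Delta> w l)" for w
  proof -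
    have "(\<Sum>j\<in>J. v j * V (real (k j) / 2 ^ n) w) = (\<Sum>j\<in>J. \<Sum>l<2 ^ n. (if l < k j then v j else 0) * ?\<Delta> w l)"
    proof (intro sum.cong refl)
      fix j assume "j \<in> J"
      then have "k j \<le> 2 ^ n" using J(2) K by (meson order_trans)
      show "v j * V (real (k j) / 2 ^ n) w = (\<Sum>l<2 ^ n. (if l < k j then v j else 0) * ?\<Delta> w l)"
        unfolding tele[OF \<open>k j \<le> 2 ^ n\<close>] sum_distrib_left by (intro sum.cong) auto
    qed
    also have "\<dots> = (\<Sum>l<2 ^ n. a l * ?\<Delta> w l)"
      unfolding a_def sum_distrib_right by (rule sum.swap)
    finally show ?thesis .
  qed
  have d: "u * (V (real L / 2 ^ n) w - V (real K / 2 ^ n) w) = (\<Sum>l<2 ^ n. d l * ?\<Delta> w l)" for w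
    unfolding tele[OF K(2)] tele[OF order_trans[OF K]] sum_subtractf[symmetric] sum_distrib_left d_def
    by (intro sum.cong refl) (simp only: left_diff_distrib mult.assoc right_diff_distrib)
  have ad: "a l * d l = 0" for l
  proof (cases "l < K")
    case False
    then have "a l = 0" using J(2) by (auto simp: a_def intro!: sum.neutral) (meson not_less order_trans)
    then show ?thesis by simp
  qed (use K in \<open>auto simp: d_def\<close>)
  have "(\<Sum>l<2 ^ n. (d l)\<^sup>2) = (\<Sum>l<2 ^ n. if l \<in> {K..<L} then u\<^sup>2 else 0)"
    by (intro sum.cong refl) (use K in \<open>auto simp: d_def\<close>)
  also have "\<dots> = u\<^sup>2 * (real L - real K)"
    using K by (subst sum.inter_restrict[symmetric]) (auto simp: Int_absorb1 subset_eq of_nat_diff)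
  finally have d2: "(\<Sum>l<2 ^ n. (d l)\<^sup>2) = u\<^sup>2 * (real L - real K)" .
  have "(\<Sum>l<2 ^ n. (a l + d l)\<^sup>2) = (\<Sum>l<2 ^ n. (a l)\<^sup>2 + (d l)\<^sup>2)"
    by (intro sum.cong refl) (simp add: power2_sum ad mult.assoc)
  then have s2: "(\<Sum>l<2 ^ n. (a l + d l)\<^sup>2) = (\<Sum>l<2 ^ n. (a l)\<^sup>2) + u\<^sup>2 * (real L - real K)"
    by (simp add: sum.distrib d2)
  have "(CLINT w|M. iexp (\<Sum>j\<in>J. v j * V (real (k j) / 2 ^ n) w) * iexp (u * (V (real L / 2 ^ n) w - V (real K / 2 ^ n) w)))
    = (CLINT w|M. iexp (\<Sum>l<2 ^ n. (a l + d l) * ?\<Delta> w l))"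
    unfolding a d by (intro Bochner_Integration.integral_cong refl)
      (simp only: distrib_right sum.distrib of_real_add distrib_left exp_add)
  also have "\<dots> = exp (- (((\<Sum>l<2 ^ n. (a l)\<^sup>2) + u\<^sup>2 * (real L - real K)) / 2 ^ n) / 2)"
    unfolding char_dyadic_increments s2 ..
  also have "\<dots> = exp (- ((\<Sum>l<2 ^ n. (a l)\<^sup>2) / 2 ^ n) / 2) * exp (- (u\<^sup>2 * (real L / 2 ^ n - real K / 2 ^ n)) / 2)"
    unfolding exp_add[symmetric] by (rule arg_cong[where f="\<lambda>x. complex_of_real (exp x)"]) (simp add: field_simps)
  also have "\<dots> = (CLINT w|M. iexp (\<Sum>j\<in>J. v j * V (real (k j) / 2 ^ n) w)) * exp (- (u\<^sup>2 * (real L / 2 ^ n - real K / 2 ^ n)) / 2)"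
    unfolding a char_dyadic_increments by simp
  finally show ?thesis by simp
qed

lemma dyadic_floor_tendsto:
  assumes "r \<ge> 0"
  shows "(\<lambda>n. real (nat \<lfloor>r * 2 ^ n\<rfloor>) / 2 ^ n) \<longlonglongrightarrow> r"
proof (rule real_tendsto_sandwich)
  have e: "real (nat \<lfloor>r * 2 ^ n\<rfloor>) = of_int \<lfloor>r * 2 ^ n\<rfloor>" for n using assms by simp
  show "\<forall>\<^sub>F n in sequentially. r - (1/2) ^ n \<le> real (nat \<lfloor>r * 2 ^ n\<rfloor>) / 2 ^ n"
  proof (rule always_eventually, rule allI)
    fix n :: nat
    have "r * 2 ^ n - 1 \<le> of_int \<lfloor>r * 2 ^ n\<rfloor>" by linarith
    then have "(r * 2 ^ n - 1) / 2 ^ n \<le> of_int \<lfloor>r * 2 ^ n\<rfloor> / 2 ^ n" by (rule divide_right_mono) simp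
    then show "r - (1/2) ^ n \<le> real (nat \<lfloor>r * 2 ^ n\<rfloor>) / 2 ^ n"
      unfolding e by (simp add: diff_divide_distrib power_divide)
  qed
  show "\<forall>\<^sub>F n in sequentially. real (nat \<lfloor>r * 2 ^ n\<rfloor>) / 2 ^ n \<le> r"
  proof (rule always_eventually, rule allI)
    fix n :: nat
    have "of_int \<lfloor>r * 2 ^ n\<rfloor> \<le> r * 2 ^ n" by linarith
    then show "real (nat \<lfloor>r * 2 ^ n\<rfloor>) / 2 ^ n \<le> r" unfolding e by (simp add: pos_divide_le_eq)
  qed
  have "(\<lambda>n. r - (1/2) ^ n) \<longlonglongrightarrow> r - 0" by (intro tendsto_intros) auto
  then show "(\<lambda>n. r - (1/2) ^ n) \<longlonglongrightarrow> r" by simp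
qed simp

text \<open>
  Approximation of all times from below by dyadic ones, using path continuity.
\<close>

lemma char_past:
  assumes J: "finite J" "J \<subseteq> {0..s}" and s: "0 \<le> s" "s \<le> t" "t \<le> 1"
  shows "(CLINT w|M. iexp (\<Sum>r\<in>J. v r * V r w) * iexp (u * (V t w - V s w)))
    = (CLINT w|M. iexp (\<Sum>r\<in>J. v r * V r w)) * exp (- (u\<^sup>2 * (t - s)) / 2)"
proof -
  define k where "k n r = nat \<lfloor>r * 2 ^ n\<rfloor>" for n and r :: real
  define q where "q n r = real (k n r) / 2 ^ n" for n r
  have q: "(\<lambda>n. q n r) \<longlonglongrightarrow> r" if "r \<ge> 0" for r
    unfolding q_def k_def by (rule dyadic_floor_tendsto[OF that])
  have Vq: "(\<lambda>n. V (q n r) w) \<longlonglongrightarrow> V r w" if "r \<ge> 0" for r w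
    using V_continuous[of w] q[OF that] isCont_tendsto_compose[of r "\<lambda>t. V t w"]
    by (auto simp: continuous_on_eq_continuous_at)
  have k_mono: "k n r \<le> k n r'" if "r \<le> r'" for n r r'
    unfolding k_def using that by (intro nat_mono floor_mono) simp
  have k1: "k n 1 = 2 ^ n" for n
  proof -
    have "\<lfloor>(1::real) * 2 ^ n\<rfloor> = 2 ^ n" by (metis floor_of_int mult_1 of_int_numeral of_int_power)
    then show ?thesis unfolding k_def by (simp add: nat_power_eq)
  qed
  have eq: "(CLINT w|M. iexp (\<Sum>r\<in>J. v r * V (q n r) w) * iexp (u * (V (q n t) w - V (q n s) w)))
    = (CLINT w|M. iexp (\<Sum>r\<in>J. v r * V (q n r) w)) * exp (- (u\<^sup>2 * (q n t - q n s)) / 2)" for n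
    unfolding q_def
  proof (rule char_dyadic_past)
    show "k n j \<le> k n s" if "j \<in> J" for j using J that by (intro k_mono) auto
    show "k n s \<le> k n t" using s by (intro k_mono) auto
    show "k n t \<le> 2 ^ n" using k_mono[of t 1 n] s k1 by simp
  qed (rule J)
  have lim1: "(\<lambda>n. iexp (\<Sum>r\<in>J. v r * V (q n r) w)) \<longlonglongrightarrow> iexp (\<Sum>r\<in>J. v r * V r w)" for w
    using J(2) by (intro tendsto_exp tendsto_mult tendsto_of_real tendsto_sum tendsto_const Vq) auto
  have lim2: "(\<lambda>n. iexp (u * (V (q n t) w - V (q n s) w))) \<longlonglongrightarrow> iexp (u * (V t w - V s w))" for w
    using s by (intro tendsto_exp tendsto_mult tendsto_of_real tendsto_diff tendsto_const Vq) auto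
  have "(\<lambda>n. CLINT w|M. iexp (\<Sum>r\<in>J. v r * V (q n r) w) * iexp (u * (V (q n t) w - V (q n s) w)))
     \<longlonglongrightarrow> (CLINT w|M. iexp (\<Sum>r\<in>J. v r * V r w) * iexp (u * (V t w - V s w)))"
  proof (rule integral_dominated_convergence[where w="\<lambda>_. 1"])
    show "AE w in M. (\<lambda>n. iexp (\<Sum>r\<in>J. v r * V (q n r) w) * iexp (u * (V (q n t) w - V (q n s) w)))
        \<longlonglongrightarrow> iexp (\<Sum>r\<in>J. v r * V r w) * iexp (u * (V t w - V s w))"
      by (intro AE_I2 tendsto_mult[OF lim1 lim2])
  qed (auto simp: norm_mult)
  moreover have "(\<lambda>n. (CLINT w|M. iexp (\<Sum>r\<in>J. v r * V (q n r) w)) * complex_of_real (exp (- (u\<^sup>2 * (q n t - q n s)) / 2)))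
     \<longlonglongrightarrow> (CLINT w|M. iexp (\<Sum>r\<in>J. v r * V r w)) * complex_of_real (exp (- (u\<^sup>2 * (t - s)) / 2))"
  proof (rule tendsto_mult)
    show "(\<lambda>n. CLINT w|M. iexp (\<Sum>r\<in>J. v r * V (q n r) w)) \<longlonglongrightarrow> (CLINT w|M. iexp (\<Sum>r\<in>J. v r * V r w))"
    proof (rule integral_dominated_convergence[where w="\<lambda>_. 1"])
      show "AE w in M. (\<lambda>n. iexp (\<Sum>r\<in>J. v r * V (q n r) w)) \<longlonglongrightarrow> iexp (\<Sum>r\<in>J. v r * V r w)"
        by (intro AE_I2 lim1)
    qed auto
    show "(\<lambda>n. complex_of_real (exp (- (u\<^sup>2 * (q n t - q n s)) / 2))) \<longlonglongrightarrow> complex_of_real (exp (- (u\<^sup>2 * (t - s)) / 2))"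
      using s by (intro tendsto_intros q) auto
  qed
  ultimately show ?thesis unfolding eq by (rule LIMSEQ_unique)
qed

lemma wiener_V:
  assumes T: "T > 0"
  shows "wiener M (\<lambda>t w. sqrt T * V (t / T) w) T"
proof
  show "T > 0" by fact
  show "(\<lambda>w. sqrt T * V (t / T) w) \<in> borel_measurable M" for t by measurable
  show "continuous_on UNIV (\<lambda>t. sqrt T * V (t / T) w)" for w
    by (intro continuous_intros continuous_on_compose2[OF V_continuous]) (use T in auto)
  show "sqrt T * V (0 / T) w = 0" for w by (simp add: V_zero)
  let ?W = "\<lambda>t w. sqrt T * V (t / T) w"
  fix s t u A assume st: "0 \<le> s" "s \<le> t" "t \<le> T" and A: "A \<in> sets (past M ?W s)"
  define \<kappa> where "\<kappa> = complex_of_real (exp (- (u\<^sup>2 * (t - s)) / 2))"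
  define D where "D w = iexp (u * (?W t w - ?W s w)) - \<kappa>" for w
  have i1: "integrable M (\<lambda>w. iexp (u * (?W t w - ?W s w)))"
    by (rule integrable_const_bound[of _ 1]) auto
  have AM: "A \<in> sets M" using A subalgebra_past[of ?W M s] by (auto simp: subalgebra_def)
  have "(CLINT w|M. indicator A w * D w) = 0"
  proof (rule past_orthogonal[OF _ _ _ A])
    show "integrable M D" unfolding D_def using i1 by auto
    fix J v assume J: "finite J" "J \<subseteq> {0..s}"
    define J' where "J' = (\<lambda>r. r / T) ` J"
    have J': "finite J'" "J' \<subseteq> {0..s / T}" using J T by (auto simp: J'_def divide_right_mono)
    have e: "(\<Sum>r\<in>J. v r * ?W r w) = (\<Sum>q\<in>J'. (v (q * T) * sqrt T) * V q w)" for w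
      unfolding J'_def using T by (subst sum.reindex) (auto simp: inj_on_def mult.assoc)
    have d: "u * (?W t w - ?W s w) = (u * sqrt T) * (V (t / T) w - V (s / T) w)" for w
      by (simp add: algebra_simps)
    have k: "\<kappa> = complex_of_real (exp (- ((u * sqrt T)\<^sup>2 * (t / T - s / T)) / 2))"
      using T by (simp add: \<kappa>_def power_mult_distrib field_simps)
    have i2: "complex_integrable M (\<lambda>w. iexp (u * (?W t w - ?W s w)) * iexp (\<Sum>r\<in>J. v r * ?W r w))"
      "complex_integrable M (\<lambda>w. iexp (\<Sum>r\<in>J. v r * ?W r w))"
      by (rule integrable_const_bound[of _ 1]; auto simp: norm_mult)+
    have split: "(CLINT w|M. (f w - \<kappa>) * g w) = (CLINT w|M. g w * f w) - (CLINT w|M. g w) * \<kappa>"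
      if "integrable M (\<lambda>w. f w * g w)" "integrable M g" for f g :: "'a \<Rightarrow> complex"
      using that by (simp add: left_diff_distrib mult.commute[of "g _" "f _"] mult.commute[of "integral\<^sup>L M g"])
    have "(CLINT w|M. D w * iexp (\<Sum>r\<in>J. v r * ?W r w)) =
      (CLINT w|M. iexp (\<Sum>r\<in>J. v r * ?W r w) * iexp (u * (?W t w - ?W s w))) - (CLINT w|M. iexp (\<Sum>r\<in>J. v r * ?W r w)) * \<kappa>"
      unfolding D_def by (rule split[OF i2])
    also have "\<dots> = 0"
      unfolding e d k using char_past[OF J', of "t / T" "\<lambda>q. v (q * T) * sqrt T" "u * sqrt T"] st T
      by (simp add: divide_right_mono)
    finally show "(CLINT w|M. D w * iexp (\<Sum>r\<in>J. v r * ?W r w)) = 0" .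
  qed measurable
  moreover have "(CLINT w|M. indicator A w * D w) = (CLINT w|M. indicator A w * iexp (u * (?W t w - ?W s w))) - prob A * \<kappa>"
  proof -
    have "integrable M (\<lambda>w. indicator A w * iexp (u * (?W t w - ?W s w)))"
      using AM by (intro integrable_const_bound[of _ 1]) (auto simp: norm_mult split: split_indicator)
    moreover have "integrable M (\<lambda>w. indicator A w * \<kappa>)"
      using AM by (intro integrable_const_bound[of _ "norm \<kappa>"]) (auto simp: norm_mult split: split_indicator)
    ultimately show ?thesis
      using complex_integral_indicator[OF AM] by (simp add: D_def right_diff_distrib)
  qed
  ultimately show "(CLINT w|M. indicator A w * iexp (u * (?W t w - ?W s w))) = prob A * exp (- (u\<^sup>2 * (t - s)) / 2)"
    by (simp add: \<kappa>_def)
qed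

end

text \<open>
  Indexing the coordinates by the natural numbers inside the reals gives points of type
  \<open>real \<Rightarrow> real\<close> and still a countably generated \<open>\<sigma>\<close>-algebra.
\<close>

abbreviation gaussian_product :: "(real \<Rightarrow> real) measure" where
  "gaussian_product \<equiv> PiM (\<nat> :: real set) (\<lambda>_. std_normal_distribution)"

lemma gaussian_sequence_product: "gaussian_sequence gaussian_product (\<lambda>i w. w (real i))"
proof -
  interpret N: prob_space std_normal_distribution by (rule prob_space_normal_density) simp
  interpret product_prob_space "\<lambda>_. std_normal_distribution" "\<nat> :: real set" ..
  let ?P = gaussian_product
  have coord: "distr ?P borel (\<lambda>w. w r) = std_normal_distribution" if "r \<in> \<nat>" for r
    using PiM_component[OF that] by (simp cong: distr_cong)
  have m: "(\<lambda>w. w r) \<in> borel_measurable ?P" if "r \<in> \<nat>" for r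
    using measurable_component_singleton[OF that, of "\<lambda>_. std_normal_distribution"] by simp
  have sets_eq: "sets (PiM (\<nat> :: real set) (\<lambda>_. borel :: real measure)) = sets ?P"
    by (rule sets_PiM_cong) auto
  have "indep_vars (\<lambda>_. borel) (\<lambda>r w. w r) (\<nat> :: real set)"
  proof (subst indep_vars_iff_distr_eq_PiM')
    show "(\<nat> :: real set) \<noteq> {}" by auto
    show "(\<lambda>w. w r) \<in> borel_measurable ?P" if "r \<in> \<nat>" for r using m[OF that] .
    have "distr ?P (PiM \<nat> (\<lambda>_. borel)) (\<lambda>w. \<lambda>r\<in>\<nat>. w r) = distr ?P ?P (\<lambda>w. w)"
      by (rule distr_cong) (auto simp: sets_eq space_PiM PiE_restrict)
    also have "\<dots> = ?P" by (rule distr_id)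
    also have "\<dots> = PiM \<nat> (\<lambda>r. distr ?P borel (\<lambda>w. w r))"
      by (rule PiM_cong) (auto simp: coord)
    finally show "distr ?P (PiM \<nat> (\<lambda>_. borel)) (\<lambda>w. \<lambda>r\<in>\<nat>. w r) = PiM \<nat> (\<lambda>r. distr ?P borel (\<lambda>w. w r))" .
  qed
  then have ind: "indep_sets (\<lambda>r. {(\<lambda>w. w r) -` A \<inter> space ?P | A. A \<in> sets borel}) (\<nat> :: real set)"
    unfolding indep_vars_def2 by simp
  show ?thesis
  proof
    show "distributed ?P lborel (\<lambda>w. w (real i)) std_normal_density" for i
    proof -
      have "distr ?P lborel (\<lambda>w. w (real i)) = distr ?P borel (\<lambda>w. w (real i))" by (rule distr_cong) auto
      then show ?thesis using coord[of "real i"] m[of "real i"] by (simp add: distributed_def)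
    qed
    show "indep_vars (\<lambda>_. borel) (\<lambda>i w. w (real i)) UNIV"
      unfolding indep_vars_def2
    proof (intro conjI ballI indep_setsI)
      show "(\<lambda>w. w (real i)) \<in> borel_measurable ?P" for i using m by simp
      then show "{(\<lambda>w. w (real i)) -` A \<inter> space ?P | A. A \<in> sets borel} \<subseteq> events" for i
        using measurable_sets by blast
    next
      fix A and J :: "nat set"
      assume J: "J \<noteq> {}" "finite J" and A: "\<forall>j\<in>J. A j \<in> {(\<lambda>w. w (real j)) -` A \<inter> space ?P | A. A \<in> sets borel}"
      have "prob (\<Inter>r\<in>real ` J. A (nat \<lfloor>r\<rfloor>)) = (\<Prod>r\<in>real ` J. prob (A (nat \<lfloor>r\<rfloor>)))"
        by (rule indep_setsD[OF ind]) (use J A in auto)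
      then show "prob (\<Inter>j\<in>J. A j) = (\<Prod>j\<in>J. prob (A j))"
        by (simp add: prod.reindex inj_on_def)
    qed
  qed
qed

lemma countable_generator_Int_stable:
  assumes "countable E0" "E0 \<subseteq> Pow \<Omega>"
  obtains E where "countable E" "Int_stable E" "E \<subseteq> Pow \<Omega>" "sigma_sets \<Omega> E = sigma_sets \<Omega> E0"
proof
  let ?F = "{F. finite F \<and> F \<subseteq> E0}"
  let ?E = "(\<lambda>F. \<Omega> \<inter> \<Inter>F) ` ?F"
  show "countable ?E" using countable_Collect_finite_subset[OF assms(1)] by (rule countable_image)
  show "Int_stable ?E"
  proof (rule Int_stableI)
    fix a b assume "a \<in> ?E" "b \<in> ?E"
    then obtain F G where "F \<in> ?F" "G \<in> ?F" "a = \<Omega> \<inter> \<Inter>F" "b = \<Omega> \<inter> \<Inter>G" by blast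
    then show "a \<inter> b \<in> ?E" by (intro image_eqI[of _ _ "F \<union> G"]) auto
  qed
  show "?E \<subseteq> Pow \<Omega>" by auto
  show "sigma_sets \<Omega> ?E = sigma_sets \<Omega> E0"
  proof (rule sigma_sets_eqI)
    interpret sigma_algebra \<Omega> "sigma_sets \<Omega> E0" using assms(2) by (rule sigma_algebra_sigma_sets)
    fix a assume "a \<in> ?E"
    then obtain F where F: "finite F" "F \<subseteq> E0" "a = \<Omega> \<inter> \<Inter>F" by auto
    have "\<Omega> \<inter> \<Inter>F \<in> sigma_sets \<Omega> E0" using F(1,2)
      by (induction F) (auto simp: Int_left_commute intro!: Int)
    then show "a \<in> sigma_sets \<Omega> E0" using F(3) by simp
  next
    fix a assume a: "a \<in> E0"
    then have "a = \<Omega> \<inter> \<Inter>{a}" using assms(2) by auto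
    then have "a \<in> ?E" using a by (intro image_eqI[of _ _ "{a}"]) auto
    then show "a \<in> sigma_sets \<Omega> ?E" by (rule sigma_sets.Basic)
  qed
qed

text \<open>
  Half-lines with rational end points in each coordinate generate, and finite intersections of them
  are still countably many.
\<close>

lemma gaussian_product_countably_generated:
  obtains E where "countable E" "Int_stable E" "E \<subseteq> Pow (space gaussian_product)"
    "sets gaussian_product = sigma_sets (space gaussian_product) E"
proof -
  let ?P = gaussian_product
  let ?\<Omega> = "space gaussian_product"
  define E0 where "E0 = (\<lambda>(i, q). {w\<in>?\<Omega>. w (real i) \<le> real_of_rat q}) ` (UNIV :: (nat \<times> rat) set)"
  have E0: "countable E0" "E0 \<subseteq> Pow ?\<Omega>" unfolding E0_def by auto
  have m: "(\<lambda>w. w r) \<in> borel_measurable ?P" if "r \<in> \<nat>" for r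
    using measurable_component_singleton[OF that, of "\<lambda>_. std_normal_distribution"] by simp
  have "sets ?P = sigma_sets ?\<Omega> E0"
  proof
    show "sigma_sets ?\<Omega> E0 \<subseteq> sets ?P"
    proof (rule sets.sigma_sets_subset, safe)
      fix a assume "a \<in> E0"
      then obtain i q where a: "a = {w\<in>?\<Omega>. w (real i) \<le> real_of_rat q}" by (auto simp: E0_def)
      have [measurable]: "(\<lambda>w. w (real i)) \<in> borel_measurable ?P" by (rule m) simp
      show "a \<in> sets ?P" unfolding a by measurable
    qed
    let ?S = "sigma ?\<Omega> E0"
    have S: "space ?S = ?\<Omega>" "sets ?S = sigma_sets ?\<Omega> E0"
      using E0 by (auto simp: space_measure_of sets_measure_of)
    have "(\<lambda>w. w) \<in> measurable ?S ?P"
    proof (rule measurable_PiM_single')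
      show "(\<lambda>w. w) \<in> space ?S \<rightarrow> (\<Pi>\<^sub>E i\<in>\<nat>. space std_normal_distribution)" unfolding S by (auto simp: space_PiM)
      fix r :: real assume "r \<in> \<nat>"
      then obtain i where r: "r = real i" by (auto elim: Nats_cases)
      have "(\<lambda>w. w r) \<in> borel_measurable ?S"
      proof (subst borel_measurable_iff_le, rule allI)
        fix a :: real
        have "{w\<in>space ?S. w r \<le> a} = (\<Inter>q\<in>{q. a < real_of_rat q}. {w\<in>?\<Omega>. w (real i) \<le> real_of_rat q})"
        proof (intro equalityI subsetI)
          fix w assume w: "w \<in> (\<Inter>q\<in>{q. a < real_of_rat q}. {w\<in>?\<Omega>. w (real i) \<le> real_of_rat q})"
          obtain q0 where "a < real_of_rat q0" using of_rat_dense[of a "a + 1"] by auto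
          then have "w \<in> ?\<Omega>" using w by auto
          moreover have "w (real i) \<le> a"
          proof (rule ccontr)
            assume "\<not> w (real i) \<le> a"
            then obtain q where "a < real_of_rat q" "real_of_rat q < w (real i)" using of_rat_dense[of a "w (real i)"] by auto
            then show False using w by auto
          qed
          ultimately show "w \<in> {w\<in>space ?S. w r \<le> a}" by (simp add: S r)
        qed (auto simp: S r)
        also have "\<dots> \<in> sets ?S"
        proof (rule sets.countable_INT)
          have "{w\<in>?\<Omega>. w (real i) \<le> real_of_rat q} \<in> sets ?S" for q
            unfolding S by (rule sigma_sets.Basic) (auto simp: E0_def)
          then show "(\<lambda>q. {w\<in>?\<Omega>. w (real i) \<le> real_of_rat q}) ` {q. a < real_of_rat q} \<subseteq> sets ?S" by auto
          show "{q. a < real_of_rat q} \<noteq> {}" using of_rat_dense[of a "a + 1"] by auto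
        qed
        finally show "{w\<in>space ?S. w r \<le> a} \<in> sets ?S" .
      qed
      then show "(\<lambda>w. w r) \<in> measurable ?S std_normal_distribution" by simp
    qed
    then show "sets ?P \<subseteq> sigma_sets ?\<Omega> E0"
      using measurable_sets[of "\<lambda>w. w" ?S ?P] S sets.sets_into_space[of _ ?P] by (fastforce simp: Int_absorb2)
  qed
  then show thesis
    using countable_generator_Int_stable[OF E0] that by metis
qed

section \<open>Change of measure for piecewise constant drifts\<close>

context wiener
begin

abbreviation G :: "real \<Rightarrow> 'w measure" where "G \<equiv> past P W"

lemma subalgebra_G: "subalgebra P (G s)"
  by (rule subalgebra_past) simp

lemma measurable_from_G: "f \<in> measurable (G s) N \<Longrightarrow> f \<in> measurable P N"
  using measurable_from_subalg[OF subalgebra_G] by blast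

lemma measurable_G_mono: "s \<le> t \<Longrightarrow> f \<in> measurable (G s) N \<Longrightarrow> f \<in> measurable (G t) N"
  by (rule measurable_from_subalg[rotated]) (auto simp: subalgebra_def intro: subsetD[OF sets_past_mono])

lemma W_measurable_G: "0 \<le> r \<Longrightarrow> r \<le> s \<Longrightarrow> W r \<in> borel_measurable (G s)"
  by (rule measurable_past)

text \<open>
  With this product form an integral over an increment can be computed by Fubini's theorem with the
  past frozen.
\<close>

lemma increment_joint_law:
  assumes "0 \<le> s" "s < t" "t \<le> T"
  shows "distr P (G s \<Otimes>\<^sub>M borel) (\<lambda>w. (w, W t w - W s w)) =
    distr P (G s) (\<lambda>w. w) \<Otimes>\<^sub>M density lborel (normal_density 0 (sqrt (t - s)))"
proof -
  let ?Y = "\<lambda>w. W t w - W s w"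
  have c: "(CLINT w|P. indicator A w * iexp (u * ?Y w)) = prob A * exp (- (u\<^sup>2 * (sqrt (t - s))\<^sup>2) / 2)"
    if "A \<in> sets (G s)" for A u
    using W_increment[of s t A u] assms that by simp
  have 1: "distributed P lborel ?Y (normal_density 0 (sqrt (t - s)))"
    and 2: "indep_set (sets (G s)) (sets (vimage_algebra (space P) ?Y borel))"
    using normal_indep_of_char[OF subalgebra_G, where Y = ?Y and \<sigma> = "sqrt (t - s)"] c assms by auto
  have id: "(\<lambda>w. w) \<in> measurable P (G s)"
    using subalgebra_G[of s] by (auto simp: subalgebra_def measurable_def)
  have law: "density lborel (normal_density 0 (sqrt (t - s))) = distr P borel ?Y"
    using 1 by (simp add: distributed_def cong: distr_cong)
  interpret Y: prob_space "distr P borel ?Y" by (rule prob_space_distr) measurable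
  interpret I: prob_space "distr P (G s) (\<lambda>w. w)" using id by (rule prob_space_distr)
  have pm: "(\<lambda>w. (w, ?Y w)) \<in> measurable P (G s \<Otimes>\<^sub>M borel)" using id by measurable
  show ?thesis
    unfolding law
  proof (rule pair_measure_eqI[symmetric])
    show "sigma_finite_measure (distr P (G s) (\<lambda>w. w))" "sigma_finite_measure (distr P borel ?Y)"
      by (rule I.sigma_finite_measure_axioms Y.sigma_finite_measure_axioms)+
    show "sets (distr P (G s) (\<lambda>w. w) \<Otimes>\<^sub>M distr P borel ?Y) = sets (distr P (G s \<Otimes>\<^sub>M borel) (\<lambda>w. (w, ?Y w)))"
      by (simp cong: sets_pair_measure_cong)
    fix A C assume "A \<in> sets (distr P (G s) (\<lambda>w. w))" "C \<in> sets (distr P borel ?Y)"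
    then have A: "A \<in> sets (G s)" and C: "C \<in> sets borel" by auto
    have A': "A \<subseteq> space P" using sets.sets_into_space[OF A] by simp
    have "prob (A \<inter> (?Y -` C \<inter> space P)) = prob A * prob (?Y -` C \<inter> space P)"
      by (rule indep_setD[OF 2 A]) (use C in \<open>auto simp: sets_vimage_algebra\<close>)
    moreover have "(\<lambda>w. (w, ?Y w)) -` (A \<times> C) \<inter> space P = A \<inter> (?Y -` C \<inter> space P)" using A' by auto
    moreover have "(\<lambda>w. w) -` A \<inter> space P = A" using A' by auto
    ultimately show "emeasure (distr P (G s) (\<lambda>w. w)) A * emeasure (distr P borel ?Y) C =
      emeasure (distr P (G s \<Otimes>\<^sub>M borel) (\<lambda>w. (w, ?Y w))) (A \<times> C)"
      using A C id pm by (simp add: emeasure_distr emeasure_eq_measure ennreal_mult)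
  qed
qed

lemma normal_density_shift:
  assumes "\<delta> > 0"
  shows "normal_density 0 (sqrt \<delta>) y * exp (b * y - b\<^sup>2 / 2 * \<delta>) = normal_density 0 (sqrt \<delta>) (y - b * \<delta>)"
proof -
  have "- (y\<^sup>2) / (2 * \<delta>) + (b * y - b\<^sup>2 / 2 * \<delta>) = - ((y - b * \<delta>)\<^sup>2) / (2 * \<delta>)"
    using assms by (simp add: field_simps power2_eq_square)
  then show ?thesis
    using assms by (simp add: normal_density_def exp_add[symmetric])
qed

text \<open>
  With the past frozen, \<open>b\<close> is a constant. Completing the square, the exponential moves the mean of the
  Gaussian increment to \<open>b (t - s)\<close>, which is subtracted again in the exponent.
\<close>

lemma girsanov_one_step:
  fixes f :: "'w \<Rightarrow> complex" and b :: "'w \<Rightarrow> real"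
  assumes st: "0 \<le> s" "s \<le> t" "t \<le> T"
    and f[measurable]: "f \<in> borel_measurable (G s)" "integrable P f"
    and b[measurable]: "b \<in> borel_measurable (G s)"
  defines "E w \<equiv> exp (b w * (W t w - W s w) - (b w)\<^sup>2 / 2 * (t - s))"
  shows "integrable P (\<lambda>w. f w * of_real (E w))"
    and "(CLINT w|P. f w * of_real (E w) * iexp (u * (W t w - W s w - b w * (t - s)))) = (CLINT w|P. f w) * exp (- (u\<^sup>2 * (t - s)) / 2)"
proof -
  have "integrable P (\<lambda>w. f w * of_real (E w)) \<and>
    (CLINT w|P. f w * of_real (E w) * iexp (u * (W t w - W s w - b w * (t - s)))) = (CLINT w|P. f w) * exp (- (u\<^sup>2 * (t - s)) / 2)"
  proof (cases "s = t")
    case True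
    then show ?thesis using f by (simp add: E_def)
  next
    case False
    then have \<delta>: "t - s > 0" using st by simp
    let ?\<delta> = "t - s"
    let ?N = "density lborel (normal_density 0 (sqrt ?\<delta>))"
    let ?P = "distr P (G s) (\<lambda>w. w)"
    let ?Y = "\<lambda>w. W t w - W s w"
    interpret N: prob_space ?N using \<delta> by (intro prob_space_normal_density) simp
    have id: "(\<lambda>w. w) \<in> measurable P (G s)"
      using subalgebra_G[of s] by (auto simp: subalgebra_def measurable_def)
    interpret P': prob_space ?P using id by (rule prob_space_distr)
    interpret PN: pair_sigma_finite ?P ?N ..
    have joint: "distr P (G s \<Otimes>\<^sub>M borel) (\<lambda>w. (w, ?Y w)) = ?P \<Otimes>\<^sub>M ?N"
      using st False by (intro increment_joint_law) auto
    have pm: "(\<lambda>w. (w, ?Y w)) \<in> measurable P (G s \<Otimes>\<^sub>M borel)" using id by measurable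
    define e where "e w y = exp (b w * y - (b w)\<^sup>2 / 2 * ?\<delta>)" for w y
    have e_m[measurable]: "(\<lambda>(w, y). e w y) \<in> borel_measurable (G s \<Otimes>\<^sub>M borel)" unfolding e_def by measurable
    have sets_pair: "sets (?P \<Otimes>\<^sub>M ?N) = sets (G s \<Otimes>\<^sub>M borel)" by (intro sets_pair_measure_cong) auto
    have mass: "(\<integral>\<^sup>+y. ennreal (e w y) \<partial>?N) = 1" for w
    proof -
      have "(\<integral>\<^sup>+y. ennreal (e w y) \<partial>?N) = (\<integral>\<^sup>+y. ennreal (normal_density 0 (sqrt ?\<delta>) y * e w y) \<partial>lborel)"
        by (subst nn_integral_density) (auto simp: e_def ennreal_mult)
      also have "\<dots> = (\<integral>\<^sup>+y. ennreal (normal_density 0 (sqrt ?\<delta>) (y - b w * ?\<delta>)) \<partial>lborel)"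
        unfolding e_def normal_density_shift[OF \<delta>] ..
      also have "\<dots> = (\<integral>\<^sup>+y. ennreal (normal_density 0 (sqrt ?\<delta>) y) \<partial>lborel)"
        using nn_integral_real_affine[of "\<lambda>y. ennreal (normal_density 0 (sqrt ?\<delta>) y)" 1 "- b w * ?\<delta>"]
        by (simp add: add.commute)
      also have "\<dots> = 1" using N.emeasure_space_1 by (simp add: emeasure_density)
      finally show ?thesis .
    qed
    have shift: "(CLINT y|?N. of_real (e w y) * iexp (u * (y - b w * ?\<delta>))) = exp (- (u\<^sup>2 * ?\<delta>) / 2)" for w
    proof -
      have "(CLINT y|?N. of_real (e w y) * iexp (u * (y - b w * ?\<delta>)))
        = (CLINT y|lborel. normal_density 0 (sqrt ?\<delta>) y *\<^sub>R (of_real (e w y) * iexp (u * (y - b w * ?\<delta>))))"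
        by (subst integral_density) (auto simp: e_def)
      also have "\<dots> = (CLINT y|lborel. of_real (normal_density 0 (sqrt ?\<delta>) y * e w y) * iexp (u * (y - b w * ?\<delta>)))"
        by (simp add: scaleR_conv_of_real mult.assoc)
      also have "\<dots> = (CLINT y|lborel. of_real (normal_density 0 (sqrt ?\<delta>) (y - b w * ?\<delta>)) * iexp (u * (y - b w * ?\<delta>)))"
        unfolding e_def normal_density_shift[OF \<delta>] ..
      also have "\<dots> = (CLINT y|lborel. of_real (normal_density 0 (sqrt ?\<delta>) y) * iexp (u * y))"
        using lborel_integral_real_affine[of 1 "\<lambda>y. complex_of_real (normal_density 0 (sqrt ?\<delta>) y) * iexp (u * y)" "- b w * ?\<delta>"]
        by (simp add: add.commute)
      also have "\<dots> = char ?N u"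
        unfolding char_def by (subst integral_density) (auto simp: scaleR_conv_of_real)
      also have "\<dots> = exp (- (u\<^sup>2 * ?\<delta>) / 2)" using \<delta> by (subst char_normal) auto
      finally show ?thesis .
    qed
    define F where "F = (\<lambda>(w, y). f w * of_real (e w y) * iexp (u * (y - b w * ?\<delta>)))"
    have F_m[measurable]: "F \<in> borel_measurable (G s \<Otimes>\<^sub>M borel)" unfolding F_def by measurable
    have F_m': "F \<in> borel_measurable (?P \<Otimes>\<^sub>M ?N)" using F_m measurable_cong_sets[OF sets_pair refl] by blast
    have fP: "integrable ?P f" using f id by (simp add: integrable_distr_eq)
    have nF: "norm (F (w, y)) = norm (f w) * e w y" for w y
      by (simp add: F_def norm_mult e_def)
    have F_int: "integrable (?P \<Otimes>\<^sub>M ?N) F"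
    proof (rule integrableI_bounded[OF F_m'])
      have m: "(\<lambda>p. ennreal (norm (F p))) \<in> borel_measurable (?P \<Otimes>\<^sub>M ?N)" using F_m' by measurable
      have "(\<integral>\<^sup>+p. ennreal (norm (F p)) \<partial>(?P \<Otimes>\<^sub>M ?N)) = (\<integral>\<^sup>+w. \<integral>\<^sup>+y. ennreal (norm (F (w, y))) \<partial>?N \<partial>?P)"
        using N.nn_integral_fst[OF m] by simp
      also have "\<dots> = (\<integral>\<^sup>+w. ennreal (norm (f w)) * (\<integral>\<^sup>+y. ennreal (e w y) \<partial>?N) \<partial>?P)"
        unfolding nF by (intro nn_integral_cong) (subst nn_integral_cmult[symmetric]; auto simp: e_def ennreal_mult)
      also have "\<dots> < \<infinity>" using fP unfolding mass by (simp add: integrable_iff_bounded)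
      finally show "(\<integral>\<^sup>+p. ennreal (norm (F p)) \<partial>(?P \<Otimes>\<^sub>M ?N)) < \<infinity>" .
    qed
    have F_eq: "F (w, ?Y w) = f w * of_real (E w) * iexp (u * (W t w - W s w - b w * ?\<delta>))" for w
      by (simp add: F_def e_def E_def)
    have "integrable P (\<lambda>w. F (w, ?Y w))"
      using F_int unfolding joint[symmetric] by (simp add: integrable_distr_eq[OF pm F_m])
    then have i1: "integrable P (\<lambda>w. f w * of_real (E w) * iexp (u * (W t w - W s w - b w * ?\<delta>)))"
      unfolding F_eq .
    have fm: "f \<in> borel_measurable P" "b \<in> borel_measurable P" by (auto intro: measurable_from_G f b)
    have "integrable P (\<lambda>w. f w * of_real (E w))"
      using fm by (intro Bochner_Integration.integrable_bound[OF i1]) (auto simp: E_def norm_mult)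
    moreover have "(CLINT w|P. f w * of_real (E w) * iexp (u * (W t w - W s w - b w * ?\<delta>))) = (CLINT w|P. f w) * exp (- (u\<^sup>2 * ?\<delta>) / 2)"
    proof -
      have "(CLINT w|P. F (w, ?Y w)) = (CLINT p|?P \<Otimes>\<^sub>M ?N. F p)"
        unfolding joint[symmetric] by (rule integral_distr[OF pm F_m, symmetric])
      also have "\<dots> = (CLINT w|?P. CLINT y|?N. F (w, y))" using PN.integral_fst'[OF F_int] by simp
      also have "\<dots> = (CLINT w|?P. f w * exp (- (u\<^sup>2 * ?\<delta>) / 2))"
        using shift by (simp add: F_def mult.assoc)
      also have "\<dots> = (CLINT w|P. f w * exp (- (u\<^sup>2 * ?\<delta>) / 2))" using id by (subst integral_distr) auto
      also have "\<dots> = (CLINT w|P. f w) * exp (- (u\<^sup>2 * ?\<delta>) / 2)" using f by simp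
      finally show ?thesis unfolding F_eq .
    qed
    ultimately show ?thesis by simp
  qed
  then show "integrable P (\<lambda>w. f w * of_real (E w))"
    and "(CLINT w|P. f w * of_real (E w) * iexp (u * (W t w - W s w - b w * (t - s)))) = (CLINT w|P. f w) * exp (- (u\<^sup>2 * (t - s)) / 2)"
    by auto
qed

end

text \<open>
  The variable \<open>\<beta> j\<close> is the drift on the interval \<open>[j h, (j + 1) h]\<close>, known at its left end.
\<close>

locale step_drift = wiener P W T for P :: "'w measure" and W T +
  fixes h :: real and N :: nat and \<beta> :: "nat \<Rightarrow> 'w \<Rightarrow> real"
  assumes h_pos: "h > 0" and Nh: "real N * h = T"
    and \<beta>_measurable: "\<And>j. \<beta> j \<in> borel_measurable (past P W (real j * h))"
begin

abbreviation \<tau> :: "nat \<Rightarrow> real" where "\<tau> j \<equiv> real j * h"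

text \<open>
  The time spent in the interval \<open>[j h, (j + 1) h]\<close> before \<open>t\<close>. With minima as in this definition the
  same formulas serve at grid points and in between.
\<close>

definition len :: "nat \<Rightarrow> real \<Rightarrow> real" where
  "len j t = min t (\<tau> (Suc j)) - min t (\<tau> j)"

definition drift :: "real \<Rightarrow> 'w \<Rightarrow> real" where
  "drift t w = (\<Sum>j<N. \<beta> j w * len j t)"

definition log_dens :: "real \<Rightarrow> 'w \<Rightarrow> real" where
  "log_dens t w = (\<Sum>j<N. \<beta> j w * (W (min t (\<tau> (Suc j))) w - W (min t (\<tau> j)) w) - (\<beta> j w)\<^sup>2 / 2 * len j t)"

definition dens :: "real \<Rightarrow> 'w \<Rightarrow> real" where "dens t w = exp (log_dens t w)"

definition B :: "real \<Rightarrow> 'w \<Rightarrow> real" where "B t w = W t w - drift t w"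

definition Q :: "'w measure" where "Q = density P (\<lambda>w. ennreal (dens T w))"

lemma \<tau>_mono: "i \<le> j \<Longrightarrow> \<tau> i \<le> \<tau> j" using h_pos by (simp add: mult_right_mono)

lemma \<tau>_nonneg: "0 \<le> \<tau> j" using h_pos by simp

lemma len_nonneg: "0 \<le> len j t" using \<tau>_mono[of j "Suc j"] by (auto simp: len_def min_def)

lemma len_le: "s \<le> t \<Longrightarrow> len j t - len j s \<le> t - s" "s \<le> t \<Longrightarrow> len j s \<le> len j t"
  using \<tau>_mono[of j "Suc j"] by (auto simp: len_def min_def)

lemma len_zero: "t \<le> \<tau> j \<Longrightarrow> len j t = 0"
  using \<tau>_mono[of j "Suc j"] by (auto simp: len_def min_def)

lemma \<beta>_measurable_P[measurable]: "\<beta> j \<in> borel_measurable P"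
  by (rule measurable_from_G[OF \<beta>_measurable])

lemma drift_measurable_G:
  assumes "0 \<le> t"
  shows "drift t \<in> borel_measurable (G t)"
proof -
  have "(\<lambda>w. \<beta> j w * len j t) \<in> borel_measurable (G t)" for j
  proof (cases "t \<le> \<tau> j")
    case False
    then have "\<beta> j \<in> borel_measurable (G t)" by (intro measurable_G_mono[OF _ \<beta>_measurable]) simp
    then show ?thesis by measurable
  qed (simp add: len_zero)
  then show ?thesis unfolding drift_def[abs_def] by measurable
qed

lemma dens_measurable_G:
  assumes "0 \<le> t"
  shows "dens t \<in> borel_measurable (G t)"
proof -
  have "(\<lambda>w. \<beta> j w * (W (min t (\<tau> (Suc j))) w - W (min t (\<tau> j)) w) - (\<beta> j w)\<^sup>2 / 2 * len j t) \<in> borel_measurable (G t)" for j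
  proof (cases "t \<le> \<tau> j")
    case True
    then have "min t (\<tau> (Suc j)) = t" "min t (\<tau> j) = t" using \<tau>_mono[of j "Suc j"] by auto
    then show ?thesis using True by (simp only: len_zero[OF True]) simp
  next
    case False
    then have [measurable]: "\<beta> j \<in> borel_measurable (G t)" by (intro measurable_G_mono[OF _ \<beta>_measurable]) simp
    have [measurable]: "W (min t (\<tau> i)) \<in> borel_measurable (G t)" for i
      using assms \<tau>_nonneg[of i] by (intro W_measurable_G) auto
    show ?thesis by measurable
  qed
  then show ?thesis unfolding dens_def[abs_def] log_dens_def by measurable
qed

lemma dens_measurable[measurable]: "dens t \<in> borel_measurable P"
  unfolding dens_def[abs_def] log_dens_def by measurable

lemma drift_measurable[measurable]: "drift t \<in> borel_measurable P"
  unfolding drift_def[abs_def] by measurable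

lemma B_measurable[measurable]: "B t \<in> borel_measurable P"
  unfolding B_def[abs_def] by measurable

lemma B_measurable_G: "0 \<le> t \<Longrightarrow> B t \<in> borel_measurable (G t)"
  unfolding B_def[abs_def] using drift_measurable_G W_measurable_G[of t t] by auto

lemma dens_pos: "dens t w > 0" by (simp add: dens_def)

lemma min_\<tau>_off_interval:
  assumes "\<tau> j \<le> s" "s \<le> t" "t \<le> \<tau> (Suc j)" "i \<noteq> j"
  shows "min t (\<tau> (Suc i)) = min t (\<tau> i) \<and> min s (\<tau> (Suc i)) = min s (\<tau> i)
    \<or> min t (\<tau> (Suc i)) = min s (\<tau> (Suc i)) \<and> min t (\<tau> i) = min s (\<tau> i)"
proof (cases "i < j")
  case True
  then have "\<tau> (Suc i) \<le> s" "\<tau> i \<le> s" using assms \<tau>_mono[of "Suc i" j] \<tau>_mono[of i j] by auto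
  then show ?thesis using assms by (auto simp: min_def)
next
  case False
  then have "t \<le> \<tau> i" "t \<le> \<tau> (Suc i)" using assms \<tau>_mono[of "Suc j" i] \<tau>_mono[of "Suc j" "Suc i"] by auto
  then show ?thesis using assms by (auto simp: min_def)
qed

lemma min_\<tau>_on_interval:
  assumes "\<tau> j \<le> s" "s \<le> t" "t \<le> \<tau> (Suc j)"
  shows "min t (\<tau> (Suc j)) = t" "min s (\<tau> (Suc j)) = s" "min t (\<tau> j) = \<tau> j" "min s (\<tau> j) = \<tau> j"
  using assms by auto

lemma sum_single_difference:
  fixes f g :: "nat \<Rightarrow> real"
  assumes "j < N" "\<And>i. i \<noteq> j \<Longrightarrow> f i = g i"
  shows "(\<Sum>i<N. f i) = (\<Sum>i<N. g i) + (f j - g j)"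
proof -
  have "(\<Sum>i<N. f i) = (\<Sum>i<N. g i + (if i = j then f j - g j else 0))"
    using assms(2) by (intro sum.cong) auto
  then show ?thesis using assms(1) by (simp add: sum.distrib)
qed

lemma drift_one_step:
  assumes "j < N" "\<tau> j \<le> s" "s \<le> t" "t \<le> \<tau> (Suc j)"
  shows "drift t w = drift s w + \<beta> j w * (t - s)"
proof -
  have "drift t w = drift s w + (\<beta> j w * len j t - \<beta> j w * len j s)"
    unfolding drift_def
  proof (rule sum_single_difference[OF assms(1)])
    fix i assume "i \<noteq> j"
    from min_\<tau>_off_interval[OF assms(2-4) this] show "\<beta> i w * len i t = \<beta> i w * len i s"
      by (elim disjE conjE) (simp_all only: len_def, simp)
  qed
  moreover have "len j t - len j s = t - s"
    unfolding len_def min_\<tau>_on_interval[OF assms(2-4)] by simp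
  ultimately show ?thesis by (simp add: right_diff_distrib[symmetric])
qed

lemma dens_one_step:
  assumes "j < N" "\<tau> j \<le> s" "s \<le> t" "t \<le> \<tau> (Suc j)"
  shows "dens t w = dens s w * exp (\<beta> j w * (W t w - W s w) - (\<beta> j w)\<^sup>2 / 2 * (t - s))"
proof -
  let ?f = "\<lambda>t i. \<beta> i w * (W (min t (\<tau> (Suc i))) w - W (min t (\<tau> i)) w) - (\<beta> i w)\<^sup>2 / 2 * len i t"
  have "log_dens t w = log_dens s w + (?f t j - ?f s j)"
    unfolding log_dens_def
  proof (rule sum_single_difference[OF assms(1)])
    fix i assume "i \<noteq> j"
    from min_\<tau>_off_interval[OF assms(2-4) this] show "?f t i = ?f s i"
      by (elim disjE conjE) (simp_all only: len_def, simp)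
  qed
  also have "?f t j - ?f s j = \<beta> j w * (W t w - W s w) - (\<beta> j w)\<^sup>2 / 2 * (t - s)"
    unfolding len_def min_\<tau>_on_interval[OF assms(2-4)] by (simp add: algebra_simps diff_divide_distrib)
  finally show ?thesis by (simp add: dens_def exp_add)
qed

lemma dens_zero: "dens 0 w = 1"
proof -
  have "min 0 (\<tau> i) = 0" for i using \<tau>_nonneg[of i] by simp
  then have "log_dens 0 w = 0" unfolding log_dens_def len_def by (simp only:) simp
  then show ?thesis by (simp add: dens_def)
qed

lemma drift_zero: "drift 0 w = 0"
proof -
  have "min 0 (\<tau> i) = 0" for i using \<tau>_nonneg[of i] by simp
  then show ?thesis unfolding drift_def len_def by (simp only:) simp
qed

lemma grid_cases:
  assumes "0 < t" "t \<le> \<tau> k"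
  obtains j where "j < k" "\<tau> j < t" "t \<le> \<tau> (Suc j)"
  using assms(2)
proof (induction k arbitrary: thesis)
  case 0
  then show ?case using assms(1) by simp
next
  case (Suc k)
  show ?case
  proof (cases "t \<le> \<tau> k")
    case True
    then show ?thesis using Suc.IH Suc.prems(1) by (metis less_SucI)
  next
    case False
    then show ?thesis using Suc.prems(1)[of k] Suc.prems(2) by simp
  qed
qed

lemma dens_integrable_grid:
  assumes "k \<le> N" "0 \<le> t" "t \<le> \<tau> k"
  shows "integrable P (dens t)"
  using assms
proof (induction k arbitrary: t)
  case 0
  then have "dens t = (\<lambda>_. 1)" using dens_zero by (auto simp: fun_eq_iff)
  then show ?case by simp
next
  case (Suc k)
  show ?case
  proof (cases "t \<le> \<tau> k")
    case False
    then have t: "\<tau> k \<le> t" "t \<le> \<tau> (Suc k)" "k < N" using Suc by auto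
    have tT: "t \<le> T" using t \<tau>_mono[of "Suc k" N] Nh by simp
    have "integrable P (\<lambda>w. complex_of_real (dens (\<tau> k) w) *
        of_real (exp (\<beta> k w * (W t w - W (\<tau> k) w) - (\<beta> k w)\<^sup>2 / 2 * (t - \<tau> k))))"
      by (rule girsanov_one_step(1)[OF \<tau>_nonneg t(1) tT])
        (use Suc \<beta>_measurable dens_measurable_G[OF \<tau>_nonneg] \<tau>_nonneg in auto)
    then have "integrable P (\<lambda>w. complex_of_real (dens t w))"
      unfolding dens_one_step[OF t(3) order_refl t(1,2)] by simp
    then have "integrable P (\<lambda>w. Re (complex_of_real (dens t w)))" by (rule integrable_Re)
    then show ?thesis by simp
  qed (use Suc in auto)
qed

lemma dens_integrable: "0 \<le> t \<Longrightarrow> t \<le> T \<Longrightarrow> integrable P (dens t)"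
  using dens_integrable_grid[of N t] Nh by simp

text \<open>
  Induction over the grid: if \<open>t\<close> lies beyond the grid point \<open>k h\<close> and \<open>s\<close> before it, the exponential
  splits at \<open>k h\<close>, and the factor up to \<open>k h\<close> belongs to the past of the last step.
\<close>

lemma girsanov_grid:
  fixes Y :: "'w \<Rightarrow> complex"
  assumes "k \<le> N" "0 \<le> s" "s \<le> t" "t \<le> \<tau> k" "Y \<in> borel_measurable (G s)" "\<And>w. norm (Y w) \<le> K"
  shows "(CLINT w|P. of_real (dens t w) * Y w * iexp (u * (B t w - B s w)))
    = (CLINT w|P. of_real (dens s w) * Y w) * exp (- (u\<^sup>2 * (t - s)) / 2)"
  using assms
proof (induction k arbitrary: s t Y)
  case 0
  then have "s = t" using \<tau>_nonneg by simp
  then show ?case by simp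
next
  case (Suc k)
  show ?case
  proof (cases "t \<le> \<tau> k")
    case True
    then show ?thesis using Suc by simp
  next
    case False
    then have t: "\<tau> k \<le> t" "t \<le> \<tau> (Suc k)" "k < N" using Suc by auto
    have tT: "t \<le> T" using t \<tau>_mono[of "Suc k" N] Nh by simp
    \<comment> \<open>The step inside the last interval, from any of its times \<open>r\<close>.\<close>
    have last_step: "(CLINT w|P. of_real (dens t w) * Y' w * iexp (u * (B t w - B r w)))
      = (CLINT w|P. of_real (dens r w) * Y' w) * exp (- (u\<^sup>2 * (t - r)) / 2)"
      if r: "\<tau> k \<le> r" "r \<le> t" and Y': "Y' \<in> borel_measurable (G r)" "\<And>w. norm (Y' w) \<le> K" for r and Y' :: "'w \<Rightarrow> complex"
    proof -
      have r0: "0 \<le> r" using r \<tau>_nonneg[of k] by simp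
      have Y'P: "Y' \<in> borel_measurable P" by (rule measurable_from_G[OF Y'(1)])
      have K0: "K \<ge> 0" using Y'(2) norm_ge_zero order_trans by blast
      have f: "integrable P (\<lambda>w. of_real (dens r w) * Y' w)"
      proof (rule Bochner_Integration.integrable_bound)
        show "integrable P (\<lambda>w. dens r w * K)" using dens_integrable[of r] r0 r tT by simp
        have "norm (of_real (dens r w) * Y' w) \<le> norm (dens r w * K)" for w
          using mult_left_mono[OF Y'(2)[of w] less_imp_le[OF dens_pos[of r w]]] dens_pos[of r w] K0 by (simp add: norm_mult)
        then show "AE w in P. norm (of_real (dens r w) * Y' w) \<le> norm (dens r w * K)" by simp
      qed (use Y'P in measurable)
      have fG: "(\<lambda>w. of_real (dens r w) * Y' w) \<in> borel_measurable (G r)"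
        using dens_measurable_G[OF r0] Y'(1) by measurable
      have bG: "\<beta> k \<in> borel_measurable (G r)" using r by (intro measurable_G_mono[OF _ \<beta>_measurable]) auto
      have e: "of_real (dens t w) * Y' w * iexp (u * (B t w - B r w)) = of_real (dens r w) * Y' w *
         of_real (exp (\<beta> k w * (W t w - W r w) - (\<beta> k w)\<^sup>2 / 2 * (t - r))) * iexp (u * (W t w - W r w - \<beta> k w * (t - r)))" for w
        unfolding dens_one_step[OF t(3) r t(2)] B_def drift_one_step[OF t(3) r t(2)]
        by (simp add: mult_ac) (simp add: algebra_simps)
      show ?thesis unfolding e by (rule girsanov_one_step(2)[OF r0 r(2) tT fG f bG])
    qed
    show ?thesis
    proof (cases "\<tau> k \<le> s")
      case True
      then show ?thesis using last_step[of s Y] Suc.prems by simp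
    next
      case False
      let ?r = "\<tau> k"
      have s: "0 \<le> s" "s \<le> ?r" using False Suc.prems by auto
      define Y' where "Y' w = Y w * iexp (u * (B ?r w - B s w))" for w
      have Y'm: "Y' \<in> borel_measurable (G ?r)"
      proof -
        have [measurable]: "Y \<in> borel_measurable (G ?r)" "B s \<in> borel_measurable (G ?r)" "B ?r \<in> borel_measurable (G ?r)"
          using measurable_G_mono[OF s(2)] Suc.prems(5) B_measurable_G[OF s(1)] B_measurable_G[OF \<tau>_nonneg] by auto
        show ?thesis unfolding Y'_def by measurable
      qed
      have "of_real (dens t w) * Y w * iexp (u * (B t w - B s w)) = of_real (dens t w) * Y' w * iexp (u * (B t w - B ?r w))" for w
      proof -
        have "iexp (u * (B t w - B s w)) = iexp (u * (B ?r w - B s w)) * iexp (u * (B t w - B ?r w))"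
          unfolding exp_add[symmetric] by (simp add: algebra_simps)
        then show ?thesis by (simp add: Y'_def mult.assoc)
      qed
      then have "(CLINT w|P. of_real (dens t w) * Y w * iexp (u * (B t w - B s w))) = (CLINT w|P. of_real (dens t w) * Y' w * iexp (u * (B t w - B ?r w)))"
        by (simp only:)
      also have "\<dots> = (CLINT w|P. of_real (dens ?r w) * Y' w) * exp (- (u\<^sup>2 * (t - ?r)) / 2)"
        by (rule last_step[OF order_refl t(1) Y'm]) (simp add: Y'_def norm_mult Suc.prems)
      also have "(CLINT w|P. of_real (dens ?r w) * Y' w) = (CLINT w|P. of_real (dens s w) * Y w) * exp (- (u\<^sup>2 * (?r - s)) / 2)"
        unfolding Y'_def mult.assoc[symmetric] using Suc.prems s by (intro Suc.IH) auto
      also have "\<dots> * exp (- (u\<^sup>2 * (t - ?r)) / 2) = (CLINT w|P. of_real (dens s w) * Y w) * exp (- (u\<^sup>2 * (t - s)) / 2)"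
      proof -
        have "- (u\<^sup>2 * (?r - s)) / 2 + - (u\<^sup>2 * (t - ?r)) / 2 = - (u\<^sup>2 * (t - s)) / 2"
          by (simp add: field_simps)
        then show ?thesis by (simp only: mult.assoc of_real_mult[symmetric] exp_add[symmetric])
      qed
      finally show ?thesis .
    qed
  qed
qed

lemma girsanov:
  fixes Y :: "'w \<Rightarrow> complex"
  assumes "0 \<le> s" "s \<le> t" "t \<le> T" "Y \<in> borel_measurable (G s)" "\<And>w. norm (Y w) \<le> K"
  shows "(CLINT w|P. of_real (dens t w) * Y w * iexp (u * (B t w - B s w)))
    = (CLINT w|P. of_real (dens s w) * Y w) * exp (- (u\<^sup>2 * (t - s)) / 2)"
  using girsanov_grid[of N s t Y K u] assms Nh by simp


lemma sets_Q[simp, measurable_cong]: "sets Q = sets P" and space_Q[simp]: "space Q = space P"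
  by (simp_all add: Q_def)

lemma integral_Q:
  fixes f :: "'w \<Rightarrow> 'b :: {banach, second_countable_topology}"
  assumes "f \<in> borel_measurable P"
  shows "integral\<^sup>L Q f = (LINT w|P. dens T w *\<^sub>R f w)"
  unfolding Q_def using assms dens_pos by (intro integral_density) (auto intro: less_imp_le)

lemma integral_Q_past:
  fixes Y :: "'w \<Rightarrow> complex"
  assumes s: "0 \<le> s" "s \<le> T" and Y: "Y \<in> borel_measurable (G s)" "\<And>w. norm (Y w) \<le> K"
  shows "integral\<^sup>L Q Y = (CLINT w|P. of_real (dens s w) * Y w)"
proof -
  have "integral\<^sup>L Q Y = (CLINT w|P. of_real (dens T w) * Y w)"
    using measurable_from_G[OF Y(1)] by (simp add: integral_Q scaleR_conv_of_real)
  then show ?thesis using girsanov[OF s(1,2) order_refl Y, of 0] by simp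
qed

lemma prob_space_Q: "prob_space Q"
proof (rule prob_spaceI)
  have "(CLINT w|P. of_real (dens T w)) = (1 :: complex)"
    using girsanov[of 0 T "\<lambda>_. 1" 1 0] T_pos by (simp add: dens_zero prob_space)
  then have "(LINT w|P. dens T w) = 1"
    by (metis integral_complex_of_real of_real_eq_1_iff)
  then show "emeasure Q (space Q) = 1"
    using dens_integrable[of T] T_pos dens_pos
    by (simp add: Q_def emeasure_density nn_integral_eq_integral less_imp_le cong: nn_integral_cong)
qed

sublocale Q: prob_space Q by (rule prob_space_Q)

lemma measure_Q_space[simp]: "measure Q (space P) = 1"
  using Q.prob_space by simp

lemma subalgebra_Q_G: "subalgebra Q (G s)"
  using subalgebra_G[of s] by (simp add: subalgebra_def)

text \<open>
  The density process is a martingale, so the density at time \<open>s\<close> suffices for events of the past of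
  \<open>s\<close>.
\<close>

lemma measure_Q_past:
  assumes "0 \<le> s" "s \<le> T" "A \<in> sets (G s)"
  shows "measure Q A = (LINT w|P. dens s w * indicator A w)"
proof -
  have AP: "A \<in> sets P" using assms subalgebra_G by (auto simp: subalgebra_def)
  have "complex_of_real (measure Q A) = (CLINT w|Q. indicator A w)"
    using AP by (subst complex_integral_indicator) auto
  also have "\<dots> = (CLINT w|P. of_real (dens s w) * indicator A w)"
    using assms by (intro integral_Q_past[where K=1]) (auto split: split_indicator)
  also have "\<dots> = (CLINT w|P. of_real (dens s w * indicator A w))"
    by (intro Bochner_Integration.integral_cong) (auto split: split_indicator)
  finally show ?thesis by (simp only: integral_complex_of_real of_real_eq_iff)
qed

lemma char_B_increment:
  assumes "0 \<le> s" "s \<le> t" "t \<le> T" "A \<in> sets (G s)"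
  shows "(CLINT w|Q. indicator A w * iexp (u * (B t w - B s w))) = measure Q A * exp (- (u\<^sup>2 * (t - s)) / 2)"
proof -
  have AP: "A \<in> sets P" using assms subalgebra_G by (auto simp: subalgebra_def)
  let ?Y = "\<lambda>w. indicator A w * iexp (u * (B t w - B s w))"
  have A: "indicator A \<in> borel_measurable (G s)" using assms(4) by measurable
  have Ym: "?Y \<in> borel_measurable (G t)"
  proof -
    have [measurable]: "B t \<in> borel_measurable (G t)" "B s \<in> borel_measurable (G t)"
      "(indicator A :: _ \<Rightarrow> complex) \<in> borel_measurable (G t)"
      using B_measurable_G[of t] measurable_G_mono[OF assms(2) B_measurable_G] A measurable_G_mono[OF assms(2)] assms(1,2) by auto
    show ?thesis by measurable
  qed
  have "(CLINT w|Q. ?Y w) = (CLINT w|P. of_real (dens t w) * ?Y w)"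
    by (rule integral_Q_past[where K=1, OF _ assms(3) Ym]) (use assms in \<open>auto simp: norm_mult split: split_indicator\<close>)
  also have "\<dots> = (CLINT w|P. of_real (dens t w) * indicator A w * iexp (u * (B t w - B s w)))"
    by (simp only: mult.assoc)
  also have "\<dots> = (CLINT w|P. of_real (dens s w) * indicator A w) * exp (- (u\<^sup>2 * (t - s)) / 2)"
    using assms A by (intro girsanov[where K=1]) (auto split: split_indicator)
  also have "(CLINT w|P. of_real (dens s w) * indicator A w) = (CLINT w|Q. indicator A w)"
    using assms A by (intro integral_Q_past[where K=1, symmetric]) (auto split: split_indicator)
  also have "\<dots> = measure Q A" using AP by (subst complex_integral_indicator) auto
  finally show ?thesis by simp
qed

lemma B_increment_square:
  assumes "0 \<le> s" "s \<le> t" "t \<le> T"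
  shows "integrable Q (\<lambda>w. (B t w - B s w)\<^sup>2)" "(LINT w|Q. (B t w - B s w)\<^sup>2) = t - s"
proof -
  have "integrable Q (\<lambda>w. (B t w - B s w)\<^sup>2) \<and> (LINT w|Q. (B t w - B s w)\<^sup>2) = t - s"
  proof (cases "s = t")
    case False
    then have st: "t - s > 0" using assms by simp
    have c: "(CLINT w|Q. indicator A w * iexp (u * (B t w - B s w))) = Q.prob A * exp (- (u\<^sup>2 * (sqrt (t - s))\<^sup>2) / 2)"
      if "A \<in> sets (G s)" for A u
      using char_B_increment[OF assms that, of u] st by simp
    have d: "distributed Q lborel (\<lambda>w. B t w - B s w) (normal_density 0 (sqrt (t - s)))"
      by (rule Q.normal_indep_of_char(1)[OF subalgebra_Q_G _ _ c]) (use st in auto)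
    show ?thesis using distributed_normal_square[OF d] st by simp
  qed simp
  then show "integrable Q (\<lambda>w. (B t w - B s w)\<^sup>2)" "(LINT w|Q. (B t w - B s w)\<^sup>2) = t - s" by auto
qed

lemma sum_len: "0 \<le> t \<Longrightarrow> t \<le> T \<Longrightarrow> (\<Sum>j<N. len j t) = t"
  unfolding len_def using sum_lessThan_telescope[of "\<lambda>j. min t (\<tau> j)" N] Nh by simp

text \<open>
  The Cauchy-Schwarz inequality in time, from \<open>2 c \<beta> \<le> \<beta>\<^sup>2 + c\<^sup>2\<close> with \<open>c\<close> the mean drift.
\<close>

lemma drift_square_le:
  assumes "0 \<le> t" "t \<le> T"
  shows "(drift t w)\<^sup>2 \<le> T * (\<Sum>j<N. (\<beta> j w)\<^sup>2 * len j t)"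
proof -
  define c where "c = drift t w / T"
  have "2 * c * drift t w = (\<Sum>j<N. (2 * c * \<beta> j w) * len j t)"
    unfolding drift_def sum_distrib_left by (simp add: mult.assoc)
  also have "\<dots> \<le> (\<Sum>j<N. ((\<beta> j w)\<^sup>2 + c\<^sup>2) * len j t)"
  proof (intro sum_mono mult_right_mono len_nonneg)
    show "2 * c * \<beta> j w \<le> (\<beta> j w)\<^sup>2 + c\<^sup>2" for j
      using sum_squares_bound[of c "\<beta> j w"] by simp
  qed
  also have "\<dots> = (\<Sum>j<N. (\<beta> j w)\<^sup>2 * len j t) + c\<^sup>2 * t"
    unfolding distrib_right sum.distrib sum_distrib_left[symmetric] sum_len[OF assms] ..
  also have "\<dots> \<le> (\<Sum>j<N. (\<beta> j w)\<^sup>2 * len j t) + c\<^sup>2 * T"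
    using assms by (intro add_left_mono mult_left_mono) auto
  finally have "2 * c * drift t w - c\<^sup>2 * T \<le> (\<Sum>j<N. (\<beta> j w)\<^sup>2 * len j t)" by simp
  also have "2 * c * drift t w - c\<^sup>2 * T = (drift t w)\<^sup>2 / T"
    using T_pos by (simp add: c_def field_simps power2_eq_square)
  finally show ?thesis using T_pos by (simp add: pos_divide_le_eq mult.commute)
qed

lemma abs_drift_increment_le:
  assumes "s \<le> t"
  shows "\<bar>drift t w - drift s w\<bar> \<le> (\<Sum>j<N. \<bar>\<beta> j w\<bar> * (len j t - len j s))"
proof -
  have "drift t w - drift s w = (\<Sum>j<N. \<beta> j w * (len j t - len j s))"
    by (simp add: drift_def sum_subtractf right_diff_distrib)
  also have "\<bar>\<dots>\<bar> \<le> (\<Sum>j<N. \<bar>\<beta> j w * (len j t - len j s)\<bar>)" by (rule sum_abs)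
  also have "\<dots> = (\<Sum>j<N. \<bar>\<beta> j w\<bar> * (len j t - len j s))"
    using len_le(2)[OF assms] by (simp add: abs_mult)
  finally show ?thesis .
qed

lemma second_moment_le:
  assumes t: "0 \<le> t" "t \<le> T" and q: "\<And>j. j < N \<Longrightarrow> integrable Q (\<lambda>w. (\<beta> j w)\<^sup>2)"
  shows "integrable Q (\<lambda>w. (x + W t w)\<^sup>2)"
    and "(LINT w|Q. (x + W t w)\<^sup>2) \<le> 3 * (x\<^sup>2 + T + T * (\<Sum>j<N. (LINT w|Q. (\<beta> j w)\<^sup>2) * len j t))"
proof -
  define R where "R w = 3 * (x\<^sup>2 + (B t w - B 0 w)\<^sup>2 + T * (\<Sum>j<N. (\<beta> j w)\<^sup>2 * len j t))" for w
  have sq3: "(a + b + c)\<^sup>2 \<le> 3 * (a\<^sup>2 + b\<^sup>2 + c\<^sup>2)" for a b c :: real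
    using zero_le_power2[of "a - b"] zero_le_power2[of "a - c"] zero_le_power2[of "b - c"]
    by (simp add: power2_eq_square algebra_simps)
  have "AE w in Q. (x + W t w)\<^sup>2 \<le> R w"
  proof (rule AE_I2)
    fix w assume w: "w \<in> space Q"
    have "x + W t w = x + (B t w - B 0 w) + drift t w"
      using W_zero[of w] w by (simp add: B_def drift_zero)
    show "(x + W t w)\<^sup>2 \<le> R w"
      unfolding \<open>x + W t w = _\<close> R_def
      using sq3[of x "B t w - B 0 w" "drift t w"] drift_square_le[OF t, of w] by argo
  qed
  moreover have Ri: "integrable Q R" unfolding R_def
    using B_increment_square(1)[of 0 t] t q
    by (intro integrable_mult_right Bochner_Integration.integrable_add Bochner_Integration.integrable_sum integrable_mult_left) auto
  ultimately show i: "integrable Q (\<lambda>w. (x + W t w)\<^sup>2)"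
    by (intro Bochner_Integration.integrable_bound[OF Ri]) (auto elim!: eventually_mono)
  have "(LINT w|Q. (x + W t w)\<^sup>2) \<le> (LINT w|Q. R w)"
    using \<open>AE w in Q. _\<close> i Ri by (intro integral_mono_AE) auto
  also have "\<dots> = 3 * (x\<^sup>2 + t + T * (\<Sum>j<N. (LINT w|Q. (\<beta> j w)\<^sup>2) * len j t))"
  proof -
    let ?S = "\<lambda>w. \<Sum>j<N. (\<beta> j w)\<^sup>2 * len j t"
    have "integrable Q ?S" using q by (intro Bochner_Integration.integrable_sum integrable_mult_left) auto
    moreover have "(LINT w|Q. ?S w) = (\<Sum>j<N. (LINT w|Q. (\<beta> j w)\<^sup>2) * len j t)"
      using q by (subst Bochner_Integration.integral_sum) auto
    ultimately show ?thesis
      unfolding R_def using B_increment_square[of 0 t] t by simp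
  qed
  finally show "(LINT w|Q. (x + W t w)\<^sup>2) \<le> 3 * (x\<^sup>2 + T + T * (\<Sum>j<N. (LINT w|Q. (\<beta> j w)\<^sup>2) * len j t))"
    using t by simp
qed

lemma abs_increment_le:
  assumes st: "0 \<le> s" "s \<le> t" "t \<le> T"
    and q: "\<And>j. j < N \<Longrightarrow> integrable Q (\<lambda>w. (\<beta> j w)\<^sup>2)" "\<And>j. j < N \<Longrightarrow> (LINT w|Q. (\<beta> j w)\<^sup>2) \<le> c"
  shows "integrable Q (\<lambda>w. W t w - W s w)"
    and "(LINT w|Q. \<bar>W t w - W s w\<bar>) \<le> sqrt (t - s) + (1 + c) * (t - s)"
proof -
  have \<beta>i: "integrable Q (\<lambda>w. \<bar>\<beta> j w\<bar>)" and \<beta>1: "(LINT w|Q. \<bar>\<beta> j w\<bar>) \<le> 1 + c" if "j < N" for j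
  proof -
    show i: "integrable Q (\<lambda>w. \<bar>\<beta> j w\<bar>)"
      by (rule Bochner_Integration.integrable_bound[of _ "\<lambda>w. 1 + (\<beta> j w)\<^sup>2"])
        (use q(1)[OF that] abs_le_one_plus_square in \<open>auto simp: add_nonneg_nonneg\<close>)
    have "(LINT w|Q. \<bar>\<beta> j w\<bar>) \<le> (LINT w|Q. 1 + (\<beta> j w)\<^sup>2)"
      using i q(1)[OF that] abs_le_one_plus_square by (intro integral_mono) auto
    also have "\<dots> \<le> 1 + c" using q[OF that] by (simp add: Q.prob_space)
    finally show "(LINT w|Q. \<bar>\<beta> j w\<bar>) \<le> 1 + c" .
  qed
  have Bi: "integrable Q (\<lambda>w. \<bar>B t w - B s w\<bar>)" and B1: "(LINT w|Q. \<bar>B t w - B s w\<bar>) \<le> sqrt (t - s)"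
    using Q.abs_mean_le[of "\<lambda>w. B t w - B s w" "sqrt (t - s)"] B_increment_square[OF st] st by auto
  define R where "R w = \<bar>B t w - B s w\<bar> + (\<Sum>j<N. \<bar>\<beta> j w\<bar> * (len j t - len j s))" for w
  have le: "\<bar>W t w - W s w\<bar> \<le> R w" for w
    using abs_drift_increment_le[OF st(2), of w] by (simp add: R_def B_def)
  have Ri: "integrable Q R" unfolding R_def using Bi \<beta>i
    by (intro Bochner_Integration.integrable_add Bochner_Integration.integrable_sum integrable_mult_left) auto
  show i: "integrable Q (\<lambda>w. W t w - W s w)"
    by (rule Bochner_Integration.integrable_bound[OF Ri]) (use le in \<open>auto intro: order_trans[OF _ abs_ge_self]\<close>)
  have "(LINT w|Q. \<bar>W t w - W s w\<bar>) \<le> (LINT w|Q. R w)"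
    using i Ri le by (intro integral_mono) auto
  also have "\<dots> = (LINT w|Q. \<bar>B t w - B s w\<bar>) + (\<Sum>j<N. (LINT w|Q. \<bar>\<beta> j w\<bar>) * (len j t - len j s))"
  proof -
    let ?S = "\<lambda>w. \<Sum>j<N. \<bar>\<beta> j w\<bar> * (len j t - len j s)"
    have "integrable Q ?S" using \<beta>i by (intro Bochner_Integration.integrable_sum integrable_mult_left) auto
    moreover have "(LINT w|Q. ?S w) = (\<Sum>j<N. (LINT w|Q. \<bar>\<beta> j w\<bar>) * (len j t - len j s))"
      using \<beta>i by (subst Bochner_Integration.integral_sum) auto
    ultimately show ?thesis unfolding R_def using Bi by simp
  qed
  also have "\<dots> \<le> sqrt (t - s) + (\<Sum>j<N. (1 + c) * (len j t - len j s))"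
    using B1 \<beta>1 len_le(2)[OF st(2)] by (intro add_mono sum_mono mult_right_mono) auto
  also have "(\<Sum>j<N. (1 + c) * (len j t - len j s)) = (1 + c) * (t - s)"
    using sum_len[of t] sum_len[of s] st by (simp add: sum_distrib_left[symmetric] sum_subtractf)
  finally show "(LINT w|Q. \<bar>W t w - W s w\<bar>) \<le> sqrt (t - s) + (1 + c) * (t - s)" .
qed

lemma step_drift_double: "step_drift P W T h N (\<lambda>j w. 2 * \<beta> j w)"
  by standard (use h_pos Nh \<beta>_measurable in auto)

text \<open>
  The square of the density is the density for the doubled drift times \<open>exp (\<Sum>\<beta>\<^sup>2 h)\<close>, and densities have
  mean one. Hence the density is square integrable on the event where \<open>\<Sum>\<beta>\<^sup>2 h\<close> is less than \<open>L\<close>; the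
  complement is small by Markov's inequality.
\<close>

lemma uniform_continuity_estimate:
  assumes A: "A \<in> sets P" and L: "L > 0" and K: "K > 0"
    and q: "\<And>j. j < N \<Longrightarrow> integrable Q (\<lambda>w. (\<beta> j w)\<^sup>2)" "\<And>j. j < N \<Longrightarrow> (LINT w|Q. (\<beta> j w)\<^sup>2) \<le> c"
  shows "measure Q A \<le> c * T / L + K * measure P A + exp L / K"
proof -
  interpret D: step_drift P W T h N "\<lambda>j w. 2 * \<beta> j w" by (rule step_drift_double)
  define S where "S w = (\<Sum>j<N. (\<beta> j w)\<^sup>2 * h)" for w
  have [measurable]: "S \<in> borel_measurable P" unfolding S_def by measurable
  have Si: "integrable Q S" unfolding S_def using q by auto
  have S_nn: "S w \<ge> 0" for w unfolding S_def using h_pos by (intro sum_nonneg) auto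
  have "(LINT w|Q. S w) = (\<Sum>j<N. (LINT w|Q. (\<beta> j w)\<^sup>2) * h)" unfolding S_def using q by simp
  also have "\<dots> \<le> (\<Sum>j<N. c * h)" using q h_pos by (intro sum_mono mult_right_mono) auto
  also have "\<dots> = c * T" using Nh by (simp add: mult_ac)
  finally have ES: "(LINT w|Q. S w) \<le> c * T" .
  have lenT: "len j T = h" "D.len j T = h" if "j < N" for j
  proof -
    have "\<tau> (Suc j) \<le> T" "\<tau> j \<le> T" using that \<tau>_mono[of "Suc j" N] \<tau>_mono[of j N] Nh by auto
    then show "len j T = h" "D.len j T = h" unfolding len_def D.len_def by (simp_all add: min_def algebra_simps)
  qed
  have "2 * log_dens T w = D.log_dens T w + S w" for w
    unfolding log_dens_def D.log_dens_def S_def sum_distrib_left sum.distrib[symmetric]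
    by (intro sum.cong refl) (simp add: lenT field_simps power2_eq_square)
  then have sq: "(dens T w)\<^sup>2 = D.dens T w * exp (S w)" for w
    by (simp add: dens_def D.dens_def exp_add[symmetric] power2_eq_square)
  have "(LINT w|P. D.dens T w) = measure D.Q (space P)"
    using D.measure_Q_past[of T "space P"] T_pos sets.top[of "G T"] by (simp cong: Bochner_Integration.integral_cong)
  then have ED: "(LINT w|P. D.dens T w) = 1" using D.Q.prob_space by simp
  define A1 where "A1 = {w\<in>space P. S w \<ge> L}"
  define A2 where "A2 = A \<inter> {w\<in>space P. S w < L}"
  have m: "A1 \<in> sets P" "A2 \<in> sets P" using A by (auto simp: A1_def A2_def)
  have "measure Q A \<le> measure Q (A1 \<union> A2)"
    using m sets.sets_into_space[OF A] by (intro Q.finite_measure_mono) (auto simp: A1_def A2_def)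
  also have "\<dots> \<le> measure Q A1 + measure Q A2" using m by (intro measure_Un_le) auto
  also have "measure Q A1 \<le> c * T / L"
  proof -
    have "measure Q A1 \<le> (LINT w|Q. S w) / L"
      unfolding A1_def using integral_Markov_inequality_measure[OF Si, of "{}" L] L S_nn by simp
    also have "\<dots> \<le> c * T / L" using ES L by (intro divide_right_mono) auto
    finally show ?thesis .
  qed
  also have "measure Q A2 \<le> K * measure P A + exp L / K"
  proof -
    have i1: "integrable P (\<lambda>w. dens T w * indicator A2 w)"
      using dens_integrable[of T] T_pos m dens_pos[of T]
      by (intro integrable_real_mult_indicator) auto
    have i2: "integrable P (\<lambda>w. K * indicator A w + D.dens T w * exp L / K)"
      using D.dens_integrable[of T] T_pos A by (auto simp: emeasure_eq_measure)
    have "measure Q A2 = (LINT w|Q. indicator A2 w)" using m by simp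
    also have "\<dots> = (LINT w|P. dens T w * indicator A2 w)"
      using m by (subst integral_Q) auto
    also have "\<dots> \<le> (LINT w|P. K * indicator A w + D.dens T w * exp L / K)"
    proof (rule integral_mono[OF i1 i2])
      fix w assume "w \<in> space P"
      show "dens T w * indicator A2 w \<le> K * indicator A w + D.dens T w * exp L / K"
      proof (cases "w \<in> A2")
        case True
        then have w: "w \<in> A" "S w \<le> L" by (auto simp: A2_def)
        have "dens T w \<le> K + (dens T w)\<^sup>2 / K"
        proof (cases "dens T w \<le> K")
          case False
          then have "dens T w * K \<le> (dens T w)\<^sup>2"
            using dens_pos[of T w] by (simp add: power2_eq_square mult_left_mono)
          then have "dens T w \<le> (dens T w)\<^sup>2 / K" using K by (simp add: pos_le_divide_eq)
          then show ?thesis using K by simp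
        next
          case True
          then show ?thesis using K by (simp add: add_increasing2)
        qed
        also have "(dens T w)\<^sup>2 / K \<le> D.dens T w * exp L / K"
          unfolding sq using w D.dens_pos[of T w] K by (intro divide_right_mono mult_left_mono) auto
        finally show ?thesis using True w by simp
      next
        case False
        then show ?thesis using D.dens_pos[of T w] K by (auto split: split_indicator intro!: add_nonneg_nonneg)
      qed
    qed
    also have "\<dots> = K * measure P A + exp L / K"
      using D.dens_integrable[of T] T_pos A ED by (simp add: emeasure_eq_measure)
    finally show ?thesis .
  qed
  finally show ?thesis by simp
qed

end

lemma (in wiener) measurable_id_G: "(\<lambda>w. w) \<in> measurable P (G s)"
  using subalgebra_G[of s] by (auto simp: subalgebra_def measurable_def)

context step_drift
begin

text \<open>
  Up to time \<open>k h\<close> the density involves only the first \<open>k\<close> drifts. Hence the laws computed from a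
  partially constructed drift are not changed by its later values.
\<close>

lemma dens_agree:
  assumes sd: "step_drift P W T h N \<beta>'" and eq: "\<And>j. j < k \<Longrightarrow> \<beta>' j = \<beta> j" and t: "t \<le> \<tau> k"
  shows "step_drift.dens W h N \<beta>' t w = dens t w"
proof -
  interpret D: step_drift P W T h N \<beta>' by fact
  have "D.log_dens t w = log_dens t w"
    unfolding D.log_dens_def log_dens_def
  proof (rule sum.cong[OF refl])
    fix j
    show "\<beta>' j w * (W (min t (\<tau> (Suc j))) w - W (min t (\<tau> j)) w) - (\<beta>' j w)\<^sup>2 / 2 * len j t =
      \<beta> j w * (W (min t (\<tau> (Suc j))) w - W (min t (\<tau> j)) w) - (\<beta> j w)\<^sup>2 / 2 * len j t"
    proof (cases "j < k")
      case False
      then have "t \<le> \<tau> j" "t \<le> \<tau> (Suc j)" using t \<tau>_mono[of k j] \<tau>_mono[of k "Suc j"] by auto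
      then have "min t (\<tau> (Suc j)) = t" "min t (\<tau> j) = t" by auto
      then show ?thesis using len_zero[OF \<open>t \<le> \<tau> j\<close>] by (simp only:) simp
    qed (simp add: eq)
  qed
  then show ?thesis by (simp add: D.dens_def dens_def)
qed

lemma restr_Q_agree:
  assumes sd: "step_drift P W T h N \<beta>'" and eq: "\<And>j. j < k \<Longrightarrow> \<beta>' j = \<beta> j" and t: "0 \<le> t" "t \<le> \<tau> k" "t \<le> T"
  shows "restr_to_subalg (step_drift.Q P W T h N \<beta>') (G t) = restr_to_subalg Q (G t)"
proof -
  interpret D: step_drift P W T h N \<beta>' by fact
  show ?thesis
  proof (rule measure_eqI)
    show "sets (restr_to_subalg D.Q (G t)) = sets (restr_to_subalg Q (G t))"
      using sets_restr_to_subalg[OF D.subalgebra_Q_G] sets_restr_to_subalg[OF subalgebra_Q_G] by simp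
    fix A assume "A \<in> sets (restr_to_subalg D.Q (G t))"
    then have A: "A \<in> sets (G t)" using sets_restr_to_subalg[OF D.subalgebra_Q_G] by simp
    have "measure D.Q A = measure Q A"
      unfolding D.measure_Q_past[OF t(1,3) A] measure_Q_past[OF t(1,3) A] using dens_agree[OF sd eq t(2)] by simp
    then show "emeasure (restr_to_subalg D.Q (G t)) A = emeasure (restr_to_subalg Q (G t)) A"
      using emeasure_restr_to_subalg[OF D.subalgebra_Q_G A] emeasure_restr_to_subalg[OF subalgebra_Q_G A]
      by (simp add: D.Q.emeasure_eq_measure Q.emeasure_eq_measure)
  qed
qed

end

lemma (in step_drift) integral_agree:
  fixes f :: "'w \<Rightarrow> real"
  assumes sd: "step_drift P W T h N \<beta>'" and eq: "\<And>j. j < k \<Longrightarrow> \<beta>' j = \<beta> j" and t: "0 \<le> t" "t \<le> \<tau> k" "t \<le> T"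
    and f: "f \<in> borel_measurable (G t)"
  shows "integrable (step_drift.Q P W T h N \<beta>') f \<longleftrightarrow> integrable Q f"
    and "integral\<^sup>L (step_drift.Q P W T h N \<beta>') f = integral\<^sup>L Q f"
proof -
  interpret D: step_drift P W T h N \<beta>' by fact
  have r: "restr_to_subalg D.Q (G t) = restr_to_subalg Q (G t)" by (rule restr_Q_agree[OF sd eq t])
  show "integrable D.Q f \<longleftrightarrow> integrable Q f"
    using r integrable_in_subalg[OF _ f] integrable_from_subalg subalgebra_Q_G D.subalgebra_Q_G by metis
  show "integral\<^sup>L D.Q f = integral\<^sup>L Q f"
    using r integral_subalgebra2[OF _ f] subalgebra_Q_G D.subalgebra_Q_G by metis
qed

lemma (in step_drift) distr_agree:
  fixes f :: "'w \<Rightarrow> real"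
  assumes sd: "step_drift P W T h N \<beta>'" and eq: "\<And>j. j < k \<Longrightarrow> \<beta>' j = \<beta> j" and t: "0 \<le> t" "t \<le> \<tau> k" "t \<le> T"
    and f: "f \<in> borel_measurable (G t)"
  shows "distr (step_drift.Q P W T h N \<beta>') borel f = distr Q borel f"
proof -
  interpret D: step_drift P W T h N \<beta>' by fact
  have fP: "f \<in> borel_measurable P" by (rule measurable_from_G[OF f])
  show ?thesis
  proof (rule measure_eqI)
    fix A assume "A \<in> sets (distr D.Q borel f)"
    then have A: "A \<in> sets borel" by simp
    have fA: "f -` A \<inter> space P \<in> sets (G t)" using measurable_sets[OF f A] by simp
    have "emeasure D.Q (f -` A \<inter> space P) = emeasure Q (f -` A \<inter> space P)"
      using restr_Q_agree[OF sd eq t] emeasure_restr_to_subalg[OF subalgebra_Q_G fA]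
        emeasure_restr_to_subalg[OF D.subalgebra_Q_G fA] by simp
    then show "emeasure (distr D.Q borel f) A = emeasure (distr Q borel f) A"
      using fP A by (simp add: emeasure_distr)
  qed simp
qed

section \<open>The drift along a flow of laws\<close>

text \<open>
  The drift of the equation together with the reference space on which it is to be realised.
\<close>

locale mckean = wiener P W T for P :: "'w measure" and W T +
  fixes b :: "real \<Rightarrow> real \<Rightarrow> real measure \<Rightarrow> real" and x C :: real
  assumes b_measurable: "(\<lambda>(t, y, \<mu>). b t y \<mu>) \<in>
      borel_measurable (restrict_space borel {0..T} \<Otimes>\<^sub>M borel \<Otimes>\<^sub>M borel_P1)"
    and C_pos: "C > 0"
    and b_growth: "\<And>t y \<mu>. t \<in> {0..T} \<Longrightarrow> \<mu> \<in> P1 \<Longrightarrow>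
      \<bar>b t y \<mu>\<bar> \<le> C * (1 + \<bar>y\<bar> + kantorovich \<mu> (return borel 0))"
    and b_continuous: "\<And>\<mu> \<epsilon>. \<mu> \<in> P1 \<Longrightarrow> \<epsilon> > 0 \<Longrightarrow> \<exists>\<delta>>0. \<forall>\<nu>\<in>P1. kantorovich \<mu> \<nu> < \<delta> \<longrightarrow>
      (\<forall>t\<in>{0..T}. \<forall>y. \<bar>b t y \<mu> - b t y \<nu>\<bar> < \<epsilon>)"
begin

definition X :: "real \<Rightarrow> 'w \<Rightarrow> real" where "X t w = x + W t w"

lemma X_measurable[measurable]: "X t \<in> borel_measurable P"
  unfolding X_def[abs_def] by measurable

lemma X_measurable_G: "0 \<le> r \<Longrightarrow> r \<le> t \<Longrightarrow> X r \<in> borel_measurable (G t)"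
  unfolding X_def[abs_def] using W_measurable_G by measurable

lemma X_continuous: "w \<in> space P \<Longrightarrow> continuous_on A (\<lambda>t. X t w)"
  unfolding X_def using W_continuous[of w] by (intro continuous_intros) (auto intro: continuous_on_subset)

lemma X_bounded:
  assumes "w \<in> space P"
  obtains K where "\<And>s. s \<in> {0..T} \<Longrightarrow> \<bar>X s w\<bar> \<le> K" "K \<ge> 0"
proof -
  have "compact ((\<lambda>t. X t w) ` {0..T})"
    by (rule compact_continuous_image[OF X_continuous[OF assms]]) simp
  then have "bounded ((\<lambda>t. X t w) ` {0..T})" by (rule compact_imp_bounded)
  then obtain K where "\<forall>y\<in>(\<lambda>t. X t w) ` {0..T}. \<bar>y\<bar> \<le> K" unfolding bounded_real by blast
  then have "\<And>s. s \<in> {0..T} \<Longrightarrow> \<bar>X s w\<bar> \<le> K" by blast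
  moreover then have "K \<ge> 0" using T_pos by (meson abs_ge_zero atLeastAtMost_iff less_imp_le order_refl order_trans)
  ultimately show thesis using that by blast
qed

text \<open>
  The laws along which the drift is evaluated. Continuity makes \<open>b s (X s w) (m s)\<close> jointly measurable,
  and the constant \<open>K\<close> makes it bounded on every path.
\<close>

definition flow :: "(real \<Rightarrow> real measure) \<Rightarrow> real \<Rightarrow> bool" where
  "flow m K \<longleftrightarrow> continuous_map (top_of_set {0..T}) P1.mtopology m \<and>
     (\<forall>s\<in>{0..T}. m s \<in> P1 \<and> kantorovich (m s) (return borel 0) \<le> K)"

definition clip :: "real \<Rightarrow> real \<Rightarrow> real" where "clip t s = max 0 (min t s)"

text \<open>
  Clipping the time to \<open>[0, t]\<close> turns \<open>X\<close> into a process that is continuous on the whole line and known at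
  time \<open>t\<close>; in this way the drift is progressively measurable.
\<close>

lemma flow_drift_measurable:
  assumes m: "flow m K" and t: "0 \<le> t" "t \<le> T"
  shows "(\<lambda>(w, s). b (clip t s) (X (clip t s) w) (m (clip t s))) \<in> borel_measurable (G t \<Otimes>\<^sub>M borel)"
proof -
  have cm: "clip t \<in> measurable borel (restrict_space borel {0..T})"
    unfolding clip_def using t by (intro measurable_restrict_space2) auto
  have "(\<lambda>(s, w). X (clip t s) w) \<in> borel_measurable (borel \<Otimes>\<^sub>M G t)"
  proof (rule borel_measurable_continuous_process)
    show "X (clip t s) \<in> borel_measurable (G t)" for s
      using t by (intro X_measurable_G) (auto simp: clip_def)
    show "continuous_on UNIV (\<lambda>s. X (clip t s) w)" if "w \<in> space (G t)" for w
      unfolding clip_def using that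
      by (intro continuous_on_compose2[OF X_continuous[of w UNIV]] continuous_intros) auto
  qed
  then have Xm: "(\<lambda>(w, s). X (clip t s) w) \<in> borel_measurable (G t \<Otimes>\<^sub>M borel)"
    by (subst measurable_pair_swap_iff) (simp add: case_prod_beta)
  have mm: "(\<lambda>s. m (clip t s)) \<in> measurable borel borel_P1"
    using measurable_compose[OF cm measurable_continuous_flow] m by (auto simp: flow_def)
  have "(\<lambda>p. (clip t (snd p), (case p of (w, s) \<Rightarrow> X (clip t s) w), m (clip t (snd p))))
    \<in> measurable (G t \<Otimes>\<^sub>M borel) (restrict_space borel {0..T} \<Otimes>\<^sub>M borel \<Otimes>\<^sub>M borel_P1)"
    by (intro measurable_Pair Xm measurable_compose[OF measurable_snd cm] measurable_compose[OF measurable_snd mm])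
  from measurable_compose[OF this b_measurable] show ?thesis by (simp add: case_prod_beta)
qed

lemma flow_drift_path_measurable:
  assumes m: "flow m K" and w: "w \<in> space P"
  shows "(\<lambda>s. indicator {0..T} s *\<^sub>R b s (X s w) (m s)) \<in> borel_measurable borel"
proof -
  have "(\<lambda>s. (w, s)) \<in> measurable borel (G T \<Otimes>\<^sub>M borel)" using w by (intro measurable_Pair) auto
  from measurable_compose[OF this flow_drift_measurable[OF m _ order_refl]]
  have "(\<lambda>s. b (clip T s) (X (clip T s) w) (m (clip T s))) \<in> borel_measurable borel" using T_pos by simp
  then have "(\<lambda>s. indicator {0..T} s *\<^sub>R b (clip T s) (X (clip T s) w) (m (clip T s))) \<in> borel_measurable borel" by measurable
  also have "(\<lambda>s. indicator {0..T} s *\<^sub>R b (clip T s) (X (clip T s) w) (m (clip T s))) = (\<lambda>s. indicator {0..T} s *\<^sub>R b s (X s w) (m s))"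
    by (auto simp: fun_eq_iff clip_def split: split_indicator)
  finally show ?thesis .
qed

lemma flow_drift_bound:
  assumes "flow m K" "s \<in> {0..T}" "\<bar>X s w\<bar> \<le> L"
  shows "\<bar>b s (X s w) (m s)\<bar> \<le> C * (1 + L + K)"
proof -
  have "\<bar>b s (X s w) (m s)\<bar> \<le> C * (1 + \<bar>X s w\<bar> + kantorovich (m s) (return borel 0))"
    using assms by (intro b_growth) (auto simp: flow_def)
  also have "\<dots> \<le> C * (1 + L + K)"
    using assms C_pos by (intro mult_left_mono add_mono) (auto simp: flow_def)
  finally show ?thesis .
qed

lemma flow_drift_integrable:
  assumes m: "flow m K" and w: "w \<in> space P" and "0 \<le> u" "v \<le> T"
  shows "set_integrable lborel {u..v} (\<lambda>s. b s (X s w) (m s))"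
proof -
  obtain L where L: "\<And>s. s \<in> {0..T} \<Longrightarrow> \<bar>X s w\<bar> \<le> L" "L \<ge> 0" using X_bounded[OF w] by blast
  have "set_integrable lborel {0..T} (\<lambda>s. b s (X s w) (m s))"
    unfolding set_integrable_def
  proof (rule Bochner_Integration.integrable_bound)
    show "integrable lborel (\<lambda>s. C * (1 + L + K) * indicator {0..T} s)"
      by (intro integrable_mult_right integrable_real_indicator) (auto simp: emeasure_lborel_Icc_eq)
    show "(\<lambda>s. indicator {0..T} s *\<^sub>R b s (X s w) (m s)) \<in> borel_measurable lborel"
      using flow_drift_path_measurable[OF m w] by simp
    have "norm (indicator {0..T} s *\<^sub>R b s (X s w) (m s)) \<le> norm (C * (1 + L + K) * indicator {0..T} s)" for s
      using flow_drift_bound[OF m _ L(1), of s] by (auto split: split_indicator)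
    then show "AE s in lborel. norm (indicator {0..T} s *\<^sub>R b s (X s w) (m s)) \<le> norm (C * (1 + L + K) * indicator {0..T} s)" by simp
  qed
  then show ?thesis by (rule set_integrable_subset) (use assms in auto)
qed

lemma flow_drift_integral_measurable:
  assumes m: "flow m K" and "0 \<le> u" "v \<le> t" "0 \<le> t" "t \<le> T"
  shows "(\<lambda>w. LBINT s:{u..v}. b s (X s w) (m s)) \<in> borel_measurable (G t)"
proof -
  have "(\<lambda>(w, s). indicator {u..v} s *\<^sub>R b (clip t s) (X (clip t s) w) (m (clip t s))) \<in> borel_measurable (G t \<Otimes>\<^sub>M lborel)"
    using flow_drift_measurable[OF m assms(4,5)] by measurable
  then have "(\<lambda>w. LBINT s. indicator {u..v} s *\<^sub>R b (clip t s) (X (clip t s) w) (m (clip t s))) \<in> borel_measurable (G t)"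
    by (rule lborel.borel_measurable_lebesgue_integral)
  also have "(\<lambda>w. LBINT s. indicator {u..v} s *\<^sub>R b (clip t s) (X (clip t s) w) (m (clip t s))) = (\<lambda>w. LBINT s:{u..v}. b s (X s w) (m s))"
    unfolding set_lebesgue_integral_def
    by (intro ext Bochner_Integration.integral_cong refl) (use assms in \<open>auto simp: clip_def split: split_indicator\<close>)
  finally show ?thesis .
qed

end

text \<open>
  A piecewise constant drift with bounds for its second moments under its own measure \<open>Q\<close>. The laws of
  \<open>X\<close> under \<open>Q\<close> form a flow along which \<open>b\<close> can be evaluated again.
\<close>

locale mckean_step = mckean P W T b x C + step_drift P W T h N \<beta>
  for P :: "'w measure" and W T b x C h N \<beta> +
  fixes e :: "nat \<Rightarrow> real" and S :: real
  assumes \<beta>_square: "\<And>j. j < N \<Longrightarrow> integrable Q (\<lambda>w. (\<beta> j w)\<^sup>2)"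
    "\<And>j. j < N \<Longrightarrow> (LINT w|Q. (\<beta> j w)\<^sup>2) \<le> e j"
    and e_sum: "(\<Sum>j<N. e j * h) \<le> S"
begin

definition law :: "real \<Rightarrow> real measure" where "law s = distr Q borel (X s)"

definition V :: real where "V = 3 * (x\<^sup>2 + T + T * S)"

lemma e_nonneg: "j < N \<Longrightarrow> 0 \<le> e j"
  by (rule order_trans[OF Bochner_Integration.integral_nonneg \<beta>_square(2)]) auto

lemma X_square:
  assumes s: "s \<in> {0..T}"
  shows "integrable Q (\<lambda>w. (X s w)\<^sup>2)" "(LINT w|Q. (X s w)\<^sup>2) \<le> V"
proof -
  have s': "0 \<le> s" "s \<le> T" using s by auto
  show "integrable Q (\<lambda>w. (X s w)\<^sup>2)"
    unfolding X_def by (rule second_moment_le(1)[OF s' \<beta>_square(1)])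
  have "(\<Sum>j<N. (LINT w|Q. (\<beta> j w)\<^sup>2) * len j s) \<le> (\<Sum>j<N. e j * h)"
  proof (rule sum_mono)
    fix j assume "j \<in> {..<N}"
    then have j: "j < N" by simp
    have "len j s \<le> h" using \<tau>_mono[of j "Suc j"] h_pos by (auto simp: len_def min_def algebra_simps)
    then show "(LINT w|Q. (\<beta> j w)\<^sup>2) * len j s \<le> e j * h"
      using \<beta>_square[OF j] e_nonneg[OF j] len_nonneg[of j s] by (intro mult_mono) auto
  qed
  then have "T * (\<Sum>j<N. (LINT w|Q. (\<beta> j w)\<^sup>2) * len j s) \<le> T * S"
    using e_sum T_pos by (intro mult_left_mono) auto
  moreover have "(LINT w|Q. (X s w)\<^sup>2) \<le> 3 * (x\<^sup>2 + T + T * (\<Sum>j<N. (LINT w|Q. (\<beta> j w)\<^sup>2) * len j s))"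
    unfolding X_def by (rule second_moment_le(2)[OF s' \<beta>_square(1)])
  ultimately show "(LINT w|Q. (X s w)\<^sup>2) \<le> V" unfolding V_def by argo
qed

lemma V_nonneg: "0 \<le> V"
  by (rule order_trans[OF Bochner_Integration.integral_nonneg X_square(2)[of 0]]) (use T_pos in auto)

lemma X_integrable: "s \<in> {0..T} \<Longrightarrow> integrable Q (X s)"
  by (rule Bochner_Integration.integrable_bound[of _ "\<lambda>w. 1 + (X s w)\<^sup>2"])
    (use X_square abs_le_one_plus_square in \<open>auto simp: add_nonneg_nonneg\<close>)

lemma law_P1: "s \<in> {0..T} \<Longrightarrow> law s \<in> P1"
  unfolding law_def using X_integrable by (subst Q.distr_in_P1_iff) auto

lemma law_dirac:
  assumes s: "s \<in> {0..T}"
  shows "kantorovich (law s) (return borel 0) \<le> 1 + V" "(kantorovich (law s) (return borel 0))\<^sup>2 \<le> V"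
proof -
  let ?k = "kantorovich (law s) (return borel 0)"
  have "?k \<le> (LINT y|law s. \<bar>y\<bar>)" by (rule kantorovich_dirac_le[OF law_P1[OF s]])
  also have "\<dots> = (LINT w|Q. \<bar>X s w\<bar>)" unfolding law_def by (subst integral_distr) auto
  also have "\<dots> \<le> sqrt V"
    using X_square[OF s] V_nonneg by (intro Q.abs_mean_le) auto
  finally have "?k\<^sup>2 \<le> (sqrt V)\<^sup>2" by (intro power_mono P1.nonneg)
  then show 2: "?k\<^sup>2 \<le> V" using V_nonneg by simp
  show "?k \<le> 1 + V" using 2 abs_le_one_plus_square[of ?k] by linarith
qed

lemma law_increment:
  assumes st: "0 \<le> s" "s \<le> t" "t \<le> T" and c: "\<And>j. j < N \<Longrightarrow> e j \<le> c"
  shows "kantorovich (law s) (law t) \<le> sqrt (t - s) + (1 + c) * (t - s)"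
proof -
  have "kantorovich (law s) (law t) \<le> (LINT w|Q. \<bar>X s w - X t w\<bar>)"
    unfolding law_def using st by (intro Q.kantorovich_distr_le X_integrable) auto
  also have "\<dots> = (LINT w|Q. \<bar>W t w - W s w\<bar>)" by (simp add: X_def abs_minus_commute)
  also have "\<dots> \<le> sqrt (t - s) + (1 + c) * (t - s)"
    using abs_increment_le(2)[OF st \<beta>_square(1), of c] \<beta>_square(2) c by force
  finally show ?thesis .
qed

lemma flow_law: "flow law (1 + V)"
  unfolding flow_def
proof (intro conjI ballI law_P1 law_dirac continuous_map_P1I)
  fix s t :: real assume st: "0 \<le> s" "s \<le> t" "t \<le> T"
  show "kantorovich (law s) (law t) \<le> sqrt (t - s) + (1 + (\<Sum>j<N. e j)) * (t - s)"
    by (rule law_increment[OF st]) (use e_nonneg in \<open>auto intro!: member_le_sum\<close>)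
qed

lemma drift_square_mean:
  assumes s: "s \<in> {0..T}"
  shows "(\<integral>\<^sup>+w. ennreal ((b s (X s w) (law s))\<^sup>2) \<partial>Q) \<le> ennreal (3 * C\<^sup>2 * (1 + 2 * V))"
proof -
  let ?k = "kantorovich (law s) (return borel 0)"
  have "(b s (X s w) (law s))\<^sup>2 \<le> 3 * C\<^sup>2 * (1 + (X s w)\<^sup>2 + V)" for w
  proof -
    have "\<bar>b s (X s w) (law s)\<bar> \<le> C * (1 + \<bar>X s w\<bar> + ?k)" using b_growth[OF s law_P1[OF s]] .
    then have "(b s (X s w) (law s))\<^sup>2 \<le> (C * (1 + \<bar>X s w\<bar> + ?k))\<^sup>2"
      using abs_le_square_iff[of "b s (X s w) (law s)" "C * (1 + \<bar>X s w\<bar> + ?k)"] by linarith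
    also have "\<dots> \<le> C\<^sup>2 * (3 * (1 + (X s w)\<^sup>2 + ?k\<^sup>2))"
    proof -
      have sq3: "(1 + p + q)\<^sup>2 \<le> 3 * (1 + p\<^sup>2 + q\<^sup>2)" for p q :: real
        using zero_le_power2[of "1 - p"] zero_le_power2[of "1 - q"] zero_le_power2[of "p - q"]
        by (simp add: power2_eq_square algebra_simps)
      show ?thesis unfolding power_mult_distrib using sq3[of "\<bar>X s w\<bar>" ?k] by (intro mult_left_mono) auto
    qed
    also have "\<dots> = 3 * C\<^sup>2 * (1 + (X s w)\<^sup>2 + ?k\<^sup>2)" by (simp only: mult_ac)
    also have "\<dots> \<le> 3 * C\<^sup>2 * (1 + (X s w)\<^sup>2 + V)"
      using law_dirac(2)[OF s] by (intro mult_left_mono) auto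
    finally show ?thesis .
  qed
  then have "(\<integral>\<^sup>+w. ennreal ((b s (X s w) (law s))\<^sup>2) \<partial>Q) \<le> (\<integral>\<^sup>+w. ennreal (3 * C\<^sup>2 * (1 + (X s w)\<^sup>2 + V)) \<partial>Q)"
    by (intro nn_integral_mono ennreal_leI) auto
  also have "\<dots> = ennreal (LINT w|Q. 3 * C\<^sup>2 * (1 + (X s w)\<^sup>2 + V))"
    using X_square(1)[OF s] V_nonneg by (intro nn_integral_eq_integral) (auto intro!: AE_I2)
  also have "\<dots> \<le> ennreal (3 * C\<^sup>2 * (1 + 2 * V))"
  proof (rule ennreal_leI)
    have "(LINT w|Q. 3 * C\<^sup>2 * (1 + (X s w)\<^sup>2 + V)) = 3 * C\<^sup>2 * (LINT w|Q. 1 + (X s w)\<^sup>2 + V)" by simp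
    also have "(LINT w|Q. 1 + (X s w)\<^sup>2 + V) = 1 + (LINT w|Q. (X s w)\<^sup>2) + V"
      using X_square(1)[OF s] by simp
    also have "3 * C\<^sup>2 * \<dots> \<le> 3 * C\<^sup>2 * (1 + 2 * V)"
      using X_square(2)[OF s] by (intro mult_left_mono) auto
    finally show "(LINT w|Q. 3 * C\<^sup>2 * (1 + (X s w)\<^sup>2 + V)) \<le> 3 * C\<^sup>2 * (1 + 2 * V)" .
  qed
  finally show ?thesis .
qed

text \<open>
  Jensen's inequality in time, along each path, followed by Fubini's theorem.
\<close>

lemma average_square:
  assumes uv: "0 \<le> u" "u < v" "v \<le> T"
  defines "y w \<equiv> (LBINT s:{u..v}. b s (X s w) (law s)) / (v - u)"
  shows "(\<integral>\<^sup>+w. ennreal ((y w)\<^sup>2) \<partial>Q) \<le> ennreal (3 * C\<^sup>2 * (1 + 2 * V))"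
proof -
  let ?g = "\<lambda>w s. b (clip T s) (X (clip T s) w) (law (clip T s))"
  have clip: "clip T s = s" if "s \<in> {u..v}" for s using that uv by (auto simp: clip_def)
  have sets_eq: "sets (Q \<Otimes>\<^sub>M lborel) = sets (P \<Otimes>\<^sub>M borel)" by (intro sets_pair_measure_cong) auto
  have g1: "(\<lambda>(w, s). ?g w s) \<in> borel_measurable (G T \<Otimes>\<^sub>M borel)"
    using T_pos by (intro flow_drift_measurable[OF flow_law]) auto
  have "(\<lambda>p. (fst p, snd p)) \<in> measurable (P \<Otimes>\<^sub>M borel) (G T \<Otimes>\<^sub>M borel)"
    by (intro measurable_Pair measurable_compose[OF measurable_fst] measurable_snd) (rule measurable_id_G)
  from measurable_compose[OF this g1] have "(\<lambda>(w, s). ?g w s) \<in> borel_measurable (P \<Otimes>\<^sub>M borel)"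
    by (simp add: case_prod_beta)
  then have gm[measurable]: "(\<lambda>(w, s). ?g w s) \<in> borel_measurable (Q \<Otimes>\<^sub>M lborel)"
    using measurable_cong_sets[OF sets_eq refl] by blast
  interpret QL: pair_sigma_finite Q lborel ..
  have jensen: "ennreal ((v - u) * (y w)\<^sup>2) \<le> (\<integral>\<^sup>+s. ennreal (indicator {u..v} s * (?g w s)\<^sup>2) \<partial>lborel)"
    if w: "w \<in> space P" for w
  proof -
    have gi: "set_integrable lborel {u..v} (\<lambda>s. b s (X s w) (law s))"
      using uv by (intro flow_drift_integrable[OF flow_law w]) auto
    obtain L where L: "\<And>s. s \<in> {0..T} \<Longrightarrow> \<bar>X s w\<bar> \<le> L" "L \<ge> 0" using X_bounded[OF w] by blast
    let ?M = "C * (1 + L + (1 + V))"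
    have bd: "\<bar>b s (X s w) (law s)\<bar> \<le> ?M" if "s \<in> {u..v}" for s
      using that uv by (intro flow_drift_bound[OF flow_law _ L(1)]) auto
    have g2i: "integrable lborel (\<lambda>s. indicator {u..v} s * (?g w s)\<^sup>2)"
    proof (rule Bochner_Integration.integrable_bound)
      show "integrable lborel (\<lambda>s. ?M\<^sup>2 * indicator {u..v} s)"
        by (intro integrable_mult_right integrable_real_indicator) (auto simp: emeasure_lborel_Icc_eq)
      show "(\<lambda>s. indicator {u..v} s * (?g w s)\<^sup>2) \<in> borel_measurable lborel"
      proof -
        have "(\<lambda>s. (w, s)) \<in> measurable lborel (Q \<Otimes>\<^sub>M lborel)" using w by (intro measurable_Pair) auto
        from measurable_compose[OF this gm] have [measurable]: "(\<lambda>s. ?g w s) \<in> borel_measurable lborel" by simp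
        show ?thesis by measurable
      qed
      have "norm (indicator {u..v} s * (?g w s)\<^sup>2) \<le> norm (?M\<^sup>2 * indicator {u..v} s)" for s
      proof (cases "s \<in> {u..v}")
        case True
        have "\<bar>b s (X s w) (law s)\<bar> \<le> \<bar>?M\<bar>" using bd[OF True] by linarith
        then have "(b s (X s w) (law s))\<^sup>2 \<le> ?M\<^sup>2" by (simp only: abs_le_square_iff)
        then show ?thesis using True by (simp add: clip[OF True])
      qed simp
      then show "AE s in lborel. norm (indicator {u..v} s * (?g w s)\<^sup>2) \<le> norm (?M\<^sup>2 * indicator {u..v} s)" by simp
    qed
    have Ig: "(LBINT s. indicator {u..v} s *\<^sub>R b s (X s w) (law s)) = (v - u) * y w"
      using uv by (simp add: y_def set_lebesgue_integral_def)
    have "2 * y w * ((v - u) * y w) = (LBINT s. 2 * y w * (indicator {u..v} s *\<^sub>R b s (X s w) (law s)))"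
      using Ig by simp
    also have "\<dots> \<le> (LBINT s. indicator {u..v} s * (?g w s)\<^sup>2 + (y w)\<^sup>2 * indicator {u..v} s)"
    proof (rule integral_mono)
      show "integrable lborel (\<lambda>s. 2 * y w * (indicator {u..v} s *\<^sub>R b s (X s w) (law s)))"
        using gi unfolding set_integrable_def by simp
      show "integrable lborel (\<lambda>s. indicator {u..v} s * (?g w s)\<^sup>2 + (y w)\<^sup>2 * indicator {u..v} s)"
        by (intro Bochner_Integration.integrable_add g2i integrable_mult_right integrable_real_indicator) (auto simp: emeasure_lborel_Icc_eq)
      show "2 * y w * (indicator {u..v} s *\<^sub>R b s (X s w) (law s)) \<le> indicator {u..v} s * (?g w s)\<^sup>2 + (y w)\<^sup>2 * indicator {u..v} s" for s
        using sum_squares_bound[of "y w" "b s (X s w) (law s)"] by (auto simp: clip split: split_indicator)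
    qed
    also have "\<dots> = (LBINT s. indicator {u..v} s * (?g w s)\<^sup>2) + (y w)\<^sup>2 * (v - u)"
      using g2i uv by (subst Bochner_Integration.integral_add) (auto intro!: integrable_mult_right integrable_real_indicator simp: emeasure_lborel_Icc_eq)
    finally have "(v - u) * (y w)\<^sup>2 \<le> (LBINT s. indicator {u..v} s * (?g w s)\<^sup>2)"
      by (simp add: power2_eq_square algebra_simps)
    then have "ennreal ((v - u) * (y w)\<^sup>2) \<le> ennreal (LBINT s. indicator {u..v} s * (?g w s)\<^sup>2)" by (rule ennreal_leI)
    also have "\<dots> = (\<integral>\<^sup>+s. ennreal (indicator {u..v} s * (?g w s)\<^sup>2) \<partial>lborel)"
      using g2i by (intro nn_integral_eq_integral[symmetric]) auto
    finally show ?thesis .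
  qed
  have ym: "y \<in> borel_measurable P"
    unfolding y_def using flow_drift_integral_measurable[OF flow_law, of u v T] uv T_pos
    by (intro measurable_from_G[of _ T] borel_measurable_divide) auto
  have "ennreal (v - u) * (\<integral>\<^sup>+w. ennreal ((y w)\<^sup>2) \<partial>Q) = (\<integral>\<^sup>+w. ennreal ((v - u) * (y w)\<^sup>2) \<partial>Q)"
    using uv ym by (subst nn_integral_cmult[symmetric]) (auto simp: ennreal_mult)
  also have "\<dots> \<le> (\<integral>\<^sup>+w. \<integral>\<^sup>+s. ennreal (indicator {u..v} s * (?g w s)\<^sup>2) \<partial>lborel \<partial>Q)"
    using jensen by (intro nn_integral_mono) auto
  also have "\<dots> = (\<integral>\<^sup>+s. \<integral>\<^sup>+w. ennreal (indicator {u..v} s * (?g w s)\<^sup>2) \<partial>Q \<partial>lborel)"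
    by (rule QL.Fubini'[symmetric]) measurable
  also have "\<dots> \<le> (\<integral>\<^sup>+s. ennreal (3 * C\<^sup>2 * (1 + 2 * V)) * indicator {u..v} s \<partial>lborel)"
  proof (rule nn_integral_mono)
    fix s
    show "(\<integral>\<^sup>+w. ennreal (indicator {u..v} s * (?g w s)\<^sup>2) \<partial>Q) \<le> ennreal (3 * C\<^sup>2 * (1 + 2 * V)) * indicator {u..v} s"
    proof (cases "s \<in> {u..v}")
      case True
      then show ?thesis using drift_square_mean[of s] uv by (simp add: clip)
    qed simp
  qed
  also have "\<dots> = ennreal (v - u) * ennreal (3 * C\<^sup>2 * (1 + 2 * V))"
    using uv by (subst nn_integral_cmult_indicator) (auto simp: mult.commute)
  finally have "ennreal (v - u) * (\<integral>\<^sup>+w. ennreal ((y w)\<^sup>2) \<partial>Q) \<le> ennreal (v - u) * ennreal (3 * C\<^sup>2 * (1 + 2 * V))" .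
  then show ?thesis
    using uv by (subst (asm) ennreal_mult_le_mult_iff) auto
qed

end

section \<open>The delayed scheme\<close>

locale mckean_scheme = mckean P W T b x C for P :: "'w measure" and W T b x C +
  fixes N :: nat
  assumes N_pos: "N > 0"
begin

definition h :: real where "h = T / real N"

lemma h_pos: "h > 0" and Nh: "real N * h = T" using T_pos N_pos by (auto simp: h_def)

text \<open>
  The drift on the \<open>k\<close>-th interval: the average over the preceding interval, or \<open>0\<close> if there is none.
\<close>

definition next_drift :: "nat \<Rightarrow> (nat \<Rightarrow> 'w \<Rightarrow> real) \<Rightarrow> 'w \<Rightarrow> real" where
  "next_drift k \<beta> w = (case k of 0 \<Rightarrow> 0
     | Suc m \<Rightarrow> (LBINT s:{real m * h..real (Suc m) * h}. b s (X s w) (distr (step_drift.Q P W T h N \<beta>) borel (X s))) / h)"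

text \<open>
  The recursion runs over all earlier values, because the law of \<open>X\<close> on the preceding interval depends on
  all of them. Cutting off at \<open>k\<close> makes the well-founded recursion explicit.
\<close>

function beta :: "nat \<Rightarrow> 'w \<Rightarrow> real" where
  "beta k = next_drift k (\<lambda>j. if j < k then beta j else (\<lambda>_. 0))"
  by pat_completeness auto
termination by (relation "Wellfounded.measure id") auto

declare beta.simps[simp del]

definition trunc :: "nat \<Rightarrow> nat \<Rightarrow> 'w \<Rightarrow> real" where "trunc k j = (if j < k then beta j else (\<lambda>_. 0))"

lemma beta_eq: "beta k = next_drift k (trunc k)"
  unfolding trunc_def by (rule beta.simps)

text \<open>
  The bounds \<open>e\<close> solve \<open>e k = a + a h (e 0 + \<dots> + e (k - 1))\<close>; this is the discrete Gronwall recursion for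
  the second moments of the drifts, and \<open>a\<close> collects its constants.
\<close>

definition a :: real where "a = 3 * C\<^sup>2 * (1 + 6 * (x\<^sup>2 + T)) + 18 * C\<^sup>2 * T"

lemma a_nonneg: "a \<ge> 0" unfolding a_def using T_pos by (intro add_nonneg_nonneg mult_nonneg_nonneg) auto

definition e :: "nat \<Rightarrow> real" where "e j = a * (1 + a * h) ^ j"

lemma e_nonneg: "e j \<ge> 0" unfolding e_def using a_nonneg h_pos by simp

lemma e_sum: "(\<Sum>j<k. e j * h) = (1 + a * h) ^ k - 1"
  by (induction k) (auto simp: e_def algebra_simps)

text \<open>
  The second moment of \<open>X s\<close> is bounded by those of the drifts before \<open>s\<close>, and the next drift is an
  average of \<open>b s (X s) (law of X s)\<close>, which grows linearly. Integrals of the earlier drifts are the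
  same under the measures of stages \<open>k\<close> and \<open>k + 1\<close>, as these agree up to time \<open>k h\<close>.
\<close>

lemma stage:
  assumes "k \<le> N"
  shows "mckean_step P W T b C h N (trunc k) (\<lambda>j. if j < k then e j else 0) (\<Sum>j<k. e j * h)"
  using assms
proof (induction k)
  case 0
  interpret step_drift P W T h N "trunc 0"
    by standard (auto simp: trunc_def h_pos Nh)
  show ?case
    by unfold_locales (auto simp: trunc_def)
next
  case (Suc k)
  then have k: "k < N" by simp
  interpret K: mckean_step P W T b x C h N "trunc k" "\<lambda>j. if j < k then e j else 0" "\<Sum>j<k. e j * h"
    using Suc by simp
  have kT: "real k * h \<le> T" "0 \<le> real k * h"
    using k h_pos mult_right_mono[of "real k" "real N" h] Nh by auto
  have beta_m: "beta k \<in> borel_measurable (G (real k * h))"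
  proof (cases k)
    case 0
    have "next_drift 0 f = (\<lambda>_. 0)" for f by (simp add: next_drift_def fun_eq_iff)
    then show ?thesis unfolding beta_eq using 0 by simp
  next
    case (Suc m)
    have "(\<lambda>w. (LBINT s:{real m * h..real (Suc m) * h}. b s (X s w) (K.law s)) / h) \<in> borel_measurable (G (real k * h))"
      using kT h_pos Suc by (intro borel_measurable_divide flow_drift_integral_measurable[OF K.flow_law]) auto
    also have "(\<lambda>w. (LBINT s:{real m * h..real (Suc m) * h}. b s (X s w) (K.law s)) / h) = beta k"
      unfolding beta_eq K.law_def using Suc by (auto simp: next_drift_def fun_eq_iff)
    finally show ?thesis .
  qed
  have sd: "step_drift P W T h N (trunc (Suc k))"
  proof unfold_locales
    fix j
    show "trunc (Suc k) j \<in> borel_measurable (past P W (real j * h))"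
      using K.\<beta>_measurable[of j] beta_m by (cases "j = k") (auto simp: trunc_def less_Suc_eq)
  qed (simp_all add: h_pos Nh)
  interpret S: step_drift P W T h N "trunc (Suc k)" by (rule sd)
  have eq: "trunc k j = trunc (Suc k) j" if "j < k" for j using that by (simp add: trunc_def)
  have agree: "integrable S.Q f \<longleftrightarrow> integrable K.Q f" "integral\<^sup>L S.Q f = integral\<^sup>L K.Q f"
    if "f \<in> borel_measurable (G (real k * h))" for f :: "'w \<Rightarrow> real"
    using S.integral_agree[OF K.step_drift_axioms eq kT(2) order_refl kT(1) that] by auto
  have last: "integrable K.Q (\<lambda>w. (beta k w)\<^sup>2) \<and> (LINT w|K.Q. (beta k w)\<^sup>2) \<le> e k"
  proof (cases k)
    case 0
    then show ?thesis using e_nonneg[of 0] by (simp add: beta_eq next_drift_def)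
  next
    case (Suc m)
    have mT: "0 \<le> real m * h" "real m * h < real (Suc m) * h" "real (Suc m) * h \<le> T"
      using kT h_pos Suc by (auto simp: algebra_simps)
    have beta_av: "beta k w = (LBINT s:{real m * h..real (Suc m) * h}. b s (X s w) (K.law s)) / (real (Suc m) * h - real m * h)" for w
      unfolding beta_eq K.law_def using Suc by (simp add: next_drift_def algebra_simps)
    have bP: "beta k \<in> borel_measurable P" by (rule measurable_from_G[OF beta_m])
    have "(\<integral>\<^sup>+w. ennreal ((beta k w)\<^sup>2) \<partial>K.Q) \<le> ennreal (3 * C\<^sup>2 * (1 + 2 * K.V))"
      unfolding beta_av by (rule K.average_square[OF mT])
    also have "3 * C\<^sup>2 * (1 + 2 * K.V) \<le> e k"
    proof -
      \<comment> \<open>With the bound \<open>S'\<close> for the drifts so far, the growth condition gives at most \<open>a + a S'\<close>, which is \<open>e k\<close>.\<close>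
      define S' where "S' = (\<Sum>j<k. e j * h)"
      have S': "S' \<ge> 0" unfolding S'_def using e_nonneg h_pos by (intro sum_nonneg) auto
      have "3 * C\<^sup>2 * (1 + 2 * K.V) = 3 * C\<^sup>2 * (1 + 6 * (x\<^sup>2 + T)) + 18 * C\<^sup>2 * T * S'"
        unfolding K.V_def unfolding S'_def[symmetric] by (simp add: algebra_simps)
      also have "\<dots> \<le> a + a * S'"
        unfolding a_def using T_pos S' by (intro add_mono mult_right_mono) auto
      also have "\<dots> = e k" unfolding S'_def e_sum by (simp add: e_def algebra_simps)
      finally show ?thesis .
    qed
    finally have le: "(\<integral>\<^sup>+w. ennreal ((beta k w)\<^sup>2) \<partial>K.Q) \<le> ennreal (e k)" by (simp add: ennreal_leI)
    have i: "integrable K.Q (\<lambda>w. (beta k w)\<^sup>2)"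
      using bP le by (intro integrableI_bounded) (auto simp: less_top[symmetric] top_unique)
    then have "ennreal (LINT w|K.Q. (beta k w)\<^sup>2) \<le> ennreal (e k)"
      using le by (simp add: nn_integral_eq_integral)
    then show ?thesis using i e_nonneg[of k] by simp
  qed
  show ?case
  proof unfold_locales
    fix j assume j: "j < N"
    have "integrable S.Q (\<lambda>w. (trunc (Suc k) j w)\<^sup>2) \<and> (LINT w|S.Q. (trunc (Suc k) j w)\<^sup>2) \<le> (if j < Suc k then e j else 0)"
    proof (cases "j < k")
      case True
      have m: "(\<lambda>w. (trunc k j w)\<^sup>2) \<in> borel_measurable (G (real k * h))"
        using measurable_G_mono[OF _ K.\<beta>_measurable[of j]] True h_pos by simp
      show ?thesis using agree[OF m] K.\<beta>_square[OF j] True by (simp add: eq[OF True, symmetric])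
    next
      case False
      show ?thesis
      proof (cases "j = k")
        case True
        have m: "(\<lambda>w. (beta k w)\<^sup>2) \<in> borel_measurable (G (real k * h))" using beta_m by measurable
        show ?thesis using agree[OF m] last True by (simp add: trunc_def)
      qed (use False in \<open>simp add: trunc_def\<close>)
    qed
    then show "integrable S.Q (\<lambda>w. (trunc (Suc k) j w)\<^sup>2)" "(LINT w|S.Q. (trunc (Suc k) j w)\<^sup>2) \<le> (if j < Suc k then e j else 0)"
      by auto
  next
    have "(\<Sum>j<N. (if j < Suc k then e j else 0) * h) = (\<Sum>j<N. if j \<in> {..<Suc k} then e j * h else 0)"
      by (intro sum.cong) auto
    also have "\<dots> = (\<Sum>j<Suc k. e j * h)"
      using Suc.prems by (subst sum.inter_restrict[symmetric], simp) (rule sum.cong, auto)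
    finally show "(\<Sum>j<N. (if j < Suc k then e j else 0) * h) \<le> (\<Sum>j<Suc k. e j * h)" by simp
  qed
qed

definition c :: real where "c = a * exp (a * T)"

lemma e_le_c: "j < N \<Longrightarrow> e j \<le> c"
proof -
  assume j: "j < N"
  have "(1 + a * h) ^ j \<le> (1 + a * h) ^ N"
    using j a_nonneg h_pos by (intro power_increasing) auto
  also have "\<dots> \<le> (exp (a * h)) ^ N"
    using a_nonneg h_pos by (intro power_mono exp_ge_add_one_self) auto
  also have "\<dots> = exp (a * T)"
  proof -
    have "real N * (a * h) = a * T" using Nh by (metis mult.left_commute)
    then show ?thesis by (simp only: exp_of_nat_mult[symmetric])
  qed
  finally show "e j \<le> c" unfolding e_def c_def using a_nonneg by (intro mult_left_mono)
qed

lemma scheme_step: "mckean_step P W T b C h N (trunc N) (\<lambda>_. c) (c * T)"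
proof -
  interpret F: mckean_step P W T b x C h N "trunc N" "\<lambda>j. if j < N then e j else 0" "\<Sum>j<N. e j * h"
    by (rule stage) simp
  show ?thesis
  proof unfold_locales
    fix j assume j: "j < N"
    show "integrable F.Q (\<lambda>w. (trunc N j w)\<^sup>2)" by (rule F.\<beta>_square(1)[OF j])
    show "(LINT w|F.Q. (trunc N j w)\<^sup>2) \<le> c" using F.\<beta>_square(2)[OF j] e_le_c[OF j] j by simp
  next
    have "(\<Sum>j<N. c * h) = c * (real N * h)" by simp
    then show "(\<Sum>j<N. c * h) \<le> c * T" by (simp only: Nh order_refl)
  qed
qed

lemma scheme_zero: "trunc N 0 w = 0"
  using N_pos by (simp add: trunc_def beta_eq next_drift_def)

lemma scheme_Suc:
  assumes "Suc k < N"
  shows "trunc N (Suc k) w = (LBINT s:{real k * h..real (Suc k) * h}. b s (X s w) (distr (step_drift.Q P W T h N (trunc N)) borel (X s))) / h"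
proof -
  interpret F: mckean_step P W T b x C h N "trunc N" "\<lambda>_. c" "c * T" by (rule scheme_step)
  interpret K: mckean_step P W T b x C h N "trunc (Suc k)" "\<lambda>j. if j < Suc k then e j else 0" "\<Sum>j<Suc k. e j * h"
    using assms by (intro stage) simp
  have "real (Suc k) * h \<le> real N * h" using assms h_pos by (intro mult_right_mono) auto
  then have kT: "real (Suc k) * h \<le> T" using Nh by simp
  have "distr K.Q borel (X s) = distr F.Q borel (X s)" if s: "s \<in> {real k * h..real (Suc k) * h}" for s
  proof (rule F.distr_agree[OF K.step_drift_axioms])
    show "trunc (Suc k) j = trunc N j" if "j < Suc k" for j using that assms by (simp add: trunc_def)
    have "0 \<le> real k * h" using h_pos by simp
    then show "0 \<le> s" "s \<le> real (Suc k) * h" "s \<le> T" using s kT by auto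
    then show "X s \<in> borel_measurable (G s)" by (intro X_measurable_G) auto
  qed
  then have "(LBINT s:{real k * h..real (Suc k) * h}. b s (X s w) (distr K.Q borel (X s)))
    = (LBINT s:{real k * h..real (Suc k) * h}. b s (X s w) (distr F.Q borel (X s)))"
    by (intro set_lebesgue_integral_cong) auto
  then show ?thesis using assms by (simp add: trunc_def[of N] beta_eq next_drift_def)
qed

end

text \<open>
  The completed scheme: bounds that do not depend on \<open>N\<close>, and drifts given by averages under the final
  measure.
\<close>

locale euler = mckean_step P W T b x C h N \<beta> "\<lambda>_. c" "c * T"
  for P :: "'w measure" and W T b x C h N \<beta> c +
  assumes \<beta>_zero: "\<And>w. \<beta> 0 w = 0"
    and \<beta>_Suc: "\<And>k w. Suc k < N \<Longrightarrow> \<beta> (Suc k) w = (LBINT s:{real k * h..real (Suc k) * h}. b s (X s w) (law s)) / h"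
begin

text \<open>
  The averages over successive intervals telescope, with a delay of one interval.
\<close>

lemma drift_delayed:
  assumes w: "w \<in> space P" and k: "Suc k \<le> N"
  shows "drift (\<tau> (Suc k)) w = (LBINT s:{0..\<tau> k}. b s (X s w) (law s))"
  using k
proof (induction k)
  case 0
  have "drift (\<tau> (Suc 0)) w = drift (\<tau> 0) w + \<beta> 0 w * (\<tau> (Suc 0) - \<tau> 0)"
    using 0 h_pos by (intro drift_one_step) auto
  moreover have "(LBINT s:{0..0}. b s (X s w) (law s)) = 0" by (rule set_integral_point)
  ultimately show ?case by (simp add: \<beta>_zero drift_zero)
next
  case (Suc k)
  have kT: "\<tau> (Suc k) \<le> T" using Suc.prems \<tau>_mono[of "Suc k" N] Nh by simp
  have "drift (\<tau> (Suc (Suc k))) w = drift (\<tau> (Suc k)) w + \<beta> (Suc k) w * (\<tau> (Suc (Suc k)) - \<tau> (Suc k))"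
    using Suc.prems \<tau>_mono[of "Suc k" "Suc (Suc k)"] by (intro drift_one_step) auto
  also have "\<tau> (Suc (Suc k)) - \<tau> (Suc k) = h" by (simp add: algebra_simps)
  also have "\<beta> (Suc k) w * h = (LBINT s:{\<tau> k..\<tau> (Suc k)}. b s (X s w) (law s))"
    using \<beta>_Suc[of k w] Suc.prems h_pos by simp
  also have "drift (\<tau> (Suc k)) w = (LBINT s:{0..\<tau> k}. b s (X s w) (law s))" using Suc by simp
  finally show ?case
    using set_integral_interval_add[OF flow_drift_integrable[OF flow_law w order_refl kT], of "\<tau> k"]
      \<tau>_nonneg[of k] \<tau>_mono[of k "Suc k"] by simp
qed

text \<open>
  By the telescoping, the accumulated drift and the integral differ by contributions of at most one
  interval of the scheme and two intervals of the integral; on all of them the integrand is bounded.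
\<close>

lemma drift_close:
  assumes w: "w \<in> space P" and t: "t \<in> {0..T}" and L: "\<And>s. s \<in> {0..T} \<Longrightarrow> \<bar>X s w\<bar> \<le> L"
  shows "\<bar>drift t w - (LBINT s:{0..t}. b s (X s w) (law s))\<bar> \<le> 3 * h * (C * (1 + L + (1 + V)))"
proof -
  let ?M = "C * (1 + L + (1 + V))"
  let ?f = "\<lambda>s. b s (X s w) (law s)"
  have bd: "\<bar>?f s\<bar> \<le> ?M" if "s \<in> {0..T}" for s by (rule flow_drift_bound[OF flow_law that L[OF that]])
  have M0: "?M \<ge> 0" using bd[of 0] T_pos abs_ge_zero[of "?f 0"] by (auto simp del: abs_ge_zero)
  have int: "\<bar>LBINT s:{u..v}. ?f s\<bar> \<le> ?M * (v - u)" if "0 \<le> u" "u \<le> v" "v \<le> T" for u v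
    using that bd by (intro abs_set_integral_le flow_drift_integrable[OF flow_law w]) auto
  show ?thesis
  proof (cases "t = 0")
    case True
    then show ?thesis using int[of 0 0] T_pos M0 h_pos by (simp add: drift_zero)
  next
    case False
    then have "0 < t" "t \<le> \<tau> N" using t Nh by auto
    then obtain j where j: "j < N" "\<tau> j < t" "t \<le> \<tau> (Suc j)" by (rule grid_cases)
    have tj: "t - \<tau> j \<le> h" using j(3) by (simp add: algebra_simps)
    have one: "drift t w = drift (\<tau> j) w + \<beta> j w * (t - \<tau> j)"
      using j by (intro drift_one_step) auto
    show ?thesis
    proof (cases j)
      case 0
      have "\<bar>LBINT s:{0..t}. ?f s\<bar> \<le> ?M * (t - 0)" using t by (intro int) auto
      also have "\<dots> \<le> ?M * (3 * h)" using tj 0 h_pos M0 by (intro mult_left_mono) auto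
      finally show ?thesis using one 0 by (simp add: \<beta>_zero drift_zero mult_ac)
    next
      case (Suc k)
      have d: "drift (\<tau> j) w = (LBINT s:{0..\<tau> k}. ?f s)"
        using drift_delayed[OF w, of k] j Suc by simp
      have kt: "\<tau> k \<le> t" "t - \<tau> k \<le> 2 * h" using j Suc tj h_pos by (auto simp: algebra_simps)
      have split: "(LBINT s:{0..t}. ?f s) = (LBINT s:{0..\<tau> k}. ?f s) + (LBINT s:{\<tau> k..t}. ?f s)"
        using t kt \<tau>_nonneg[of k] by (intro set_integral_interval_add flow_drift_integrable[OF flow_law w]) auto
      have jT: "\<tau> j \<le> T" using j(2) t by simp
      have "\<bar>\<beta> j w\<bar> * h = \<bar>LBINT s:{\<tau> k..\<tau> j}. ?f s\<bar>"
        using \<beta>_Suc[of k w] j Suc h_pos by (simp add: abs_mult)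
      also have "\<dots> \<le> ?M * (\<tau> j - \<tau> k)"
        using jT Suc \<tau>_nonneg[of k] \<tau>_mono[of k j] by (intro int) auto
      also have "\<tau> j - \<tau> k = h" using Suc by (simp add: algebra_simps)
      finally have \<beta>M: "\<bar>\<beta> j w\<bar> \<le> ?M" using h_pos by simp
      have "\<bar>\<beta> j w * (t - \<tau> j)\<bar> \<le> ?M * h"
        unfolding abs_mult using \<beta>M tj j(2) M0 by (intro mult_mono) auto
      moreover have "\<bar>LBINT s:{\<tau> k..t}. ?f s\<bar> \<le> ?M * (2 * h)"
      proof -
        have "\<bar>LBINT s:{\<tau> k..t}. ?f s\<bar> \<le> ?M * (t - \<tau> k)" using kt t \<tau>_nonneg[of k] by (intro int) auto
        also have "\<dots> \<le> ?M * (2 * h)" using kt M0 by (intro mult_left_mono) auto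
        finally show ?thesis .
      qed
      ultimately have "\<bar>drift t w - (LBINT s:{0..t}. ?f s)\<bar> \<le> ?M * h + ?M * (2 * h)"
        unfolding one d split by linarith
      then show ?thesis by (simp add: algebra_simps)
    qed
  qed
qed

end

section \<open>Passage to the limit\<close>

lemma (in mckean_scheme) euler_scheme: "euler P W T b x C h N (trunc N) c"
proof -
  interpret F: mckean_step P W T b x C h N "trunc N" "\<lambda>_. c" "c * T" by (rule scheme_step)
  show ?thesis
    by unfold_locales (simp_all only: scheme_zero scheme_Suc F.law_def)
qed

context mckean
begin

lemma integral_drift_tendsto:
  assumes m: "\<And>n. flow (m n) K" "flow \<mu> K'" and conv: "\<And>s. s \<in> {0..T} \<Longrightarrow> (\<lambda>n. kantorovich (m n s) (\<mu> s)) \<longlonglongrightarrow> 0"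
    and w: "w \<in> space P" and t: "t \<in> {0..T}"
  shows "(\<lambda>n. LBINT s:{0..t}. b s (X s w) (m n s)) \<longlonglongrightarrow> (LBINT s:{0..t}. b s (X s w) (\<mu> s))"
  unfolding set_lebesgue_integral_def
proof -
  obtain L where L: "\<And>s. s \<in> {0..T} \<Longrightarrow> \<bar>X s w\<bar> \<le> L" "L \<ge> 0" using X_bounded[OF w] by blast
  show "(\<lambda>n. LBINT s. indicator {0..t} s *\<^sub>R b s (X s w) (m n s)) \<longlonglongrightarrow> (LBINT s. indicator {0..t} s *\<^sub>R b s (X s w) (\<mu> s))"
  proof (rule integral_dominated_convergence[where w="\<lambda>s. C * (1 + L + K) * indicator {0..t} s"])
    have "set_integrable lborel {0..t} (\<lambda>s. b s (X s w) (\<mu> s))" "set_integrable lborel {0..t} (\<lambda>s. b s (X s w) (m n s))" for n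
      using t by (auto intro!: flow_drift_integrable[OF m(1) w] flow_drift_integrable[OF m(2) w])
    then show "(\<lambda>s. indicator {0..t} s *\<^sub>R b s (X s w) (\<mu> s)) \<in> borel_measurable lborel"
      "(\<lambda>s. indicator {0..t} s *\<^sub>R b s (X s w) (m n s)) \<in> borel_measurable lborel" for n
      unfolding set_integrable_def by (auto intro: borel_measurable_integrable)
    show "integrable lborel (\<lambda>s. C * (1 + L + K) * indicator {0..t} s)"
      by (intro integrable_mult_right integrable_real_indicator) (auto simp: emeasure_lborel_Icc_eq)
    have "norm (indicator {0..t} s *\<^sub>R b s (X s w) (m n s)) \<le> C * (1 + L + K) * indicator {0..t} s" for n s
      using flow_drift_bound[OF m(1)[of n] _ L(1), of s] t by (auto split: split_indicator)
    then show "AE s in lborel. norm (indicator {0..t} s *\<^sub>R b s (X s w) (m n s)) \<le> C * (1 + L + K) * indicator {0..t} s" for n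
      by simp
    have "(\<lambda>n. b s (X s w) (m n s)) \<longlonglongrightarrow> b s (X s w) (\<mu> s)" if s: "s \<in> {0..T}" for s
    proof (rule LIMSEQ_I)
      fix \<epsilon> :: real assume "\<epsilon> > 0"
      have P: "\<mu> s \<in> P1" "m n s \<in> P1" for n using m s by (auto simp: flow_def)
      obtain \<delta> where \<delta>: "\<delta> > 0" "\<And>\<nu>. \<nu> \<in> P1 \<Longrightarrow> kantorovich (\<mu> s) \<nu> < \<delta> \<Longrightarrow> \<bar>b s (X s w) (\<mu> s) - b s (X s w) \<nu>\<bar> < \<epsilon>"
        using b_continuous[OF P(1) \<open>\<epsilon> > 0\<close>] s by blast
      obtain n0 where "\<And>n. n \<ge> n0 \<Longrightarrow> kantorovich (m n s) (\<mu> s) < \<delta>"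
        using LIMSEQ_zero_eventually_less[OF conv[OF s] \<delta>(1)] by blast
      then have "norm (b s (X s w) (m n s) - b s (X s w) (\<mu> s)) < \<epsilon>" if "n \<ge> n0" for n
        using \<delta>(2)[OF P(2)[of n]] that by (simp add: P1.commute abs_minus_commute)
      then show "\<exists>no. \<forall>n\<ge>no. norm (b s (X s w) (m n s) - b s (X s w) (\<mu> s)) < \<epsilon>" by blast
    qed
    then show "AE s in lborel. (\<lambda>n. indicator {0..t} s *\<^sub>R b s (X s w) (m n s)) \<longlonglongrightarrow> indicator {0..t} s *\<^sub>R b s (X s w) (\<mu> s)"
      using t by (intro AE_I2) (auto split: split_indicator)
  qed
qed

text \<open>
  The Brownian motion that has to drive \<open>X\<close> if \<open>R\<close> is to be the law of a solution.
\<close>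

definition noise :: "'w measure \<Rightarrow> real \<Rightarrow> 'w \<Rightarrow> real" where
  "noise R t w = W t w - (LBINT s:{0..t}. b s (X s w) (distr R borel (X s)))"

definition solution_law :: "'w measure \<Rightarrow> bool" where
  "solution_law R \<longleftrightarrow> prob_space R \<and> sets R = sets P \<and> (\<exists>K. flow (\<lambda>s. distr R borel (X s)) K) \<and>
     (\<forall>s t u. \<forall>A\<in>sets (G s). 0 \<le> s \<longrightarrow> s \<le> t \<longrightarrow> t \<le> T \<longrightarrow>
       (CLINT w|R. indicator A w * iexp (u * (noise R t w - noise R s w))) = measure R A * exp (- (u\<^sup>2 * (t - s)) / 2))"

text \<open>
  Along a setwise convergent subsequence the laws converge in the Kantorovich distance, hence the drifts
  converge on every path, first with the limiting laws inserted and then, by \<open>drift_close\<close>, for the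
  scheme itself. The characterisation of Brownian motion passes to the limit as an integral of bounded
  functions that converge pointwise.
\<close>

lemma solution_law_exists:
  assumes E: "countable E" "Int_stable E" "E \<subseteq> Pow (space P)" "sets P = sigma_sets (space P) E"
  shows "\<exists>R. solution_law R"
proof -
  interpret S: mckean_scheme P W T b x C "Suc n" for n by unfold_locales simp
  interpret E: euler P W T b x C "S.h n" "Suc n" "S.trunc n (Suc n)" S.c for n by (rule S.euler_scheme)
  define Q where "Q n = E.Q n" for n
  define V where "V = 3 * (x\<^sup>2 + T + T * (S.c * T))"
  have EV: "E.V = V" by (simp add: E.V_def V_def)
  have c0: "S.c \<ge> 0" using S.a_nonneg by (simp add: S.c_def)
  have Qp: "prob_space (Q n)" "sets (Q n) = sets P" for n unfolding Q_def using E.prob_space_Q by auto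
  have uac: "unif_abs_cont P Q"
    unfolding unif_abs_cont_def
  proof (intro allI impI)
    fix \<epsilon> :: real assume e: "\<epsilon> > 0"
    \<comment> \<open>Each of the three terms of the estimate is made at most \<open>\<epsilon> / 3\<close>, in the order \<open>L\<close>, \<open>K\<close>, \<open>\<delta>\<close>.\<close>
    define L where "L = 3 * S.c * T / \<epsilon> + 1"
    define K where "K = 3 * exp L / \<epsilon>"
    define \<delta> where "\<delta> = \<epsilon> / (3 * K)"
    have L: "L > 0"
      unfolding L_def using e c0 T_pos by (intro add_nonneg_pos divide_nonneg_pos mult_nonneg_nonneg) auto
    have "\<epsilon> / 3 * L = S.c * T + \<epsilon> / 3" using e by (simp add: L_def field_simps)
    then have "S.c * T \<le> \<epsilon> / 3 * L" using e by simp
    then have L': "S.c * T / L \<le> \<epsilon> / 3" using L by (simp add: pos_divide_le_eq)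
    have K: "K > 0" "exp L / K = \<epsilon> / 3" using e by (auto simp: K_def)
    have \<delta>: "\<delta> > 0" "K * \<delta> = \<epsilon> / 3" using e K by (auto simp: \<delta>_def)
    have "measure (Q n) A < \<epsilon>" if "A \<in> sets P" "measure P A < \<delta>" for n A
    proof -
      have "measure (Q n) A \<le> S.c * T / L + K * measure P A + exp L / K"
        unfolding Q_def by (rule E.uniform_continuity_estimate[OF that(1) L K(1) E.\<beta>_square])
      also have "K * measure P A < K * \<delta>" using that K by simp
      finally show ?thesis using L' K \<delta> by linarith
    qed
    then show "\<exists>\<delta>>0. \<forall>n. \<forall>A\<in>sets P. measure P A < \<delta> \<longrightarrow> measure (Q n) A < \<epsilon>"
      using \<delta>(1) by blast
  qed
  obtain r R where r: "strict_mono r" and R: "prob_space R" "sets R = sets P"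
    and conv: "\<And>A. A \<in> sets P \<Longrightarrow> (\<lambda>n. measure (Q (r n)) A) \<longlonglongrightarrow> measure R A"
    using setwise_compactness[OF prob_space_axioms Qp E uac] by blast
  interpret R: prob_space R by fact
  have mR[measurable_cong]: "sets R = sets P" by fact
  have spR: "space R = space P" using R(2) by (rule sets_eq_imp_space_eq)
  have spQ: "space (Q n) = space P" for n using Qp(2) by (rule sets_eq_imp_space_eq)
  have uac_r: "unif_abs_cont P (\<lambda>n. Q (r n))" using uac unfolding unif_abs_cont_def by blast
  define m where "m n s = E.law (r n) s" for n s
  define \<mu> where "\<mu> s = distr R borel (X s)" for s
  have m_eq: "m n s = distr (Q (r n)) borel (X s)" for n s by (simp add: m_def E.law_def Q_def)
  have sqQ: "integrable (Q n) (\<lambda>w. (X s w)\<^sup>2)" "(LINT w|Q n. (X s w)\<^sup>2) \<le> V" if "s \<in> {0..T}" for n s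
    using E.X_square[OF that] unfolding Q_def EV by auto
  have sqR: "integrable R (\<lambda>w. (X s w)\<^sup>2)" "(LINT w|R. (X s w)\<^sup>2) \<le> V" if s: "s \<in> {0..T}" for s
    by (rule setwise_integral_le[where Q="\<lambda>n. Q (r n)" and v=V]; use Qp R conv sqQ[OF s] in simp)+
  have XR: "integrable R (X s)" if "s \<in> {0..T}" for s
    by (rule Bochner_Integration.integrable_bound[of _ "\<lambda>w. 1 + (X s w)\<^sup>2"])
      (use sqR[OF that] abs_le_one_plus_square in \<open>auto simp: add_nonneg_nonneg\<close>)
  have \<mu>P1: "\<mu> s \<in> P1" if "s \<in> {0..T}" for s
    unfolding \<mu>_def using XR[OF that] by (subst R.distr_in_P1_iff) auto
  have mP1: "m n s \<in> P1" if "s \<in> {0..T}" for n s unfolding m_def by (rule E.law_P1[OF that])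
  have Kconv: "(\<lambda>n. kantorovich (m n s) (\<mu> s)) \<longlonglongrightarrow> 0" if s: "s \<in> {0..T}" for s
  proof (rule kantorovich_tendsto_of_setwise[where c=V])
    show "prob_space (m n s)" "prob_space (\<mu> s)" for n using mP1[OF s] \<mu>P1[OF s] by (auto dest: P1_D)
    show "sets (m n s) = sets borel" "sets (\<mu> s) = sets borel" for n by (simp_all add: m_eq \<mu>_def)
    have Xm: "X s \<in> borel_measurable (Q n)" for n by (subst measurable_cong_sets[OF Qp(2) refl]) (rule X_measurable)
    fix D :: "real set" assume D: "D \<in> sets borel"
    have "measure (m n s) D = measure (Q (r n)) (X s -` D \<inter> space P)" for n
      unfolding m_eq using Xm D spQ by (subst measure_distr) auto
    moreover have "measure (\<mu> s) D = measure R (X s -` D \<inter> space P)"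
      unfolding \<mu>_def using D spR by (subst measure_distr) auto
    ultimately show "(\<lambda>n. measure (m n s) D) \<longlonglongrightarrow> measure (\<mu> s) D"
      using conv[of "X s -` D \<inter> space P"] D by simp
  next
    have Xm: "X s \<in> borel_measurable (Q n)" for n by (subst measurable_cong_sets[OF Qp(2) refl]) (rule X_measurable)
    show "integrable (m n s) (\<lambda>y. y\<^sup>2)" "(LINT y|m n s. y\<^sup>2) \<le> V" for n
      unfolding m_eq using sqQ[OF s, of "r n"] Xm by (simp_all add: integrable_distr_eq integral_distr)
    show "integrable (\<mu> s) (\<lambda>y. y\<^sup>2)" "(LINT y|\<mu> s. y\<^sup>2) \<le> V"
      unfolding \<mu>_def using sqR[OF s] by (simp_all add: integrable_distr_eq integral_distr)
  qed
  have flow_m: "flow (m n) (1 + V)" for n unfolding m_def[abs_def] EV[symmetric] by (rule E.flow_law)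
  have flow_\<mu>: "flow \<mu> (1 + V)"
    unfolding flow_def
  proof (intro conjI ballI \<mu>P1 continuous_map_P1I)
    fix s t :: real assume st: "0 \<le> s" "s \<le> t" "t \<le> T"
    then have s: "s \<in> {0..T}" and t: "t \<in> {0..T}" by auto
    have le: "kantorovich (\<mu> s) (\<mu> t) \<le> kantorovich (m n s) (\<mu> s) + (sqrt (t - s) + (1 + S.c) * (t - s)) + kantorovich (m n t) (\<mu> t)" for n
    proof -
      have "kantorovich (\<mu> s) (\<mu> t) \<le> kantorovich (\<mu> s) (m n s) + kantorovich (m n s) (\<mu> t)"
        using \<mu>P1 mP1 s t by (intro P1.triangle) auto
      also have "kantorovich (m n s) (\<mu> t) \<le> kantorovich (m n s) (m n t) + kantorovich (m n t) (\<mu> t)"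
        using \<mu>P1 mP1 s t by (intro P1.triangle) auto
      also have "kantorovich (m n s) (m n t) \<le> sqrt (t - s) + (1 + S.c) * (t - s)"
        unfolding m_def using E.law_increment[OF st order_refl] .
      finally show ?thesis by (simp add: P1.commute)
    qed
    have "(\<lambda>n. kantorovich (m n s) (\<mu> s) + (sqrt (t - s) + (1 + S.c) * (t - s)) + kantorovich (m n t) (\<mu> t))
        \<longlonglongrightarrow> 0 + (sqrt (t - s) + (1 + S.c) * (t - s)) + 0"
      by (intro tendsto_add Kconv s t tendsto_const)
    then show "kantorovich (\<mu> s) (\<mu> t) \<le> sqrt (t - s) + (1 + S.c) * (t - s)"
      using le by (intro LIMSEQ_le_const[where X="\<lambda>n. kantorovich (m n s) (\<mu> s) + (sqrt (t - s) + (1 + S.c) * (t - s)) + kantorovich (m n t) (\<mu> t)"]) auto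
  next
    fix s assume s: "s \<in> {0..T}"
    have "kantorovich (\<mu> s) (return borel 0) \<le> (LINT y|\<mu> s. \<bar>y\<bar>)" by (rule kantorovich_dirac_le[OF \<mu>P1[OF s]])
    also have "\<dots> = (LINT w|R. \<bar>X s w\<bar>)" unfolding \<mu>_def by (subst integral_distr) auto
    also have "\<dots> \<le> (LINT w|R. 1 + (X s w)\<^sup>2)"
      using XR[OF s] sqR[OF s] abs_le_one_plus_square by (intro integral_mono) auto
    also have "\<dots> \<le> 1 + V" using sqR[OF s] by (simp add: R.prob_space)
    finally show "kantorovich (\<mu> s) (return borel 0) \<le> 1 + V" .
  qed
  define I where "I t w = (LBINT s:{0..t}. b s (X s w) (\<mu> s))" for t w
  have I_m: "I t \<in> borel_measurable P" if "t \<in> {0..T}" for t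
    unfolding I_def using that by (intro measurable_from_G[of _ t] flow_drift_integral_measurable[OF flow_\<mu>]) auto
  have h_lim: "(\<lambda>n. S.h (r n)) \<longlonglongrightarrow> 0"
  proof -
    have "(\<lambda>n. T / real (Suc n)) \<longlonglongrightarrow> 0"
      using LIMSEQ_Suc[OF lim_const_over_n[of T]] by simp
    from LIMSEQ_subseq_LIMSEQ[OF this r] show ?thesis by (simp add: S.h_def o_def)
  qed
  have drift_lim: "(\<lambda>n. E.drift (r n) t w) \<longlonglongrightarrow> I t w" if w: "w \<in> space P" and t: "t \<in> {0..T}" for t w
  proof -
    obtain L where L: "\<And>s. s \<in> {0..T} \<Longrightarrow> \<bar>X s w\<bar> \<le> L" "L \<ge> 0" using X_bounded[OF w] by blast
    let ?J = "\<lambda>n. LBINT s:{0..t}. b s (X s w) (m n s)"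
    have 1: "?J \<longlonglongrightarrow> I t w"
      unfolding I_def by (rule integral_drift_tendsto[OF flow_m flow_\<mu> Kconv w t])
    have 2: "(\<lambda>n. E.drift (r n) t w - ?J n) \<longlonglongrightarrow> 0"
    proof (rule Lim_null_comparison)
      show "\<forall>\<^sub>F n in sequentially. norm (E.drift (r n) t w - ?J n) \<le> 3 * S.h (r n) * (C * (1 + L + (1 + V)))"
        using E.drift_close[OF w t L(1)] unfolding m_def EV by (intro always_eventually) auto
      show "(\<lambda>n. 3 * S.h (r n) * (C * (1 + L + (1 + V)))) \<longlonglongrightarrow> 0"
        using tendsto_mult_left[OF h_lim, of 3] by (intro tendsto_mult_left_zero) simp
    qed
    show ?thesis using tendsto_add[OF 1 2] by simp
  qed
  have noise_eq: "noise R t w = W t w - I t w" for t w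
    by (simp add: noise_def I_def \<mu>_def)
  have "solution_law R"
    unfolding solution_law_def
  proof (intro conjI allI ballI impI)
    show "prob_space R" "sets R = sets P" by (fact R)+
    show "\<exists>K. flow (\<lambda>s. distr R borel (X s)) K" using flow_\<mu> unfolding \<mu>_def[abs_def] by blast
    fix s t u A assume A: "A \<in> sets (G s)" and st: "0 \<le> s" "s \<le> t" "t \<le> T"
    then have s: "s \<in> {0..T}" and t: "t \<in> {0..T}" by auto
    have AP: "A \<in> sets P" using A subalgebra_G by (auto simp: subalgebra_def)
    let ?B = "\<lambda>n. E.B (r n)"
    let ?Y = "\<lambda>t w. W t w - I t w"
    have lim1: "(\<lambda>n. CLINT w|Q (r n). indicator A w * iexp (u * (?B n t w - ?B n s w)))
       \<longlonglongrightarrow> (CLINT w|R. indicator A w * iexp (u * (?Y t w - ?Y s w)))"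
    proof (rule setwise_tendsto_integral_varying[OF prob_space_axioms Qp R uac_r conv, where K=1])
      show "(\<lambda>w. indicator A w * iexp (u * (?B n t w - ?B n s w))) \<in> borel_measurable P" for n
        using AP by measurable
      show "(\<lambda>w. indicator A w * iexp (u * (?Y t w - ?Y s w))) \<in> borel_measurable P"
        using AP I_m[OF s] I_m[OF t] by measurable
      show "norm (indicator A w * iexp (u * (?B n t w - ?B n s w))) \<le> 1" for n w
        by (simp add: norm_mult split: split_indicator)
      fix w assume w: "w \<in> space P"
      show "(\<lambda>n. indicator A w * iexp (u * (?B n t w - ?B n s w))) \<longlonglongrightarrow> indicator A w * iexp (u * (?Y t w - ?Y s w))"
        unfolding E.B_def
        by (intro tendsto_mult tendsto_const tendsto_exp tendsto_of_real tendsto_diff drift_lim w s t)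
    qed
    have eq: "(CLINT w|Q (r n). indicator A w * iexp (u * (?B n t w - ?B n s w))) = measure (Q (r n)) A * exp (- (u\<^sup>2 * (t - s)) / 2)" for n
      unfolding Q_def by (rule E.char_B_increment[OF st A])
    have "(\<lambda>n. complex_of_real (measure (Q (r n)) A * exp (- (u\<^sup>2 * (t - s)) / 2))) \<longlonglongrightarrow> complex_of_real (measure R A * exp (- (u\<^sup>2 * (t - s)) / 2))"
      by (intro tendsto_of_real tendsto_mult tendsto_const conv AP)
    from LIMSEQ_unique[OF lim1[unfolded eq] this]
    show "(CLINT w|R. indicator A w * iexp (u * (noise R t w - noise R s w))) = measure R A * exp (- (u\<^sup>2 * (t - s)) / 2)"
      unfolding noise_eq .
  qed
  then show ?thesis by blast
qed

end

section \<open>The augmented filtration and existence\<close>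

text \<open>
  Agreement up to a null set with an event of \<open>G v\<close> for all \<open>v > t\<close> adds the null sets and takes the
  right limit in one step.
\<close>

definition augmented :: "'w measure \<Rightarrow> (real \<Rightarrow> 'w measure) \<Rightarrow> real \<Rightarrow> 'w measure" where
  "augmented M G t = sigma (space M) {A \<in> sets M. \<forall>v>t. \<exists>A'\<in>sets (G v). (A - A') \<union> (A' - A) \<in> null_sets M}"

lemma sets_augmented:
  assumes M: "complete_measure M" and G: "\<And>v. subalgebra M (G v)"
  shows "sets (augmented M G t) = {A \<in> sets M. \<forall>v>t. \<exists>A'\<in>sets (G v). (A - A') \<union> (A' - A) \<in> null_sets M}" (is "_ = ?A")
proof -
  interpret complete_measure M by fact
  have "sigma_algebra (space M) ?A"
    unfolding sigma_algebra_iff2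
  proof (intro conjI ballI allI impI)
    show "?A \<subseteq> Pow (space M)" using sets.sets_into_space by auto
    show "{} \<in> ?A" by (auto intro!: bexI[of _ "{}"])
  next
    fix s assume s: "s \<in> ?A"
    show "space M - s \<in> ?A"
    proof (safe)
      show "space M - s \<in> sets M" using s by auto
      fix v assume "v > t"
      then obtain A' where A': "A' \<in> sets (G v)" "(s - A') \<union> (A' - s) \<in> null_sets M" using s by blast
      have sp: "space (G v) = space M" using G by (auto simp: subalgebra_def)
      have "A' \<subseteq> space M" using sets.sets_into_space[OF A'(1)] sp by simp
      moreover have "s \<subseteq> space M" using s sets.sets_into_space by auto
      ultimately have "((space M - s) - (space M - A')) \<union> ((space M - A') - (space M - s)) = (s - A') \<union> (A' - s)" by auto
      then show "\<exists>A'\<in>sets (G v). ((space M - s) - A') \<union> (A' - (space M - s)) \<in> null_sets M"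
        using A' sp sets.compl_sets[OF A'(1)] by (intro bexI[of _ "space M - A'"]) auto
    qed
  next
    fix A :: "nat \<Rightarrow> 'a set" assume A: "range A \<subseteq> ?A"
    show "(\<Union>i. A i) \<in> ?A"
    proof (safe)
      show "(\<Union>i. A i) \<in> sets M" using A by auto
      fix v assume v: "v > t"
      have "\<forall>i. \<exists>A'\<in>sets (G v). (A i - A') \<union> (A' - A i) \<in> null_sets M" using A v by blast
      then obtain A' where A': "\<And>i. A' i \<in> sets (G v)" "\<And>i. (A i - A' i) \<union> (A' i - A i) \<in> null_sets M" by metis
      have "(\<Union>i. (A i - A' i) \<union> (A' i - A i)) \<in> null_sets M" using A'(2) by (rule null_sets_UN)
      then have "((\<Union>i. A i) - (\<Union>i. A' i)) \<union> ((\<Union>i. A' i) - (\<Union>i. A i)) \<in> null_sets M"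
        by (rule complete2[rotated]) auto
      then show "\<exists>A'\<in>sets (G v). ((\<Union>i. A i) - A') \<union> (A' - (\<Union>i. A i)) \<in> null_sets M"
        using A'(1) by (intro bexI[of _ "\<Union>i. A' i"]) auto
    qed
  qed
  then show ?thesis
    unfolding augmented_def by (rule sigma_algebra.sets_measure_of_eq)
qed

lemma space_augmented[simp]: "space (augmented M G t) = space M"
  unfolding augmented_def by (rule space_measure_of) (use sets.sets_into_space in auto)

lemma usual_filtration_augmented:
  assumes M: "complete_measure M" and G: "\<And>v. subalgebra M (G v)"
  shows "usual_filtration T M (augmented M G)"
proof -
  note S = sets_augmented[OF M G]
  show ?thesis
    unfolding usual_filtration_def
  proof (intro conjI ballI impI)
    show "subalgebra M (augmented M G t)" for t unfolding subalgebra_def S by auto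
    show "sets (augmented M G s) \<subseteq> sets (augmented M G t)" if "s \<le> t" for s t unfolding S using that by auto
    fix t assume t: "t \<in> {0..<T}"
    show "sets (augmented M G t) = (\<Inter>u\<in>{t<..T}. sets (augmented M G u))"
    proof (intro equalityI subsetI)
      fix A assume A: "A \<in> (\<Inter>u\<in>{t<..T}. sets (augmented M G u))"
      then have "A \<in> sets (augmented M G T)" using t by auto
      then have "A \<in> sets M" unfolding S by simp
      moreover have "\<exists>A'\<in>sets (G v). (A - A') \<union> (A' - A) \<in> null_sets M" if v: "v > t" for v
      proof -
        obtain u where u: "t < u" "u < min v T" using dense[of t "min v T"] v t by auto
        then have "A \<in> sets (augmented M G u)" using A by auto
        then show ?thesis unfolding S using u by auto
      qed
      ultimately show "A \<in> sets (augmented M G t)" unfolding S by auto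
    qed (auto simp: S)
  next
    show "null_sets M \<subseteq> sets (augmented M G 0)"
      unfolding S by (auto intro!: bexI[of _ "{}"] simp: null_setsD2)
  qed
qed

lemma measurable_augmented:
  assumes M: "complete_measure M" and G: "\<And>v. subalgebra M (G v)" and mono: "\<And>u v. u \<le> v \<Longrightarrow> sets (G u) \<subseteq> sets (G v)"
    and f: "f \<in> measurable (G t) N"
  shows "f \<in> measurable (augmented M G t) N"
proof (rule measurable_from_subalg[OF _ f])
  show "subalgebra (augmented M G t) (G t)"
    unfolding subalgebra_def sets_augmented[OF M G]
  proof (intro conjI subsetI)
    show "space (G t) = space (augmented M G t)" using G[of t] by (simp add: subalgebra_def)
    fix A assume A: "A \<in> sets (G t)"
    then show "A \<in> {A \<in> sets M. \<forall>v>t. \<exists>A'\<in>sets (G v). (A - A') \<union> (A' - A) \<in> null_sets M}"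
      using G[of t] subsetD[OF mono[OF less_imp_le]] by (auto simp: subalgebra_def intro!: bexI[of _ A])
  qed
qed

context mckean
begin

lemma continuous_drift_integral:
  assumes m: "flow m K" and w: "w \<in> space P"
  shows "continuous_on {0..T} (\<lambda>t. LBINT s:{0..t}. b s (X s w) (m s))"
proof -
  obtain L where L: "\<And>s. s \<in> {0..T} \<Longrightarrow> \<bar>X s w\<bar> \<le> L" "L \<ge> 0" using X_bounded[OF w] by blast
  let ?f = "\<lambda>s. b s (X s w) (m s)" and ?M = "C * (1 + L + K)"
  have bd: "\<bar>?f s\<bar> \<le> ?M" if "s \<in> {0..T}" for s by (rule flow_drift_bound[OF m that L(1)[OF that]])
  have M0: "?M \<ge> 0" using bd[of 0] T_pos by (auto intro: order_trans[OF abs_ge_zero])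
  have inc: "\<bar>(LBINT s:{0..v}. ?f s) - (LBINT s:{0..u}. ?f s)\<bar> \<le> ?M * (v - u)" if "0 \<le> u" "u \<le> v" "v \<le> T" for u v
  proof -
    have "(LBINT s:{0..v}. ?f s) = (LBINT s:{0..u}. ?f s) + (LBINT s:{u..v}. ?f s)"
      using that by (intro set_integral_interval_add flow_drift_integrable[OF m w]) auto
    moreover have "\<bar>LBINT s:{u..v}. ?f s\<bar> \<le> ?M * (v - u)"
      using that bd by (intro abs_set_integral_le flow_drift_integrable[OF m w]) auto
    ultimately show ?thesis by simp
  qed
  have "?M-lipschitz_on {0..T} (\<lambda>t. LBINT s:{0..t}. ?f s)"
  proof (rule lipschitz_onI[OF _ M0])
    fix u v assume uv: "u \<in> {0..T}" "v \<in> {0..T}"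
    show "dist (LBINT s:{0..u}. ?f s) (LBINT s:{0..v}. ?f s) \<le> ?M * dist u v"
      using inc[of u v] inc[of v u] uv by (cases "u \<le> v") (auto simp: dist_real_def abs_minus_commute)
  qed
  then show ?thesis by (rule lipschitz_on_continuous_on)
qed

text \<open>
  An event of the augmented past of \<open>s\<close> agrees almost surely with an event of the past of each \<open>q > s\<close>.
  The characterisation of Brownian motion therefore holds with \<open>q\<close> in place of \<open>s\<close>, and path continuity
  lets \<open>q\<close> decrease to \<open>s\<close>.
\<close>

lemma weak_solution_of_solution_law:
  assumes sol: "solution_law R"
  shows "\<exists>M F B. weak_solution T b x (M :: 'w measure) F B X"
proof -
  have R: "prob_space R" "sets R = sets P" using sol by (auto simp: solution_law_def)
  obtain K where flow: "flow (\<lambda>s. distr R borel (X s)) K" using sol by (auto simp: solution_law_def)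
  interpret R: prob_space R by fact
  have mR[measurable_cong]: "sets R = sets P" by fact
  have spR: "space R = space P" using R(2) by (rule sets_eq_imp_space_eq)
  define \<mu> where "\<mu> s = distr R borel (X s)" for s
  define B where "B t w = W t w - (LBINT r:{0..t}. b r (X r w) (\<mu> r))" for t w
  have char: "(CLINT w|R. indicator A w * iexp (u * (B t w - B s w))) = measure R A * exp (- (u\<^sup>2 * (t - s)) / 2)"
    if "0 \<le> s" "s \<le> t" "t \<le> T" "A \<in> sets (G s)" for s t u A
    using sol that unfolding solution_law_def noise_def B_def \<mu>_def by blast
  \<comment> \<open>The completion supplies the null sets that the usual conditions ask for.\<close>
  define M where "M = completion R"
  have fl: "flow \<mu> K" using flow by (simp add: \<mu>_def[abs_def])
  have spM: "space M = space P" by (simp add: M_def spR)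
  have PM: "sets P \<subseteq> sets M" unfolding M_def using R(2) by auto
  interpret M: complete_measure M unfolding M_def by (rule completion.complete_measure_axioms)
  have pM: "prob_space M" unfolding M_def by (rule prob_spaceI) (simp add: R.emeasure_space_1)
  interpret M: prob_space M by fact
  have subG: "subalgebra M (G v)" for v
    using subalgebra_G[of v] PM by (auto simp: subalgebra_def spM)
  define F where "F = augmented M G"
  have measF: "f \<in> measurable (F t) N" if "f \<in> measurable (G t) N" for f t and N :: "real measure"
    unfolding F_def
    by (rule measurable_augmented[where G = G, OF M.complete_measure_axioms subG]) (rule sets_past_mono that, assumption?)+
  have usual: "usual_filtration T M F"
    unfolding F_def by (rule usual_filtration_augmented[OF M.complete_measure_axioms subG])
  have XM: "X t \<in> borel_measurable M" for t
    unfolding M_def using X_measurable[of t] by (intro measurable_completion) measurable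
  have distrM: "distr M borel (X s) = \<mu> s" for s
    unfolding M_def \<mu>_def by (rule distr_completion) measurable
  have B_G: "B t \<in> borel_measurable (G t)" if "t \<in> {0..T}" for t
    unfolding B_def using that by (intro borel_measurable_diff W_measurable_G flow_drift_integral_measurable[OF fl]) auto
  have B_P: "B t \<in> borel_measurable P" if "t \<in> {0..T}" for t by (rule measurable_from_G[OF B_G[OF that]])
  have B_R: "B t \<in> borel_measurable R" if "t \<in> {0..T}" for t
    by (subst measurable_cong_sets[OF R(2) refl]) (rule B_P[OF that])
  have B_cont: "continuous_on {0..T} (\<lambda>t. B t w)" if "w \<in> space P" for w
    unfolding B_def using W_continuous[OF that]
    by (intro continuous_on_diff continuous_drift_integral[OF fl that]) (auto intro: continuous_on_subset)
  have caB: "continuous_adapted T M F B"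
    unfolding continuous_adapted_def
  proof (intro conjI ballI)
    show "B t \<in> borel_measurable (F t)" if "t \<in> {0..T}" for t by (rule measF[OF B_G[OF that]])
    show "continuous_on {0..T} (\<lambda>t. B t w)" if "w \<in> space M" for w using B_cont that spM by simp
  qed
  have caX: "continuous_adapted T M F X"
    unfolding continuous_adapted_def
  proof (intro conjI ballI)
    show "X t \<in> borel_measurable (F t)" if "t \<in> {0..T}" for t
      using that by (intro measF X_measurable_G) auto
    show "continuous_on {0..T} (\<lambda>t. X t w)" if "w \<in> space M" for w using X_continuous that spM by simp
  qed
  have B0: "B 0 w = 0" if "w \<in> space P" for w
    unfolding B_def set_integral_point using W_zero[OF that] by simp
  have bm: "distributed M lborel (\<lambda>w. B t w - B s w) (normal_density 0 (sqrt (t - s)))"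
      "M.indep_set (sets (F s)) (sets (vimage_algebra (space M) (\<lambda>w. B t w - B s w) borel))"
    if st: "0 \<le> s" "s < t" "t \<le> T" for s t
  proof -
    have s: "s \<in> {0..T}" and t: "t \<in> {0..T}" using st by auto
    have BtP: "B t \<in> borel_measurable R" "B s \<in> borel_measurable R" by (rule B_R[OF t] B_R[OF s])+
    then have Bm: "(\<lambda>w. B t w - B s w) \<in> borel_measurable M"
      unfolding M_def by (intro measurable_completion borel_measurable_diff)
    have sub: "subalgebra M (F s)" using usual s by (auto simp: usual_filtration_def)
    have ch: "(CLINT w|M. indicator A w * iexp (u * (B t w - B s w))) = M.prob A * exp (- (u\<^sup>2 * (sqrt (t - s))\<^sup>2) / 2)"
      if A: "A \<in> sets (F s)" for A u
    proof -
      have AM: "A \<in> sets M" using A sub by (auto simp: subalgebra_def)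
      \<comment> \<open>Times in \<open>(s, t]\<close> that decrease to \<open>s\<close>.\<close>
      define q where "q n = s + (t - s) / real (Suc (Suc n))" for n
      have q: "s < q n" "q n \<le> t" for n
      proof -
        show "s < q n" using st by (simp add: q_def)
        have "(t - s) / real (Suc (Suc n)) \<le> (t - s) / 1" using st by (intro divide_left_mono) auto
        then show "q n \<le> t" by (simp add: q_def)
      qed
      have qT: "q n \<in> {0..T}" for n using q[of n] st by auto
      have q_lim: "q \<longlonglongrightarrow> s"
      proof -
        have "(\<lambda>n. (t - s) / real n) \<longlonglongrightarrow> 0" by (rule lim_const_over_n)
        from LIMSEQ_ignore_initial_segment[OF this, of 2]
        have "(\<lambda>n. s + (t - s) / real (n + 2)) \<longlonglongrightarrow> s + 0" by (intro tendsto_add tendsto_const)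
        then show ?thesis by (simp add: q_def[abs_def] add.commute)
      qed
      have eq: "(CLINT w|M. indicator A w * iexp (u * (B t w - B (q n) w))) = M.prob A * exp (- (u\<^sup>2 * (t - q n)) / 2)" for n
      proof -
        obtain A' where A': "A' \<in> sets (G (q n))" "(A - A') \<union> (A' - A) \<in> null_sets M"
          using A q[of n] unfolding F_def sets_augmented[OF M.complete_measure_axioms subG] by blast
        have A'P: "A' \<in> sets P" using A'(1) subalgebra_G by (auto simp: subalgebra_def)
        have A'M: "A' \<in> sets M" using A'P PM by auto
        have ae: "AE w in M. w \<in> A \<longleftrightarrow> w \<in> A'"
          using AE_not_in[OF A'(2)] by eventually_elim auto
        have BqP: "B (q n) \<in> borel_measurable R" by (rule B_R[OF qT])
        have m1: "(\<lambda>w. iexp (u * (B t w - B (q n) w))) \<in> borel_measurable R" using BtP BqP by measurable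
        then have m2: "(\<lambda>w. iexp (u * (B t w - B (q n) w))) \<in> borel_measurable M" unfolding M_def by (rule measurable_completion)
        have "(CLINT w|M. indicator A w * iexp (u * (B t w - B (q n) w))) = (CLINT w|M. indicator A' w * iexp (u * (B t w - B (q n) w)))"
        proof (rule integral_cong_AE)
          show "AE w in M. indicator A w * iexp (u * (B t w - B (q n) w)) = indicator A' w * iexp (u * (B t w - B (q n) w))"
            using ae by eventually_elim (auto split: split_indicator)
        qed (use AM A'M m2 in measurable)
        also have "\<dots> = (CLINT w|R. indicator A' w * iexp (u * (B t w - B (q n) w)))"
          unfolding M_def using m1 A'P R(2) by (intro integral_completion borel_measurable_times borel_measurable_indicator) auto
        also have "\<dots> = measure R A' * exp (- (u\<^sup>2 * (t - q n)) / 2)"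
          using char[OF _ q(2) st(3) A'(1), of u] qT[of n] by simp
        also have "measure R A' = M.prob A"
        proof -
          have "M.prob A = M.prob A'" by (rule M.finite_measure_eq_AE[OF ae AM A'M])
          then show ?thesis using A'P R(2) by (simp add: M_def)
        qed
        finally show ?thesis .
      qed
      have "(\<lambda>n. CLINT w|M. indicator A w * iexp (u * (B t w - B (q n) w))) \<longlonglongrightarrow> (CLINT w|M. indicator A w * iexp (u * (B t w - B s w)))"
      proof (rule integral_dominated_convergence[where w="\<lambda>_. 1"])
        have BM: "B r \<in> borel_measurable M" if "r \<in> {0..T}" for r
          unfolding M_def by (rule measurable_completion[OF B_R[OF that]])
        show "(\<lambda>w. indicator A w * iexp (u * (B t w - B s w))) \<in> borel_measurable M"
          using AM BM[OF t] BM[OF s] by measurable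
        show "(\<lambda>w. indicator A w * iexp (u * (B t w - B (q n) w))) \<in> borel_measurable M" for n
          using AM BM[OF t] BM[OF qT[of n]] by measurable
        show "AE w in M. (\<lambda>n. indicator A w * iexp (u * (B t w - B (q n) w))) \<longlonglongrightarrow> indicator A w * iexp (u * (B t w - B s w))"
        proof (rule AE_I2)
          fix w assume "w \<in> space M"
          then have "continuous_on {0..T} (\<lambda>t. B t w)" using B_cont spM by auto
          from continuous_on_tendsto_compose[OF this q_lim s]
          have "(\<lambda>n. B (q n) w) \<longlonglongrightarrow> B s w" using qT by auto
          then show "(\<lambda>n. indicator A w * iexp (u * (B t w - B (q n) w))) \<longlonglongrightarrow> indicator A w * iexp (u * (B t w - B s w))"
            by (intro tendsto_mult tendsto_const tendsto_exp tendsto_of_real tendsto_diff)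
        qed
      qed (auto simp: norm_mult split: split_indicator)
      moreover have "(\<lambda>n. complex_of_real (M.prob A * exp (- (u\<^sup>2 * (t - q n)) / 2))) \<longlonglongrightarrow> complex_of_real (M.prob A * exp (- (u\<^sup>2 * (t - s)) / 2))"
        by (intro tendsto_intros q_lim) auto
      ultimately have "(CLINT w|M. indicator A w * iexp (u * (B t w - B s w))) = complex_of_real (M.prob A * exp (- (u\<^sup>2 * (t - s)) / 2))"
        unfolding eq by (rule LIMSEQ_unique)
      then show ?thesis using st by simp
    qed
    show "distributed M lborel (\<lambda>w. B t w - B s w) (normal_density 0 (sqrt (t - s)))"
      "M.indep_set (sets (F s)) (sets (vimage_algebra (space M) (\<lambda>w. B t w - B s w) borel))"
      using M.normal_indep_of_char[OF sub Bm _ ch] st by auto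
  qed
  have "brownian_motion T M F B"
    unfolding brownian_motion_def using caB B0 bm spM by (auto intro!: AE_I2)
  moreover have "\<forall>t\<in>{0..T}. distr M borel (X t) \<in> P1"
    unfolding distrM using fl by (auto simp: flow_def)
  moreover have "AE w in M. set_integrable lborel {0..T} (\<lambda>s. b s (X s w) (distr M borel (X s))) \<and>
        (\<forall>t\<in>{0..T}. X t w = x + (LBINT s:{0..t}. b s (X s w) (distr M borel (X s))) + B t w)"
  proof (rule AE_I2, intro conjI ballI)
    fix w assume "w \<in> space M"
    then have w: "w \<in> space P" by (simp add: spM)
    show "set_integrable lborel {0..T} (\<lambda>s. b s (X s w) (distr M borel (X s)))"
      unfolding distrM by (rule flow_drift_integrable[OF fl w]) auto
    show "X t w = x + (LBINT s:{0..t}. b s (X s w) (distr M borel (X s))) + B t w" for t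
      unfolding distrM B_def X_def by simp
  qed
  ultimately have "weak_solution T b x M F B X"
    unfolding weak_solution_def using pM M.complete_measure_axioms usual caX by blast
  then show ?thesis by blast
qed

end

lemma weak_solution_exists:
  assumes T: "T > 0"
    and "(\<lambda>(t, y, \<mu>). b t y \<mu>) \<in> borel_measurable (restrict_space borel {0..T} \<Otimes>\<^sub>M borel \<Otimes>\<^sub>M borel_P1)"
    and "C > 0" "\<And>t y \<mu>. t \<in> {0..T} \<Longrightarrow> \<mu> \<in> P1 \<Longrightarrow> \<bar>b t y \<mu>\<bar> \<le> C * (1 + \<bar>y\<bar> + kantorovich \<mu> (return borel 0))"
    and "\<And>\<mu> \<epsilon>. \<mu> \<in> P1 \<Longrightarrow> \<epsilon> > 0 \<Longrightarrow> \<exists>\<delta>>0. \<forall>\<nu>\<in>P1. kantorovich \<mu> \<nu> < \<delta> \<longrightarrow>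
      (\<forall>t\<in>{0..T}. \<forall>y. \<bar>b t y \<mu> - b t y \<nu>\<bar> < \<epsilon>)"
  shows "\<exists>(M :: (real \<Rightarrow> real) measure) F B X. weak_solution T b x M F B X"
proof -
  interpret g: gaussian_sequence gaussian_product "\<lambda>i w. w (real i)" by (rule gaussian_sequence_product)
  interpret wiener gaussian_product "\<lambda>t w. sqrt T * g.V (t / T) w" T by (rule g.wiener_V[OF T])
  interpret mckean gaussian_product "\<lambda>t w. sqrt T * g.V (t / T) w" T b x C
    by unfold_locales (use assms in auto)
  obtain E where E: "countable E" "Int_stable E" "E \<subseteq> Pow (space gaussian_product)"
    "sets gaussian_product = sigma_sets (space gaussian_product) E"
    by (rule gaussian_product_countably_generated)
  obtain R where "solution_law R" using solution_law_exists[OF E] by blast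
  from weak_solution_of_solution_law[OF this] show ?thesis by blast
qed

section \<open>Continuity of the law of an arbitrary weak solution\<close>

text \<open>
  Let \<open>S\<close> be the closed set of times near which \<open>m\<close> is unbounded. If it is not empty, Baire's theorem gives
  an interval on which \<open>m\<close> is bounded by some \<open>n\<close> at the points of \<open>S\<close>. Any other time \<open>t\<close> of this interval
  is separated from \<open>S\<close> by a segment that ends at a nearest point \<open>a \<in> S\<close>. On the segment \<open>m\<close> is bounded,
  first away from \<open>a\<close> by its value at \<open>t\<close>, then altogether; so \<open>m t\<close> is controlled by \<open>m a \<le> n\<close>. Thus \<open>m\<close> is
  bounded near a point of \<open>S\<close>, a contradiction.
\<close>

lemma bounded_by_Baire:
  fixes m :: "real \<Rightarrow> real"
  assumes T: "T \<ge> 0" and d: "d > 0"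
    and lsc: "\<And>K. closed {t \<in> {0..T}. m t \<le> K}"
    and short: "\<And>p q K. p \<in> {0..T} \<Longrightarrow> q \<in> {0..T} \<Longrightarrow> \<bar>p - q\<bar> \<le> d \<Longrightarrow>
      (\<And>r. r \<in> closed_segment p q \<Longrightarrow> m r \<le> K) \<Longrightarrow> m q \<le> 2 * m p + \<kappa>"
  shows "\<exists>K. \<forall>t\<in>{0..T}. m t \<le> K"
proof -
  define loc where "loc t \<longleftrightarrow> (\<exists>\<delta>>0. \<exists>K. \<forall>r\<in>{0..T}. \<bar>r - t\<bar> < \<delta> \<longrightarrow> m r \<le> K)" for t
  have seg: "\<exists>K. \<forall>r\<in>{u..v}. m r \<le> K"
    if "u \<le> v" and sub: "{u..v} \<subseteq> {0..T}" and l: "\<And>t. t \<in> {u..v} \<Longrightarrow> loc t" for u v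
  proof -
    define I where "I = {u..v}"
    have "\<exists>K. \<forall>r\<in>{u..v} \<inter> I. m r \<le> K"
      using \<open>u \<le> v\<close>
    proof (induction rule: Bolzano)
      case (trans p q r)
      then obtain K K' where "\<forall>s\<in>{p..q} \<inter> I. m s \<le> K" "\<forall>s\<in>{q..r} \<inter> I. m s \<le> K'" by blast
      then have "m y \<le> max K K'" if "y \<in> {p..r} \<inter> I" for y
        using that by (cases "y \<le> q") (auto simp: le_max_iff_disj)
      then show ?case by (intro exI[of _ "max K K'"] ballI)
    next
      case (local t)
      then have "loc t" using l by auto
      then obtain \<delta> K where \<delta>: "\<delta> > 0" "\<And>r. r \<in> {0..T} \<Longrightarrow> \<bar>r - t\<bar> < \<delta> \<Longrightarrow> m r \<le> K" unfolding loc_def by blast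
      show ?case
      proof (rule exI[of _ \<delta>], intro conjI allI impI)
        fix p q assume pq: "p \<le> t \<and> t \<le> q \<and> q - p < \<delta>"
        have "m r \<le> K" if "r \<in> {p..q} \<inter> I" for r
          using that pq sub by (intro \<delta>(2)) (auto simp: I_def)
        then show "\<exists>K. \<forall>r\<in>{p..q} \<inter> I. m r \<le> K" by blast
      qed (rule \<delta>(1))
    qed
    then show ?thesis by (simp add: I_def)
  qed
  define S where "S = {t \<in> {0..T}. \<not> loc t}"
  have "closed S"
  proof -
    have "open {t. loc t}"
      unfolding open_dist
    proof (intro ballI)
      fix t assume "t \<in> {t. loc t}"
      then obtain \<delta> K where \<delta>: "\<delta> > 0" "\<And>r. r \<in> {0..T} \<Longrightarrow> \<bar>r - t\<bar> < \<delta> \<Longrightarrow> m r \<le> K" unfolding loc_def by blast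
      have "loc y" if "dist y t < \<delta> / 2" for y
        unfolding loc_def
      proof (rule exI[of _ "\<delta> / 2"], intro exI[of _ K] conjI ballI impI)
        fix r assume r: "r \<in> {0..T}" "\<bar>r - y\<bar> < \<delta> / 2"
        have "\<bar>r - t\<bar> < \<delta>" using r(2) that unfolding dist_real_def by argo
        then show "m r \<le> K" using r(1) by (intro \<delta>(2))
      qed (use \<delta> in simp)
      then show "\<exists>e>0. \<forall>y. dist y t < e \<longrightarrow> y \<in> {t. loc t}"
        using \<delta>(1) by (intro exI[of _ "\<delta> / 2"]) auto
    qed
    then have "closed ({0..T} - {t. loc t})" by (intro closed_Diff) auto
    moreover have "S = {0..T} - {t. loc t}" by (auto simp: S_def)
    ultimately show ?thesis by simp
  qed
  have "S = {}"
  proof (rule ccontr)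
    assume "S \<noteq> {}"
    \<comment> \<open>The sets \<open>U n\<close> are relatively open with empty intersection, so one of them is not dense in \<open>S\<close>.\<close>
    define U where "U n = {t \<in> S. m t > real n}" for n :: nat
    have opU: "openin (top_of_set S) (U n)" for n
    proof -
      have "U n = S \<inter> (- {t \<in> {0..T}. m t \<le> real n})" by (auto simp: U_def S_def)
      moreover have "open (- {t \<in> {0..T}. m t \<le> real n})" using lsc by (rule open_Compl)
      ultimately show ?thesis by (simp only: openin_open_Int)
    qed
    have "\<not> (\<forall>n. S \<subseteq> closure (U n))"
    proof
      assume dense: "\<forall>n. S \<subseteq> closure (U n)"
      have "S \<subseteq> closure (\<Inter>(range U))"
        by (rule Baire[OF \<open>closed S\<close>]) (use opU dense in auto)
      moreover have "\<Inter>(range U) = {}"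
      proof (rule ccontr)
        assume "\<Inter>(range U) \<noteq> {}"
        then obtain t where t: "\<And>n. t \<in> U n" by blast
        obtain n :: nat where "m t \<le> real n" using real_arch_simple by blast
        then show False using t[of n] by (simp add: U_def)
      qed
      ultimately show False using \<open>S \<noteq> {}\<close> by simp
    qed
    then obtain n z where z: "z \<in> S" "z \<notin> closure (U n)" by blast
    then obtain \<delta> where \<delta>: "\<delta> > 0" "\<And>t. t \<in> U n \<Longrightarrow> \<delta> \<le> \<bar>t - z\<bar>"
      unfolding closure_approachable by (auto simp: dist_real_def not_less)
    define \<eta> where "\<eta> = min \<delta> d"
    have \<eta>: "\<eta> > 0" "\<eta> \<le> \<delta>" "\<eta> \<le> d" using \<delta> d by (auto simp: \<eta>_def)
    have S_small: "m t \<le> real n" if "t \<in> S" "\<bar>t - z\<bar> < \<eta>" for t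
      using \<delta>(2)[of t] that \<eta> by (force simp: U_def not_less)
    have zT: "z \<in> {0..T}" using z by (simp add: S_def)
    have "m t \<le> max (real n) (2 * real n + \<kappa>)" if t: "t \<in> {0..T}" "\<bar>t - z\<bar> < \<eta>" for t
    proof (cases "t \<in> S")
      case True
      then show ?thesis using S_small t by (simp add: le_max_iff_disj)
    next
      case False
      have "compact (S \<inter> closed_segment z t)"
        using \<open>closed S\<close> by (intro closed_Int_compact compact_segment)
      moreover have "S \<inter> closed_segment z t \<noteq> {}" using z by auto
      ultimately obtain a where a: "a \<in> S \<inter> closed_segment z t"
        and near: "\<And>y. y \<in> S \<inter> closed_segment z t \<Longrightarrow> dist t a \<le> dist t y"
        using distance_attains_inf[of "S \<inter> closed_segment z t" t] compact_imp_closed by blast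
      have aT: "a \<in> {0..T}" using a by (simp add: S_def)
      have seg_sub: "closed_segment a t \<subseteq> closed_segment z t" using a by (simp add: subset_closed_segment)
      have seg_T: "closed_segment z t \<subseteq> {0..T}"
        using zT t by (auto simp: closed_segment_eq_real_ivl split: if_splits)
      have dist_le: "\<bar>p - q\<bar> \<le> \<bar>t - z\<bar>" if "p \<in> closed_segment z t" "q \<in> closed_segment z t" for p q
        using that by (auto simp: closed_segment_eq_real_ivl split: if_splits)
      have free: "y \<notin> S" if "y \<in> closed_segment a t" "y \<noteq> a" for y
      proof
        assume "y \<in> S"
        then have "dist t a \<le> dist t y" using near that(1) seg_sub by blast
        then show False using that by (auto simp: closed_segment_eq_real_ivl dist_real_def split: if_splits)
      qed
      \<comment> \<open>A segment from \<open>t\<close> that stops before \<open>a\<close> is a compact set of times near which \<open>m\<close> is bounded.\<close>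
      have backward: "m s \<le> 2 * m t + \<kappa>" if s: "s \<in> closed_segment a t" "s \<noteq> a" for s
      proof -
        have st: "closed_segment s t \<subseteq> closed_segment a t" using s by (simp add: subset_closed_segment)
        have "a \<notin> closed_segment s t" using s by (auto simp: closed_segment_eq_real_ivl split: if_splits)
        then have l: "loc y" if "y \<in> closed_segment s t" for y
        proof -
          have "y \<in> closed_segment a t" "y \<noteq> a" using that st \<open>a \<notin> closed_segment s t\<close> by auto
          then show ?thesis using free[of y] seg_sub seg_T by (auto simp: S_def)
        qed
        have "\<exists>K. \<forall>r\<in>{min s t..max s t}. m r \<le> K"
        proof (rule seg)
          have e: "{min s t..max s t} = closed_segment s t" by (auto simp: closed_segment_eq_real_ivl)
          show "{min s t..max s t} \<subseteq> {0..T}" unfolding e using st seg_sub seg_T by blast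
          show "loc y" if "y \<in> {min s t..max s t}" for y using that l unfolding e by blast
        qed simp
        moreover have "closed_segment t s = {min s t..max s t}" by (auto simp: closed_segment_eq_real_ivl)
        ultimately obtain K where K: "\<And>r. r \<in> closed_segment t s \<Longrightarrow> m r \<le> K" by metis
        show ?thesis
        proof (rule short[OF _ _ _ K])
          show "t \<in> {0..T}" "s \<in> {0..T}" using t s seg_sub seg_T by auto
          show "\<bar>t - s\<bar> \<le> d" using dist_le[of t s] s seg_sub t \<eta> by force
        qed
      qed
      have "m t \<le> 2 * m a + \<kappa>"
      proof (rule short)
        show "a \<in> {0..T}" "t \<in> {0..T}" by (fact aT t)+
        show "\<bar>a - t\<bar> \<le> d" using dist_le[of a t] a t \<eta> by force
        show "m r \<le> max (m a) (2 * m t + \<kappa>)" if "r \<in> closed_segment a t" for r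
          using backward[OF that] by (cases "r = a") auto
      qed
      moreover have "m a \<le> real n"
        using a dist_le[of a z] t by (intro S_small) auto
      ultimately show ?thesis by simp
    qed
    then have "loc z" unfolding loc_def using \<eta>(1) by blast
    then show False using z by (simp add: S_def)
  qed
  then have "\<exists>K. \<forall>r\<in>{0..T}. m r \<le> K" using T by (intro seg) (auto simp: S_def)
  then show ?thesis .
qed

text \<open>
  Everything follows from the increment bound on intervals where \<open>m t = E\<bar>X t\<bar>\<close> is bounded by some \<open>S\<close>:
  the linear growth of \<open>b\<close> in \<open>\<bar>X\<bar>\<close> and in the law contributes \<open>C (1 + 2 S)\<close> per unit of time.
\<close>

lemma weak_solution_law_continuous:
  assumes T: "T > 0" and C: "C > 0"
    and growth: "\<And>t y \<mu>. t \<in> {0..T} \<Longrightarrow> \<mu> \<in> P1 \<Longrightarrow> \<bar>b t y \<mu>\<bar> \<le> C * (1 + \<bar>y\<bar> + kantorovich \<mu> (return borel 0))"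
    and sol: "weak_solution T b x M F B X"
  shows "continuous_map (top_of_set {0..T}) P1.mtopology (\<lambda>t. distr M borel (X t))"
proof -
  define law where "law t = distr M borel (X t)" for t
  interpret prob_space M using sol by (simp add: weak_solution_def)
  have sub: "subalgebra M (F t)" if "t \<in> {0..T}" for t
    using sol that by (simp add: weak_solution_def usual_filtration_def)
  have Xm: "X t \<in> borel_measurable M" if "t \<in> {0..T}" for t
    using sol that by (intro measurable_from_subalg[OF sub]) (auto simp: weak_solution_def continuous_adapted_def)
  have Bm: "B t \<in> borel_measurable M" if "t \<in> {0..T}" for t
    using sol that by (intro measurable_from_subalg[OF sub]) (auto simp: weak_solution_def brownian_motion_def continuous_adapted_def)
  have Xc: "continuous_on {0..T} (\<lambda>t. X t w)" if "w \<in> space M" for w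
    using sol that by (simp add: weak_solution_def continuous_adapted_def)
  have lawP: "law t \<in> P1" if "t \<in> {0..T}" for t using sol that by (simp add: weak_solution_def law_def)
  have Xi: "integrable M (X t)" if "t \<in> {0..T}" for t
    using lawP[OF that] Xm[OF that] by (simp add: law_def distr_in_P1_iff)
  have B1: "(\<integral>\<^sup>+w. ennreal \<bar>B t w - B s w\<bar> \<partial>M) \<le> ennreal (sqrt (t - s))" if "0 \<le> s" "s \<le> t" "t \<le> T" for s t
  proof (cases "s = t")
    case False
    have d: "distributed M lborel (\<lambda>w. B t w - B s w) (normal_density 0 (sqrt (t - s)))"
      using sol that False by (auto simp: weak_solution_def brownian_motion_def)
    have "integrable M (\<lambda>w. \<bar>B t w - B s w\<bar>)" "expectation (\<lambda>w. \<bar>B t w - B s w\<bar>) \<le> sqrt (t - s)"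
      using abs_mean_le[of "\<lambda>w. B t w - B s w" "sqrt (t - s)"] distributed_normal_square[OF d] Bm[of s] Bm[of t] that False
      by auto
    then show ?thesis by (simp add: nn_integral_eq_integral ennreal_leI)
  qed simp
  define m where "m t = expectation (\<lambda>w. \<bar>X t w\<bar>)" for t
  have m_nn: "0 \<le> m t" for t unfolding m_def by simp
  have dirac: "kantorovich (law t) (return borel 0) \<le> m t" if "t \<in> {0..T}" for t
    using kantorovich_dirac_le[OF lawP[OF that]] Xm[OF that] unfolding law_def m_def by (simp add: integral_distr)
  define cl where "cl r = max 0 (min T r)" for r :: real
  have cl: "cl r \<in> {0..T}" for r using T by (auto simp: cl_def)
  have cl_id: "cl r = r" if "r \<in> {0..T}" for r using that by (auto simp: cl_def)
  have joint: "(\<lambda>(r, w). X (cl r) w) \<in> borel_measurable (borel \<Otimes>\<^sub>M M)"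
  proof (rule borel_measurable_continuous_process)
    show "X (cl r) \<in> borel_measurable M" for r by (rule Xm[OF cl])
    show "continuous_on UNIV (\<lambda>r. X (cl r) w)" if "w \<in> space M" for w
      by (rule continuous_on_compose2[OF Xc[OF that]]) (use cl in \<open>auto simp: cl_def intro!: continuous_intros\<close>)
  qed
  have joint': "(\<lambda>(r, w). X (cl r) w) \<in> borel_measurable (lborel \<Otimes>\<^sub>M M)"
    using joint by (simp cong: measurable_cong_sets add: sets_pair_measure_cong[of lborel borel M M])
  have m_meas[measurable]: "(\<lambda>r. m (cl r)) \<in> borel_measurable borel"
    unfolding m_def by (rule borel_measurable_lebesgue_integral) (use joint in measurable)
  interpret LM: pair_sigma_finite lborel M ..
  have increment: "expectation (\<lambda>w. \<bar>X t w - X s w\<bar>) \<le> sqrt (t - s) + C * (1 + 2 * S) * (t - s)"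
    if st: "0 \<le> s" "s \<le> t" "t \<le> T" and S: "\<And>r. r \<in> {s..t} \<Longrightarrow> m r \<le> S" for s t S
  proof -
    have sT: "s \<in> {0..T}" and tT: "t \<in> {0..T}" using st by auto
    have S0: "S \<ge> 0" using S[of s] m_nn[of s] st by simp
    let ?g = "\<lambda>w r. b r (X r w) (law r)"
    let ?k = "\<lambda>w r. ennreal (indicator {s..t} r * (C * (1 + \<bar>X (cl r) w\<bar> + m (cl r))))"
    have km: "(\<lambda>(r, w). ?k w r) \<in> borel_measurable (lborel \<Otimes>\<^sub>M M)"
      using joint' by measurable
    have path: "AE w in M. ennreal \<bar>X t w - X s w\<bar> \<le> ennreal \<bar>B t w - B s w\<bar> + (\<integral>\<^sup>+r. ?k w r \<partial>lborel)"
    proof -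
      have "AE w in M. set_integrable lborel {0..T} (?g w) \<and>
        (\<forall>t\<in>{0..T}. X t w = x + (LBINT r:{0..t}. ?g w r) + B t w)"
        using sol by (simp add: weak_solution_def law_def)
      then show ?thesis
      proof eventually_elim
        case (elim w)
        have gt: "set_integrable lborel {0..t} (?g w)" and gst: "set_integrable lborel {s..t} (?g w)"
          using elim st by (auto intro: set_integrable_subset[of lborel "{0..T}"])
        have "X t w - X s w = (LBINT r:{s..t}. ?g w r) + (B t w - B s w)"
          using elim sT tT set_integral_interval_add[OF gt st(1,2)] by auto
        then have "\<bar>X t w - X s w\<bar> \<le> \<bar>B t w - B s w\<bar> + \<bar>LBINT r:{s..t}. ?g w r\<bar>" by linarith
        then have "ennreal \<bar>X t w - X s w\<bar> \<le> ennreal (\<bar>B t w - B s w\<bar> + \<bar>LBINT r:{s..t}. ?g w r\<bar>)"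
          by (rule ennreal_leI)
        also have "\<dots> = ennreal \<bar>B t w - B s w\<bar> + ennreal \<bar>LBINT r:{s..t}. ?g w r\<bar>"
          by (rule ennreal_plus) auto
        also have "ennreal \<bar>LBINT r:{s..t}. ?g w r\<bar> \<le> (\<integral>\<^sup>+r. ennreal (norm (indicator {s..t} r *\<^sub>R ?g w r)) \<partial>lborel)"
          using integral_norm_bound_ennreal[of lborel "\<lambda>r. indicator {s..t} r *\<^sub>R ?g w r"] gst
          unfolding set_integrable_def set_lebesgue_integral_def by simp
        also have "\<dots> \<le> (\<integral>\<^sup>+r. ?k w r \<partial>lborel)"
        proof (intro nn_integral_mono ennreal_leI)
          fix r
          show "norm (indicator {s..t} r *\<^sub>R ?g w r) \<le> indicator {s..t} r * (C * (1 + \<bar>X (cl r) w\<bar> + m (cl r)))"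
          proof (cases "r \<in> {s..t}")
            case True
            then have r: "r \<in> {0..T}" using st by auto
            have "\<bar>?g w r\<bar> \<le> C * (1 + \<bar>X r w\<bar> + kantorovich (law r) (return borel 0))"
              by (rule growth[OF r lawP[OF r]])
            also have "\<dots> \<le> C * (1 + \<bar>X r w\<bar> + m r)"
              using dirac[OF r] C by (intro mult_left_mono) auto
            finally show ?thesis using True by (simp add: cl_id[OF r])
          qed simp
        qed
        finally show ?case by (simp add: add_left_mono)
      qed
    qed
    have inner: "(\<integral>\<^sup>+w. ?k w r \<partial>M) \<le> ennreal (C * (1 + 2 * S)) * indicator {s..t} r" for r
    proof (cases "r \<in> {s..t}")
      case True
      then have r: "r \<in> {0..T}" using st by auto
      have "(\<integral>\<^sup>+w. ?k w r \<partial>M) = (\<integral>\<^sup>+w. ennreal (C * (1 + \<bar>X r w\<bar> + m r)) \<partial>M)"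
        using True by (simp add: cl_id[OF r])
      also have "\<dots> = ennreal (expectation (\<lambda>w. C * (1 + \<bar>X r w\<bar> + m r)))"
        using Xi[OF r] C m_nn by (intro nn_integral_eq_integral) auto
      also have "expectation (\<lambda>w. C * (1 + \<bar>X r w\<bar> + m r)) = C * (1 + 2 * m r)"
        using Xi[OF r] by (simp add: prob_space m_def)
      also have "\<dots> \<le> C * (1 + 2 * S)" using S[OF True] C by simp
      finally show ?thesis using True by (simp add: ennreal_leI)
    qed simp
    have "ennreal (expectation (\<lambda>w. \<bar>X t w - X s w\<bar>)) = (\<integral>\<^sup>+w. ennreal \<bar>X t w - X s w\<bar> \<partial>M)"
      using Xi[OF sT] Xi[OF tT] by (intro nn_integral_eq_integral[symmetric]) auto
    also have "\<dots> \<le> (\<integral>\<^sup>+w. ennreal \<bar>B t w - B s w\<bar> + (\<integral>\<^sup>+r. ?k w r \<partial>lborel) \<partial>M)"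
      by (rule nn_integral_mono_AE[OF path])
    also have "\<dots> = (\<integral>\<^sup>+w. ennreal \<bar>B t w - B s w\<bar> \<partial>M) + (\<integral>\<^sup>+w. \<integral>\<^sup>+r. ?k w r \<partial>lborel \<partial>M)"
    proof (rule nn_integral_add)
      show "(\<lambda>w. ennreal \<bar>B t w - B s w\<bar>) \<in> borel_measurable M" using Bm[OF sT] Bm[OF tT] by measurable
      show "(\<lambda>w. \<integral>\<^sup>+r. ?k w r \<partial>lborel) \<in> borel_measurable M"
        using km by (intro lborel.borel_measurable_nn_integral) (simp add: measurable_pair_swap_iff[of _ M] case_prod_beta)
    qed
    also have "(\<integral>\<^sup>+w. \<integral>\<^sup>+r. ?k w r \<partial>lborel \<partial>M) = (\<integral>\<^sup>+r. \<integral>\<^sup>+w. ?k w r \<partial>M \<partial>lborel)"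
      by (rule LM.Fubini'[OF km])
    also have "\<dots> \<le> (\<integral>\<^sup>+r. ennreal (C * (1 + 2 * S)) * indicator {s..t} r \<partial>lborel)"
      by (rule nn_integral_mono[OF inner])
    also have "\<dots> = ennreal (C * (1 + 2 * S) * (t - s))"
      using st C S0 by (subst nn_integral_cmult_indicator) (auto simp: ennreal_mult)
    also have "(\<integral>\<^sup>+w. ennreal \<bar>B t w - B s w\<bar> \<partial>M) \<le> ennreal (sqrt (t - s))" by (rule B1[OF st])
    finally have "ennreal (expectation (\<lambda>w. \<bar>X t w - X s w\<bar>)) \<le> ennreal (sqrt (t - s)) + ennreal (C * (1 + 2 * S) * (t - s))"
      by (simp add: add_mono)
    also have "\<dots> = ennreal (sqrt (t - s) + C * (1 + 2 * S) * (t - s))"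
      using st C S0 by (intro ennreal_plus[symmetric]) auto
    finally show ?thesis using st C S0 by (subst (asm) ennreal_le_iff) auto
  qed
  have m_diff: "m q \<le> m p + expectation (\<lambda>w. \<bar>X q w - X p w\<bar>)" if "p \<in> {0..T}" "q \<in> {0..T}" for p q
  proof -
    have "m q \<le> expectation (\<lambda>w. \<bar>X p w\<bar> + \<bar>X q w - X p w\<bar>)"
      unfolding m_def using Xi[OF that(1)] Xi[OF that(2)] by (intro integral_mono) auto
    then show ?thesis using Xi[OF that(1)] Xi[OF that(2)] by (simp add: m_def)
  qed
  obtain K where K: "\<And>t. t \<in> {0..T} \<Longrightarrow> m t \<le> K"
  proof -
    have "\<exists>K. \<forall>t\<in>{0..T}. m t \<le> K"
    \<comment> \<open>On an interval of length \<open>1 / (4 C)\<close> the increment bound is \<open>sqrt T + 1/4 + S / 2\<close>; with \<open>S\<close> the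
      supremum of \<open>m\<close> there, the last term can be absorbed.\<close>
    proof (rule bounded_by_Baire[where d = "1 / (4 * C)" and \<kappa> = "2 * sqrt T + 1/2"])
      show "closed {t \<in> {0..T}. m t \<le> K}" for K
      proof (unfold closed_sequential_limits, intro allI impI, elim conjE)
        fix u t assume u: "\<forall>n. u n \<in> {t \<in> {0..T}. m t \<le> K}" and lim: "u \<longlonglongrightarrow> t"
        then have uT: "u n \<in> {0..T}" and uK: "m (u n) \<le> K" for n by auto
        have t: "t \<in> {0..T}" by (rule closed_sequentially[OF closed_atLeastAtMost _ lim]) (use uT in auto)
        have K0: "K \<ge> 0" using m_nn uK order_trans by blast
        have "ennreal (m t) = (\<integral>\<^sup>+w. ennreal \<bar>X t w\<bar> \<partial>M)"
          unfolding m_def using Xi[OF t] by (intro nn_integral_eq_integral[symmetric]) auto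
        also have "\<dots> = (\<integral>\<^sup>+w. liminf (\<lambda>n. ennreal \<bar>X (u n) w\<bar>) \<partial>M)"
        proof (rule nn_integral_cong)
          fix w assume "w \<in> space M"
          from continuous_on_tendsto_compose[OF Xc[OF this] lim t]
          have "(\<lambda>n. X (u n) w) \<longlonglongrightarrow> X t w" using uT by auto
          then have "(\<lambda>n. ennreal \<bar>X (u n) w\<bar>) \<longlonglongrightarrow> ennreal \<bar>X t w\<bar>" by (intro tendsto_ennrealI tendsto_rabs)
          then show "ennreal \<bar>X t w\<bar> = liminf (\<lambda>n. ennreal \<bar>X (u n) w\<bar>)"
            by (rule lim_imp_Liminf[OF trivial_limit_sequentially, symmetric])
        qed
        also have "\<dots> \<le> liminf (\<lambda>n. \<integral>\<^sup>+w. ennreal \<bar>X (u n) w\<bar> \<partial>M)"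
          using Xm[OF uT] by (intro nn_integral_liminf) measurable
        also have "\<dots> \<le> ennreal K"
        proof (rule Liminf_le)
          have "(\<integral>\<^sup>+w. ennreal \<bar>X (u n) w\<bar> \<partial>M) \<le> ennreal K" for n
            using Xi[OF uT[of n]] uK[of n] by (simp add: nn_integral_eq_integral m_def ennreal_leI)
          then show "\<forall>\<^sub>F n in sequentially. (\<integral>\<^sup>+w. ennreal \<bar>X (u n) w\<bar> \<partial>M) \<le> ennreal K" by simp
        qed simp
        finally show "t \<in> {t \<in> {0..T}. m t \<le> K}" using t K0 by simp
      qed
    next
      fix p q K
      assume p: "p \<in> {0..T}" and q: "q \<in> {0..T}" and pq: "\<bar>p - q\<bar> \<le> 1 / (4 * C)"
        and K: "\<And>r. r \<in> closed_segment p q \<Longrightarrow> m r \<le> K"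
      define S where "S = (SUP r\<in>closed_segment p q. m r)"
      have bdd: "bdd_above (m ` closed_segment p q)" using K by (auto intro!: bdd_aboveI2)
      have S: "m r \<le> S" if "r \<in> closed_segment p q" for r unfolding S_def using that bdd by (intro cSUP_upper)
      have S0: "S \<ge> 0" using S[of p] m_nn[of p] by simp
      have "m r \<le> m p + (sqrt T + 1/4 + S/2)" if r: "r \<in> closed_segment p q" for r
      proof -
        have rT: "r \<in> {0..T}" using r p q by (auto simp: closed_segment_eq_real_ivl split: if_splits)
        have sub: "closed_segment p r \<subseteq> closed_segment p q" using r by (simp add: subset_closed_segment)
        have rp: "\<bar>r - p\<bar> \<le> \<bar>p - q\<bar>" using r by (auto simp: closed_segment_eq_real_ivl split: if_splits)
        have "expectation (\<lambda>w. \<bar>X r w - X p w\<bar>) \<le> sqrt \<bar>r - p\<bar> + C * (1 + 2 * S) * \<bar>r - p\<bar>"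
        proof (cases "p \<le> r")
          case True
          then have "m y \<le> S" if "y \<in> {p..r}" for y using that sub by (intro S) (auto simp: closed_segment_eq_real_ivl)
          then have "expectation (\<lambda>w. \<bar>X r w - X p w\<bar>) \<le> sqrt (r - p) + C * (1 + 2 * S) * (r - p)"
            using p rT True by (intro increment) auto
          then show ?thesis using True by simp
        next
          case False
          then have "m y \<le> S" if "y \<in> {r..p}" for y using that sub by (intro S) (auto simp: closed_segment_eq_real_ivl)
          then have "expectation (\<lambda>w. \<bar>X p w - X r w\<bar>) \<le> sqrt (p - r) + C * (1 + 2 * S) * (p - r)"
            using p rT False by (intro increment) auto
          then show ?thesis using False by (simp add: abs_minus_commute)
        qed
        also have "\<dots> \<le> sqrt T + C * (1 + 2 * S) * (1 / (4 * C))"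
          using rp pq p rT C S0 by (intro add_mono mult_left_mono real_sqrt_le_mono) auto
        also have "C * (1 + 2 * S) * (1 / (4 * C)) = 1/4 + S/2" using C by (simp add: field_simps)
        finally show ?thesis using m_diff[OF p rT] by simp
      qed
      then have "S \<le> m p + (sqrt T + 1/4 + S/2)" unfolding S_def by (intro cSUP_least) auto
      then show "m q \<le> 2 * m p + (2 * sqrt T + 1/2)" using S[of q] by simp
    qed (use T C in auto)
    then show thesis using that by blast
  qed
  show ?thesis
    unfolding law_def[symmetric]
  proof (rule continuous_map_P1I[OF lawP])
    fix s t assume st: "0 \<le> s" "s \<le> t" "t \<le> T"
    then have s: "s \<in> {0..T}" and t: "t \<in> {0..T}" by auto
    have "kantorovich (law s) (law t) \<le> expectation (\<lambda>w. \<bar>X s w - X t w\<bar>)"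
      unfolding law_def by (rule kantorovich_distr_le[OF Xi[OF s] Xi[OF t]])
    also have "\<dots> = expectation (\<lambda>w. \<bar>X t w - X s w\<bar>)" by (simp add: abs_minus_commute)
    also have "\<dots> \<le> sqrt (t - s) + C * (1 + 2 * K) * (t - s)"
      using st K by (intro increment) auto
    finally show "kantorovich (law s) (law t) \<le> sqrt (t - s) + (C * (1 + 2 * K)) * (t - s)" .
  qed
qed

section \<open>Existence of weak solutions and continuity of their laws\<close>

theorem theorem2p3:
  fixes T x :: real
    and b :: "real \<Rightarrow> real \<Rightarrow> real measure \<Rightarrow> real"
  assumes "T > 0"
    and measurable: "(\<lambda>(t, y, \<mu>). b t y \<mu>) \<in>
      borel_measurable (restrict_space borel {0..T} \<Otimes>\<^sub>M borel \<Otimes>\<^sub>M borel_P1)"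
    and linear_growth: "\<exists>C>0. \<forall>t\<in>{0..T}. \<forall>y. \<forall>\<mu>\<in>P1.
      \<bar>b t y \<mu>\<bar> \<le> C * (1 + \<bar>y\<bar> + kantorovich \<mu> (return borel 0))"
    and continuity: "\<forall>\<mu>\<in>P1. \<forall>\<epsilon>>0. \<exists>\<delta>>0. \<forall>\<nu>\<in>P1. kantorovich \<mu> \<nu> < \<delta> \<longrightarrow>
      (\<forall>t\<in>{0..T}. \<forall>y. \<bar>b t y \<mu> - b t y \<nu>\<bar> < \<epsilon>)"
  shows "(\<exists>(M :: (real \<Rightarrow> real) measure) F B X. weak_solution T b x M F B X) \<and>
    (\<forall>(M :: 'w measure) F B X. weak_solution T b x M F B X \<longrightarrow>
       continuous_map (top_of_set {0..T}) P1.mtopology (\<lambda>t. distr M borel (X t)))"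
proof -
  obtain C where C: "C > 0" and growth: "\<And>t y \<mu>. t \<in> {0..T} \<Longrightarrow> \<mu> \<in> P1 \<Longrightarrow>
      \<bar>b t y \<mu>\<bar> \<le> C * (1 + \<bar>y\<bar> + kantorovich \<mu> (return borel 0))"
    using linear_growth by blast
  have cont: "\<exists>\<delta>>0. \<forall>\<nu>\<in>P1. kantorovich \<mu> \<nu> < \<delta> \<longrightarrow> (\<forall>t\<in>{0..T}. \<forall>y. \<bar>b t y \<mu> - b t y \<nu>\<bar> < \<epsilon>)"
    if "\<mu> \<in> P1" "\<epsilon> > 0" for \<mu> \<epsilon>
    using continuity that by blast
  show ?thesis
  proof (intro conjI allI impI)
    show "\<exists>(M :: (real \<Rightarrow> real) measure) F B X. weak_solution T b x M F B X"
      by (rule weak_solution_exists[OF \<open>T > 0\<close> measurable C growth cont])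
    fix M :: "'w measure" and F B X
    assume sol: "weak_solution T b x M F B X"
    show "continuous_map (top_of_set {0..T}) P1.mtopology (\<lambda>t. distr M borel (X t))"
      by (rule weak_solution_law_continuous[where C = C]) (fact \<open>T > 0\<close> C growth sol)+
  qed
qed

end
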